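(* Let $k$ be algebraically closed of characteristic $0$ and $\mathcal A$ the $N=2$ conformal superalgebra. Up to isomorphism of $k$-conformal superalgebras there are exactly two twisted loop algebras of $\mathcal A$, namely $\mathcal L(\mathcal A,\mathrm{id})=\mathcal A\otimes_kR$ and $\mathcal L(\mathcal A,\omega)$, where $\omega$ is the order-two automorphism of $\mathcal A$ with $L\mapsto L$, $J\mapsto-J$, $G^+\mapsto G^-$, $G^-\mapsto G^+$. Furthermore, every $\widehat{\mathcal S}/\mathcal R$-form of $\mathcal A\otimes_k\mathcal R$ is isomorphic (as $\mathcal R$-conformal superalgebra) to one of these two loop algebras, and these two are not isomorphic.
   Context: Notation: $R=k[t^{\pm1}]$, $S_m=k[t^{\pm1/m}]$, $\widehat S=k[t^q:q\in\mathbb Q]$, $\delta_t=d/dt$, $\mathcal R=(R,\delta_t)$, $\widehat{\mathcal S}=(\widehat S,\delta_t)$; fixed compatible primitive roots of unity $\xi_m\in k$. Over a differential ring $(R,\delta_R)$, a conformal superalgebra is a $\mathbb Z/2\mathbb Z$-graded $R$-module with parity-preserving $k$-linear $\partial$ and $k$-bilinear products $a_{(n)}b$ satisfying $a_{(n)}b=0$ for $n\gg0$, $(\partial a)_{(n)}b=-na_{(n-1)}b$, $a_{(n)}\partial b=\partial(a_{(n)}b)+na_{(n-1)}b$, $\partial(ra)=r\partial a+\delta_R(r)a$, $a_{(n)}(rb)=r(a_{(n)}b)$, $(ra)_{(n)}b=\sum_j\frac1{j!}\delta_R^j(r)(a_{(n+j)}b)$; homomorphisms are even $R$-linear maps preserving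 $n$-products and commuting with $\partial$. Base change $\mathcal B\otimes_{\mathcal R}\mathcal S$: $\partial\otimes1+1\otimes\delta_S$, $(a\otimes r)_{(n)}(b\otimes s)=\sum_j(a_{(n+j)}b)\otimes\frac1{j!}\delta_S^j(r)s$. An $\widehat{\mathcal S}/\mathcal R$-form of $\mathcal B$ is an $\mathcal R$-conformal superalgebra $\mathcal F$ with $\mathcal F\otimes_{\mathcal R}\widehat{\mathcal S}\cong\mathcal B\otimes_{\mathcal R}\widehat{\mathcal S}$. The $N=2$ conformal superalgebra is $\mathcal A=k[\partial]\otimes V$, $V_{\bar0}=kL\oplus kJ$, $V_{\bar1}=kG^+\oplus kG^-$, with $\lambda$-brackets ($[a_\lambda b]=\sum\frac{\lambda^n}{n!}a_{(n)}b$) $[L_\lambda L]=(\partial+2\lambda)L$, $[L_\lambda J]=(\partial+\lambda)J$, $[L_\lambda G^\pm]=(\partial+\frac32\lambda)G^\pm$, $[J_\lambda J]=0$, $[J_\lambda G^\pm]=\pm G^\pm$, $[G^\pm{}_\lambda G^\pm]=0$, $[G^+{}_\lambda G^-]=L+\frac12(\partial+2\lambda)J$ (others by skew-symmetry). For a $k$-conformal automorphism $\sigma$ of $\mathcal A$ with $\sigma^m=\mathrm{id}$, set $\mathcal A_i=\{x:\sigma x=\xi_m^ix\}$ and $\mathcal L(\mathcal A,\sigma)=\bigoplus_{i\in\mathbb Z}\mathcal A_i\otimes t^{i/m}\subseteq\mathcal A\otimes_kS_m$ (twisted loop algebra), an $\mathcal R$-conformal superalgebra (with derivation $\partial\otimes1+1\otimes\delta_t$),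 hence also a $k$-conformal superalgebra by restriction. *)

theory Defs
  imports "HOL-Library.Poly_Mapping" "HOL-Library.Function_Algebras"
          "HOL-Computational_Algebra.Polynomial"
begin

text \<open>An element of S-hat = k[t^q : q rational] is a finitely supported map rat => k
  (coefficient of t^q).  Multiplication is the convolution product of Poly_Mapping.
  The subrings k (constants) and R = k[t, t^-1] are subsets; S-hat is UNIV.\<close>

type_synonym 'k puis = "rat \<Rightarrow>\<^sub>0 'k"

definition tpow :: "rat \<Rightarrow> 'k::comm_ring_1 puis" where
  "tpow q = Poly_Mapping.single q 1"

definition kconst :: "'k \<Rightarrow> 'k::comm_ring_1 puis" where
  "kconst c = Poly_Mapping.single 0 c"

definition puis_deriv :: "'k::field_char_0 puis \<Rightarrow> 'k puis" where
  "puis_deriv f = (\<Sum>q\<in>Poly_Mapping.keys f. Poly_Mapping.single (q - 1) (of_rat q * Poly_Mapping.lookup f q))"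

definition k_set :: "'k::comm_ring_1 puis set" where
  "k_set = {f. Poly_Mapping.keys f \<subseteq> {0}}"

definition R_set :: "'k::comm_ring_1 puis set" where
  "R_set = {f. Poly_Mapping.keys f \<subseteq> \<int>}"

record (overloaded) ('k::zero, 'a) csa =
  cs_carrier :: "'a set"
  cs_smul :: "'k puis \<Rightarrow> 'a \<Rightarrow> 'a"
  cs_even :: "'a set"
  cs_odd :: "'a set"
  cs_der :: "'a \<Rightarrow> 'a"
  cs_prod :: "nat \<Rightarrow> 'a \<Rightarrow> 'a \<Rightarrow> 'a"

definition nsmul :: "nat \<Rightarrow> 'a::comm_monoid_add \<Rightarrow> 'a" where
  "nsmul n x = (\<Sum>i<n. x)"

definition is_submod :: "'k::zero puis set \<Rightarrow> ('k, 'a::ab_group_add) csa \<Rightarrow> 'a set \<Rightarrow> bool" where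
  "is_submod D S N \<longleftrightarrow> N \<subseteq> cs_carrier S \<and> 0 \<in> N \<and> (\<forall>a\<in>N. \<forall>b\<in>N. a + b \<in> N)
     \<and> (\<forall>a\<in>N. - a \<in> N) \<and> (\<forall>r\<in>D. \<forall>a\<in>N. cs_smul S r a \<in> N)"

definition is_csa :: "'k::field_char_0 puis set \<Rightarrow> ('k, 'a::ab_group_add) csa \<Rightarrow> bool" where
  "is_csa D S \<longleftrightarrow>
    (let M = cs_carrier S; sm = cs_smul S; E = cs_even S; Od = cs_odd S;
         d = cs_der S; p = cs_prod S in
      \<comment> \<open>D-module\<close>
      0 \<in> M \<and> (\<forall>a\<in>M. \<forall>b\<in>M. a + b \<in> M) \<and> (\<forall>a\<in>M. - a \<in> M)
    \<and> (\<forall>r\<in>D. \<forall>a\<in>M. sm r a \<in> M)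
    \<and> (\<forall>r\<in>D. \<forall>a\<in>M. \<forall>b\<in>M. sm r (a + b) = sm r a + sm r b)
    \<and> (\<forall>r\<in>D. \<forall>s\<in>D. \<forall>a\<in>M. sm (r + s) a = sm r a + sm s a)
    \<and> (\<forall>r\<in>D. \<forall>s\<in>D. \<forall>a\<in>M. sm (r * s) a = sm r (sm s a))
    \<and> (\<forall>a\<in>M. sm 1 a = a)
      \<comment> \<open>Z/2Z-grading by D-submodules\<close>
    \<and> is_submod D S E \<and> is_submod D S Od \<and> E \<inter> Od = {0}
    \<and> (\<forall>a\<in>M. \<exists>x\<in>E. \<exists>y\<in>Od. a = x + y)
      \<comment> \<open>parity preserving additive derivation\<close>
    \<and> (\<forall>a\<in>M. d a \<in> M) \<and> (\<forall>a\<in>M. \<forall>b\<in>M. d (a + b) = d a + d b)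
    \<and> (\<forall>a\<in>E. d a \<in> E) \<and> (\<forall>a\<in>Od. d a \<in> Od)
      \<comment> \<open>biadditive, parity respecting n-products\<close>
    \<and> (\<forall>n. \<forall>a\<in>M. \<forall>b\<in>M. p n a b \<in> M)
    \<and> (\<forall>n. \<forall>a\<in>M. \<forall>b\<in>M. \<forall>c\<in>M. p n (a + b) c = p n a c + p n b c)
    \<and> (\<forall>n. \<forall>a\<in>M. \<forall>b\<in>M. \<forall>c\<in>M. p n a (b + c) = p n a b + p n a c)
    \<and> (\<forall>n. \<forall>a\<in>E. \<forall>b\<in>E. p n a b \<in> E) \<and> (\<forall>n. \<forall>a\<in>E. \<forall>b\<in>Od. p n a b \<in> Od)
    \<and> (\<forall>n. \<forall>a\<in>Od. \<forall>b\<in>E. p n a b \<in> Od) \<and> (\<forall>n. \<forall>a\<in>Od. \<forall>b\<in>Od. p n a b \<in> E)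
      \<comment> \<open>conformal axioms\<close>
    \<and> (\<forall>a\<in>M. \<forall>b\<in>M. \<exists>N. \<forall>n\<ge>N. p n a b = 0)
    \<and> (\<forall>n. \<forall>a\<in>M. \<forall>b\<in>M. p n (d a) b = - nsmul n (p (n - 1) a b))
    \<and> (\<forall>n. \<forall>a\<in>M. \<forall>b\<in>M. p n a (d b) = d (p n a b) + nsmul n (p (n - 1) a b))
    \<and> (\<forall>r\<in>D. \<forall>a\<in>M. d (sm r a) = sm r (d a) + sm (puis_deriv r) a)
    \<and> (\<forall>r\<in>D. \<forall>n. \<forall>a\<in>M. \<forall>b\<in>M. p n a (sm r b) = sm r (p n a b))
    \<and> (\<forall>r\<in>D. \<forall>n. \<forall>a\<in>M. \<forall>b\<in>M. \<forall>N. (\<forall>m\<ge>N. p m a b = 0) \<longrightarrow>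
          p n (sm r a) b
          = (\<Sum>j<N. sm (kconst (inverse (fact j)) * (puis_deriv ^^ j) r) (p (n + j) a b))))"

definition csa_hom :: "'k::zero puis set \<Rightarrow> ('k, 'a::ab_group_add) csa \<Rightarrow> ('k, 'b::ab_group_add) csa
    \<Rightarrow> ('a \<Rightarrow> 'b) \<Rightarrow> bool" where
  "csa_hom D S T f \<longleftrightarrow>
      (\<forall>a\<in>cs_carrier S. f a \<in> cs_carrier T)
    \<and> (\<forall>a\<in>cs_carrier S. \<forall>b\<in>cs_carrier S. f (a + b) = f a + f b)
    \<and> (\<forall>r\<in>D. \<forall>a\<in>cs_carrier S. f (cs_smul S r a) = cs_smul T r (f a))
    \<and> (\<forall>a\<in>cs_even S. f a \<in> cs_even T) \<and> (\<forall>a\<in>cs_odd S. f a \<in> cs_odd T)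
    \<and> (\<forall>a\<in>cs_carrier S. f (cs_der S a) = cs_der T (f a))
    \<and> (\<forall>n. \<forall>a\<in>cs_carrier S. \<forall>b\<in>cs_carrier S. f (cs_prod S n a b) = cs_prod T n (f a) (f b))"

definition csa_iso :: "'k::zero puis set \<Rightarrow> ('k, 'a::ab_group_add) csa \<Rightarrow> ('k, 'b::ab_group_add) csa
    \<Rightarrow> ('a \<Rightarrow> 'b) \<Rightarrow> bool" where
  "csa_iso D S T f \<longleftrightarrow> csa_hom D S T f \<and> bij_betw f (cs_carrier S) (cs_carrier T)"

definition at_pt :: "'i \<Rightarrow> 'b::zero \<Rightarrow> 'i \<Rightarrow> 'b" where
  "at_pt q b = (\<lambda>x. if x = q then b else 0)"

definition supp :: "('i \<Rightarrow> 'b::zero) \<Rightarrow> 'i set" where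
  "supp f = {q. f q \<noteq> 0}"

definition prod_bound :: "(nat \<Rightarrow> 'a \<Rightarrow> 'a \<Rightarrow> 'b::zero) \<Rightarrow> 'a \<Rightarrow> 'a \<Rightarrow> nat" where
  "prod_bound p a b = (LEAST N. \<forall>m\<ge>N. p m a b = 0)"

text \<open>S-hat is free over R with basis t^q, q in [0,1).  An element of B (x)_R S-hat is
  represented by g with finite support in [0,1), standing for  sum_q g(q) (x) t^q.
  embedR S b r is the normal form of the simple tensor b (x) r.\<close>

definition embedR :: "('k::comm_ring_1, 'b::ab_group_add) csa \<Rightarrow> 'b \<Rightarrow> 'k puis \<Rightarrow> rat \<Rightarrow> 'b" where
  "embedR S b r = (\<Sum>p\<in>Poly_Mapping.keys r.
      at_pt (frac p) (cs_smul S (Poly_Mapping.single (of_int \<lfloor>p\<rfloor>) (Poly_Mapping.lookup r p)) b))"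

definition base_change :: "('k::field_char_0, 'b::ab_group_add) csa \<Rightarrow> ('k, rat \<Rightarrow> 'b) csa" where
  "base_change S =
    (let C = {g. finite (supp g) \<and> supp g \<subseteq> {0..<1} \<and> (\<forall>q. g q \<in> cs_carrier S)} in
     \<lparr> cs_carrier = C,
       cs_smul = (\<lambda>r g. \<Sum>q\<in>supp g. embedR S (g q) (r * tpow q)),
       cs_even = {g\<in>C. \<forall>q. g q \<in> cs_even S},
       cs_odd = {g\<in>C. \<forall>q. g q \<in> cs_odd S},
       cs_der = (\<lambda>g. \<Sum>q\<in>supp g. at_pt q (cs_der S (g q)) + embedR S (g q) (puis_deriv (tpow q))),
       cs_prod = (\<lambda>n g h. \<Sum>p\<in>supp g. \<Sum>q\<in>supp h.
          \<Sum>j<prod_bound (cs_prod S) (g p) (h q).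
             embedR S (cs_prod S (n + j) (g p) (h q))
               (kconst (inverse (fact j)) * (puis_deriv ^^ j) (tpow p) * tpow q)) \<rparr>)"

datatype gen = gL | gJ | gGp | gGm

text \<open>An element of A is a map gen => k[d], i.e. p_L(d) L + p_J(d) J + p_+(d) G+ + p_-(d) G-.\<close>
type_synonym 'k N2 = "gen \<Rightarrow> 'k poly"

definition gens :: "gen set" where "gens = {gL, gJ, gGp, gGm}"

definition gen_el :: "gen \<Rightarrow> 'k::zero poly \<Rightarrow> 'k N2" where
  "gen_el x c = (\<lambda>z. if z = x then c else 0)"

definition N2_scale :: "'k::comm_ring_1 \<Rightarrow> 'k N2 \<Rightarrow> 'k N2" where
  "N2_scale c a = (\<lambda>z. smult c (a z))"

definition N2_derpow :: "nat \<Rightarrow> 'k::comm_ring_1 N2 \<Rightarrow> 'k N2" where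
  "N2_derpow k a = (\<lambda>z. monom 1 k * a z)"

definition N2_der :: "'k::comm_ring_1 N2 \<Rightarrow> 'k N2" where
  "N2_der a = N2_derpow 1 a"

text \<open>0-th and 1-st products of generators, read off from the lambda-brackets
  (the remaining ones by skew-symmetry); all higher products of generators vanish.\<close>
fun gp0 :: "gen \<Rightarrow> gen \<Rightarrow> 'k::field N2" where
  "gp0 gL gL = gen_el gL (monom 1 1)"
| "gp0 gL gJ = gen_el gJ (monom 1 1)"
| "gp0 gL gGp = gen_el gGp (monom 1 1)"
| "gp0 gL gGm = gen_el gGm (monom 1 1)"
| "gp0 gJ gL = 0"
| "gp0 gJ gJ = 0"
| "gp0 gJ gGp = gen_el gGp 1"
| "gp0 gJ gGm = - gen_el gGm 1"
| "gp0 gGp gL = gen_el gGp (monom (1/2) 1)"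
| "gp0 gGm gL = gen_el gGm (monom (1/2) 1)"
| "gp0 gGp gJ = - gen_el gGp 1"
| "gp0 gGm gJ = gen_el gGm 1"
| "gp0 gGp gGp = 0"
| "gp0 gGm gGm = 0"
| "gp0 gGp gGm = gen_el gL 1 + gen_el gJ (monom (1/2) 1)"
| "gp0 gGm gGp = gen_el gL 1 - gen_el gJ (monom (1/2) 1)"

fun gp1 :: "gen \<Rightarrow> gen \<Rightarrow> 'k::field N2" where
  "gp1 gL gL = gen_el gL [:2:]"
| "gp1 gL gJ = gen_el gJ 1"
| "gp1 gL gGp = gen_el gGp [:3/2:]"
| "gp1 gL gGm = gen_el gGm [:3/2:]"
| "gp1 gJ gL = gen_el gJ 1"
| "gp1 gJ gJ = 0"
| "gp1 gJ gGp = 0"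
| "gp1 gJ gGm = 0"
| "gp1 gGp gL = gen_el gGp [:3/2:]"
| "gp1 gGm gL = gen_el gGm [:3/2:]"
| "gp1 gGp gJ = 0"
| "gp1 gGm gJ = 0"
| "gp1 gGp gGp = 0"
| "gp1 gGm gGm = 0"
| "gp1 gGp gGm = gen_el gJ 1"
| "gp1 gGm gGp = - gen_el gJ 1"

definition gp :: "nat \<Rightarrow> gen \<Rightarrow> gen \<Rightarrow> 'k::field N2" where
  "gp n x y = (if n = 0 then gp0 x y else if n = 1 then gp1 x y else 0)"

text \<open>(d^i x)_(n) (d^j y), forced by the axioms (d a)_(n) b = -n a_(n-1) b and
  a_(n) (d b) = d (a_(n) b) + n a_(n-1) b.\<close>
definition basic_prod :: "gen \<Rightarrow> nat \<Rightarrow> gen \<Rightarrow> nat \<Rightarrow> nat \<Rightarrow> 'k::field N2" where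
  "basic_prod x i y j n =
     N2_scale ((-1) ^ i * of_nat ((n choose i) * fact i))
       (\<Sum>l\<le>j. N2_scale (of_nat ((j choose l) * ((n - i) choose l) * fact l))
                  (N2_derpow (j - l) (gp (n - i - l) x y)))"

definition N2_prod :: "nat \<Rightarrow> 'k::field N2 \<Rightarrow> 'k N2 \<Rightarrow> 'k N2" where
  "N2_prod n a b =
     (\<Sum>x\<in>gens. \<Sum>y\<in>gens. \<Sum>i\<le>degree (a x). \<Sum>j\<le>degree (b y).
        N2_scale (coeff (a x) i * coeff (b y) j) (basic_prod x i y j n))"

definition N2_even :: "'k::zero N2 set" where
  "N2_even = {a. a gGp = 0 \<and> a gGm = 0}"

definition N2_odd :: "'k::zero N2 set" where
  "N2_odd = {a. a gL = 0 \<and> a gJ = 0}"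

definition N2_csa :: "('k::field, 'k N2) csa" where
  "N2_csa = \<lparr> cs_carrier = UNIV, cs_smul = (\<lambda>r a. N2_scale (Poly_Mapping.lookup r 0) a),
              cs_even = N2_even, cs_odd = N2_odd, cs_der = N2_der, cs_prod = N2_prod \<rparr>"

definition omega :: "'k::ab_group_add N2 \<Rightarrow> 'k N2" where
  "omega a = (\<lambda>z. case z of gL \<Rightarrow> a gL | gJ \<Rightarrow> - a gJ | gGp \<Rightarrow> a gGm | gGm \<Rightarrow> a gGp)"

text \<open>Elements of A (x)_k S-hat: finitely supported f : rat => A, standing for sum_q f(q) (x) t^q.\<close>
definition embedK :: "'k::comm_ring_1 N2 \<Rightarrow> 'k puis \<Rightarrow> rat \<Rightarrow> 'k N2" where
  "embedK b r = (\<Sum>p\<in>Poly_Mapping.keys r. at_pt p (N2_scale (Poly_Mapping.lookup r p) b))"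

definition AS_smul :: "'k::comm_ring_1 puis \<Rightarrow> (rat \<Rightarrow> 'k N2) \<Rightarrow> rat \<Rightarrow> 'k N2" where
  "AS_smul r f = (\<Sum>q\<in>supp f. embedK (f q) (r * tpow q))"

definition AS_der :: "(rat \<Rightarrow> 'k::field_char_0 N2) \<Rightarrow> rat \<Rightarrow> 'k N2" where
  "AS_der f = (\<Sum>q\<in>supp f. at_pt q (N2_der (f q)) + embedK (f q) (puis_deriv (tpow q)))"

definition AS_prod :: "nat \<Rightarrow> (rat \<Rightarrow> 'k::field_char_0 N2) \<Rightarrow> (rat \<Rightarrow> 'k N2) \<Rightarrow> rat \<Rightarrow> 'k N2" where
  "AS_prod n f g = (\<Sum>p\<in>supp f. \<Sum>q\<in>supp g. \<Sum>j<prod_bound N2_prod (f p) (g q).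
      embedK (N2_prod (n + j) (f p) (g q))
        (kconst (inverse (fact j)) * (puis_deriv ^^ j) (tpow p) * tpow q))"

text \<open>Twisted loop algebra L(A, sigma) = sum_i A_i (x) t^(i/m), A_i = {x. sigma x = xi_m^i x},
  as a conformal superalgebra (the ring of scalars is chosen by the D argument of is_csa /
  csa_iso: R_set for the R-structure, k_set for the restricted k-structure).\<close>
definition loop :: "(nat \<Rightarrow> 'k::field_char_0) \<Rightarrow> nat \<Rightarrow> ('k N2 \<Rightarrow> 'k N2)
    \<Rightarrow> ('k, rat \<Rightarrow> 'k N2) csa" where
  "loop xi m \<sigma> =
    (let C = {f. finite (supp f) \<and> (\<forall>q\<in>supp f. \<exists>i::int.
                 q = of_int i / of_nat m \<and> \<sigma> (f q) = N2_scale (xi m powi i) (f q))} in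
     \<lparr> cs_carrier = C, cs_smul = AS_smul,
       cs_even = {f\<in>C. \<forall>q. f q \<in> N2_even}, cs_odd = {f\<in>C. \<forall>q. f q \<in> N2_odd},
       cs_der = AS_der, cs_prod = AS_prod \<rparr>)"

end

theory Submission
  imports Defs "HOL-Computational_Algebra.Formal_Power_Series"
begin

text \<open>Let chi be the character of the rationals with chi(i/m) = xi_m^i, whose kernel is the integers, and let
  Gamma be the automorphism t^q -> chi(q) t^q of S-hat. A form F, and likewise a loop algebra L(A, sigma), is
  the algebra of fixed points in A (x) S-hat of a Gamma-semilinear automorphism T which has finite order on every
  element: T is the transport of 1 (x) Gamma, respectively sigma^{-1} (x) Gamma.

  Comparing leading terms, an odd element all of whose products with itself vanish involves derivatives of
  only one of G+ and G-. Hence T G+ = s G+ and T G- = s^{-1} G-, or T G+ = s G- and T G- = s^{-1} G+, for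
  a unit s = c t^p of S-hat. In the first case finite order forces s to be a root of unity chi(r); in the second
  case s = u Gamma(u) has a solution u because k is algebraically closed. Conjugation with a spectral flow
  G+ -> u G+, G- -> u^{-1} G- (u = t^r in the first case) turns T into Gamma or omega Gamma, whose fixed points
  are L(A, id) and L(A, omega). These differ already over k: G+ (x) 1 is odd with vanishing self-products,
  and symmetry under omega leaves no such element except 0 in L(A, omega).\<close>

section \<open>Finitely supported functions\<close>

text \<open>The single map Gamma stands in for the whole Galois group: the kernel of chi is exactly
  the integers, so the elements of S-hat fixed by Gamma alone are those of R, and no cocycles have
  to be handled. As chi is unchanged under integer shifts, Gamma commutes with d/dt and respects the
  Leibniz sums of the conformal axioms, which lower exponents by integers. Following G+ and G-
  suffices, since J = G+_(1) G- and L = G+_(0) G- - (1/2) d J. The obstacle is that T G+ may a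
  priori contain any powers of d; leading terms are used to exclude this. The classification takes
  in only that T is a semilinear homomorphism, sends G+ and G- to odd elements, does not kill G+,
  and has finite order on G+. Loop algebras and forms are both brought to this shape. The two cases
  differ in the equation for the flow u: if T keeps G+, it is Gamma(u) = s u, so s must be constant;
  if T exchanges G+ and G-, it is u Gamma(u) = s, and the exponent p/2 of u absorbs any p.\<close>

lemma sum_fun_app: "(\<Sum>a\<in>A. f a) x = (\<Sum>a\<in>A. f a x)"
  for f :: "'a \<Rightarrow> 'b \<Rightarrow> 'c::comm_monoid_add"
  by (induction A rule: infinite_finite_induct) auto

lemma at_pt_apply: "at_pt q a x = (if x = q then a else 0)"
  by (simp add: at_pt_def)

lemma at_pt_0 [simp]: "at_pt q 0 = 0"
  by (auto simp: at_pt_def)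

lemma at_pt_add: "at_pt q (a + b) = at_pt q a + at_pt q (b::'b::monoid_add)"
  by (auto simp: at_pt_def)

lemma at_pt_uminus: "at_pt q (- a) = - at_pt q (a::'b::group_add)"
  by (auto simp: at_pt_def)

lemma at_pt_sum: "at_pt q (\<Sum>i\<in>A. h i) = (\<Sum>i\<in>A. at_pt q (h i :: 'b::comm_monoid_add))"
  by (induction A rule: infinite_finite_induct) (simp_all add: at_pt_add)

abbreviation fs :: "('i \<Rightarrow> 'b::zero) \<Rightarrow> bool" where
  "fs f \<equiv> finite (supp f)"

lemma supp_0 [simp]: "supp 0 = {}"
  by (simp add: supp_def)

lemma supp_at_pt: "supp (at_pt q a) = (if a = 0 then {} else {q})"
  by (auto simp: supp_def at_pt_def)

lemma fs_at_pt [simp]: "fs (at_pt q a)"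
  by (simp add: supp_at_pt)

lemma supp_add: "supp (f + g) \<subseteq> supp f \<union> supp (g :: 'i \<Rightarrow> 'b::monoid_add)"
  by (auto simp: supp_def)

lemma fs_add [simp]: "fs f \<Longrightarrow> fs g \<Longrightarrow> fs (f + g)"
  for f g :: "'i \<Rightarrow> 'b::monoid_add"
  by (meson finite_Un finite_subset supp_add)

lemma fs_uminus [simp]: "fs (- f) = fs f"
  for f :: "'i \<Rightarrow> 'b::group_add"
  by (simp add: supp_def)

lemma fs_diff [simp]: "fs f \<Longrightarrow> fs g \<Longrightarrow> fs (f - g)"
  for f g :: "'i \<Rightarrow> 'b::ab_group_add"
  using fs_add[of f "- g"] by simp

lemma fs_sum: "(\<And>i. i \<in> A \<Longrightarrow> fs (h i)) \<Longrightarrow> fs (\<Sum>i\<in>A. h i)"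
  for h :: "'a \<Rightarrow> 'i \<Rightarrow> 'b::comm_monoid_add"
  by (induction A rule: infinite_finite_induct) auto

lemma fs_decomp:
  fixes f :: "'i \<Rightarrow> 'b::comm_monoid_add"
  assumes "fs f"
  shows "(\<Sum>q\<in>supp f. at_pt q (f q)) = f"
proof
  fix x
  show "(\<Sum>q\<in>supp f. at_pt q (f q)) x = f x"
    using assms by (auto simp: sum_fun_app at_pt_apply sum.delta' supp_def)
qed

lemma fs_induct [consumes 1, case_names zero at_pt add]:
  fixes f :: "'i \<Rightarrow> 'b::comm_monoid_add"
  assumes "fs f" and z: "P 0" and p: "\<And>q a. P (at_pt q a)"
    and a: "\<And>f g. fs f \<Longrightarrow> fs g \<Longrightarrow> P f \<Longrightarrow> P g \<Longrightarrow> P (f + g)"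
  shows "P f"
proof -
  have "P (\<Sum>q\<in>A. at_pt q (f q))" if "finite A" for A
    using that
  proof induction
    case (insert x F)
    have "P (at_pt x (f x) + (\<Sum>q\<in>F. at_pt q (f q)))"
      by (rule a) (simp_all only: fs_at_pt p insert.IH fs_sum)
    with insert.hyps show ?case
      by (simp only: sum.insert if_False not_False_eq_True)
  qed (simp only: sum.empty z)
  then show ?thesis
    using fs_decomp[OF assms(1)] assms(1) by metis
qed

lemma sum_supp_superset:
  assumes "finite A" "supp f \<subseteq> A" "\<And>q. h q 0 = 0"
  shows "(\<Sum>q\<in>supp f. h q (f q)) = (\<Sum>q\<in>A. h q (f q))"
  using assms by (intro sum.mono_neutral_left) (auto simp: supp_def)

text \<open>Additivity of \<open>h q\<close> is asked only at the values of \<open>f\<close> and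
  \<open>g\<close>: \<open>mult_out\<close> needs it for \<open>AS_smul (tpow q)\<close>, whose
  additivity is known on finitely supported arguments only.\<close>

lemma sum_supp_add_values:
  fixes f g :: "'i \<Rightarrow> 'b::comm_monoid_add" and h :: "'i \<Rightarrow> 'b \<Rightarrow> 'c::comm_monoid_add"
  assumes "fs f" "fs g" and h: "\<And>q. h q (f q + g q) = h q (f q) + h q (g q)" and h0: "\<And>q. h q 0 = 0"
  shows "(\<Sum>q\<in>supp (f + g). h q ((f + g) q)) = (\<Sum>q\<in>supp f. h q (f q)) + (\<Sum>q\<in>supp g. h q (g q))"
proof -
  let ?A = "supp f \<union> supp g"
  have "(\<Sum>q\<in>supp (f + g). h q ((f + g) q)) = (\<Sum>q\<in>?A. h q ((f + g) q))"
    by (rule sum_supp_superset[where f = "f + g"]) (use assms supp_add[of f g] in simp_all)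
  also have "\<dots> = (\<Sum>q\<in>?A. h q (f q)) + (\<Sum>q\<in>?A. h q (g q))"
    by (simp add: h sum.distrib)
  also have "\<dots> = (\<Sum>q\<in>supp f. h q (f q)) + (\<Sum>q\<in>supp g. h q (g q))"
    using assms by (simp add: sum_supp_superset[of ?A])
  finally show ?thesis .
qed

lemma sum_supp_add:
  fixes f g :: "'i \<Rightarrow> 'b::comm_monoid_add" and h :: "'i \<Rightarrow> 'b \<Rightarrow> 'c::cancel_comm_monoid_add"
  assumes "fs f" "fs g" and h: "\<And>q a b. h q (a + b) = h q a + h q b"
  shows "(\<Sum>q\<in>supp (f + g). h q ((f + g) q)) = (\<Sum>q\<in>supp f. h q (f q)) + (\<Sum>q\<in>supp g. h q (g q))"
proof (rule sum_supp_add_values)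
  show "h q 0 = 0" for q
    using h[of q 0 0] by simp
qed (use assms in simp_all)

lemma sum_supp_at_pt:
  assumes "h q 0 = 0"
  shows "(\<Sum>x\<in>supp (at_pt q a). h x (at_pt q a x)) = h q a"
  using assms by (auto simp: supp_at_pt at_pt_apply)

section \<open>Products of the N=2 conformal superalgebra\<close>

lemma N2_scale_add: "N2_scale c (a + b) = N2_scale c a + N2_scale c b"
  by (auto simp: N2_scale_def smult_add_right)
lemma N2_scale_add_left: "N2_scale (c + d) a = N2_scale c a + N2_scale d a"
  by (auto simp: N2_scale_def smult_add_left)
lemma N2_scale_scale [simp]: "N2_scale c (N2_scale d a) = N2_scale (c * d) a"
  by (auto simp: N2_scale_def)
lemma N2_scale_1 [simp]: "N2_scale 1 a = a"
  by (auto simp: N2_scale_def)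
lemma N2_scale_0 [simp]: "N2_scale 0 a = 0"
  by (auto simp: N2_scale_def)
lemma N2_scale_zero [simp]: "N2_scale c 0 = 0"
  by (auto simp: N2_scale_def)
lemma N2_scale_uminus: "N2_scale c (- a) = - N2_scale c a"
  by (auto simp: N2_scale_def)
lemma N2_scale_minus_left: "N2_scale (- c) a = - N2_scale c a"
  by (auto simp: N2_scale_def)
lemma N2_scale_sum: "N2_scale c (\<Sum>i\<in>A. h i) = (\<Sum>i\<in>A. N2_scale c (h i))"
  by (simp add: fun_eq_iff N2_scale_def sum_fun_app poly_eq_iff coeff_sum sum_distrib_left)
lemma N2_scale_sum_left: "N2_scale (\<Sum>i\<in>A. h i) a = (\<Sum>i\<in>A. N2_scale (h i) a)"
  by (induction A rule: infinite_finite_induct) (simp_all add: N2_scale_add_left)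
lemma N2_scale_eq_0_iff: "N2_scale c a = 0 \<longleftrightarrow> c = 0 \<or> a = 0" for c :: "'k::field"
  by (auto simp: N2_scale_def fun_eq_iff)
lemma N2_scale_gen_el: "N2_scale c (gen_el x p) = gen_el x (smult c p)"
  by (auto simp: N2_scale_def gen_el_def)

lemma N2_derpow_add: "N2_derpow n (a + b) = N2_derpow n a + N2_derpow n b"
  by (auto simp: N2_derpow_def algebra_simps)
lemma N2_derpow_zero [simp]: "N2_derpow n 0 = 0"
  by (auto simp: N2_derpow_def)
lemma N2_derpow_sum: "N2_derpow c (\<Sum>i\<in>A. h i) = (\<Sum>i\<in>A. N2_derpow c (h i))"
  by (simp add: fun_eq_iff N2_derpow_def sum_fun_app sum_distrib_left)
lemma N2_derpow_0 [simp]: "N2_derpow 0 a = a"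
  by (auto simp: N2_derpow_def)
lemma N2_derpow_scale: "N2_derpow n (N2_scale c a) = N2_scale c (N2_derpow n a)"
  by (auto simp: N2_derpow_def N2_scale_def)
lemma N2_derpow_derpow: "N2_derpow n (N2_derpow m a) = N2_derpow (n + m) a"
  by (auto simp: N2_derpow_def mult_monom simp flip: mult.assoc)
lemma N2_derpow_gen_el: "N2_derpow n (gen_el x p) = gen_el x (monom 1 n * p)"
  by (auto simp: N2_derpow_def gen_el_def)

lemma N2_der_add: "N2_der (a + b) = N2_der a + N2_der b"
  by (simp add: N2_der_def N2_derpow_add)
lemma N2_der_zero [simp]: "N2_der 0 = 0"
  by (simp add: N2_der_def)
lemma N2_der_scale: "N2_der (N2_scale c a) = N2_scale c (N2_der a)"
  by (simp add: N2_der_def N2_derpow_scale)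
lemma N2_der_gen_el_monom: "N2_der (gen_el x (monom c i)) = gen_el x (monom c (Suc i))"
  by (simp add: N2_der_def N2_derpow_gen_el mult_monom)

lemma gen_el_add: "gen_el x (p + q) = gen_el x p + gen_el x q"
  by (auto simp: gen_el_def)
lemma gen_el_zero [simp]: "gen_el x 0 = 0"
  by (auto simp: gen_el_def)
lemma gen_el_uminus: "gen_el x (- p) = - gen_el x p" for p :: "'k::ab_group_add poly"
  by (auto simp: gen_el_def)
lemma gen_el_apply: "gen_el x p z = (if z = x then p else 0)"
  by (auto simp: gen_el_def)
lemma gen_el_sum: "gen_el x (\<Sum>i\<in>A. h i) = (\<Sum>i\<in>A. gen_el x (h i))"
  by (induction A rule: infinite_finite_induct) (simp_all add: gen_el_add)

lemma finite_gens [simp]: "finite gens" and in_gens [simp]: "x \<in> gens"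
  by (simp add: gens_def, cases x) (simp_all add: gens_def)

lemma N2_decomp: "(\<Sum>x\<in>gens. gen_el x (a x)) = (a :: 'k::comm_monoid_add N2)"
proof
  fix z show "(\<Sum>x\<in>gens. gen_el x (a x)) z = a z"
    by (simp add: sum_fun_app gen_el_apply sum.delta)
qed

lemma N2_induct [case_names mono add]:
  fixes a :: "'k::comm_ring_1 N2"
  assumes m: "\<And>x c i. P (gen_el x (monom c i))" and add: "\<And>a b. P a \<Longrightarrow> P b \<Longrightarrow> P (a + b)"
  shows "P a"
proof -
  have z: "P 0"
    using m[of _ 0] by simp
  have s: "P (\<Sum>i\<in>A. h i)" if "\<And>i. P (h i)" for h and A :: "'b set"
    by (induction A rule: infinite_finite_induct) (simp_all only: sum.infinite sum.empty sum.insert z add that not_False_eq_True)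
  have "P (gen_el x p)" for x p
    using s[of "\<lambda>i. gen_el x (monom (coeff p i) i)" "{..degree p}"] m
    by (simp flip: gen_el_sum add: poly_as_sum_of_monoms)
  then show ?thesis
    using s[of "\<lambda>x. gen_el x (a x)" gens] by (simp add: N2_decomp)
qed

section \<open>Leibniz recursions for products of derivatives of generators\<close>

lemma basic_prod_Suc_left:
  "basic_prod x (Suc i) y j n = - N2_scale (of_nat n) (basic_prod x i y j (n - 1))"
proof (cases n)
  case (Suc m)
  have "of_nat ((Suc m choose Suc i) * fact (Suc i)) = of_nat (Suc m) * (of_nat ((m choose i) * fact i) :: 'a)"
    by (simp only: flip: of_nat_mult) (metis Suc_times_binomial_eq fact_Suc mult.assoc of_nat_id mult.commute)
  then show ?thesis
    by (simp add: basic_prod_def Suc N2_scale_minus_left[symmetric] mult_ac del: of_nat_mult of_nat_Suc fact_Suc binomial_Suc_Suc)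
qed (simp add: basic_prod_def)

text \<open>The product x_(m) (d^j y). At m = n - i it is the inner sum of
  \<open>basic_prod\<close>, so the two factors can be differentiated one at a time. Truncation of n
  - i does no harm because (n choose i) vanishes for n < i.\<close>

definition inner_prod :: "gen \<Rightarrow> gen \<Rightarrow> nat \<Rightarrow> nat \<Rightarrow> 'k::field N2" where
  "inner_prod x y j m = (\<Sum>l\<le>j. N2_scale (of_nat ((j choose l) * (m choose l) * fact l))
                  (N2_derpow (j - l) (gp (m - l) x y)))"

lemma binomial_Suc_times_fact: "(Suc m choose Suc l) * fact (Suc l) = Suc m * ((m choose l) * fact l)"
  by (metis Suc_times_binomial_eq fact_Suc mult.assoc of_nat_id mult.commute)

text \<open>Pascal's rule for (j+1 choose l+1): one half, with the term l = 0, is the derivative of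
  the whole product; the other half is the product with its index lowered by one. At m = 0 the
  truncated m - 1 is multiplied by 0.\<close>

lemma inner_prod_Suc:
  "inner_prod x y (Suc j) m = N2_der (inner_prod x y j m) + N2_scale (of_nat m) (inner_prod x y j (m - 1))"
proof -
  let ?g = "\<lambda>k l. N2_derpow k (gp (m - l) x y) :: 'a N2"
  let ?f = "\<lambda>l. (m choose l) * fact l"
  \<comment> \<open>The sum runs one step further than necessary, to match the index shift below;
    its last term has the factor (j choose j+1) = 0.\<close>
  have A: "N2_der (inner_prod x y j m) = (\<Sum>l\<le>Suc j. N2_scale (of_nat ((j choose l) * ?f l)) (?g (Suc j - l) l))"
    by (auto simp: inner_prod_def N2_derpow_sum N2_derpow_scale N2_der_def N2_derpow_derpow Suc_diff_le mult.assoc binomial_eq_0 intro!: sum.cong)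
  have B: "N2_scale (of_nat m) (inner_prod x y j (m - 1)) =
      (\<Sum>l\<le>j. N2_scale (of_nat ((j choose l) * ?f (Suc l))) (?g (j - l) (Suc l)))"
  proof (cases m)
    case (Suc k)
    have "of_nat (Suc k) * of_nat ((j choose l) * (k choose l) * fact l) = (of_nat ((j choose l) * ((Suc k choose Suc l) * fact (Suc l))) :: 'a)" for l
      unfolding binomial_Suc_times_fact by (simp only: of_nat_mult mult_ac)
    then show ?thesis
      by (simp add: inner_prod_def N2_scale_sum Suc del: of_nat_mult of_nat_Suc fact_Suc binomial_Suc_Suc)
  qed simp
  have "inner_prod x y (Suc j) m = N2_derpow (Suc j) (gp m x y) +
     (\<Sum>l\<le>j. N2_scale (of_nat ((Suc j choose Suc l) * ?f (Suc l))) (?g (j - l) (Suc l)))"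
    by (subst inner_prod_def, subst sum.atMost_Suc_shift)
      (simp del: of_nat_mult of_nat_Suc fact_Suc binomial_Suc_Suc add: mult.assoc of_nat_1[unfolded One_nat_def])
  also have "\<dots> = N2_derpow (Suc j) (gp m x y) + (\<Sum>l\<le>j. N2_scale (of_nat ((j choose Suc l) * ?f (Suc l))) (?g (j - l) (Suc l)))
      + (\<Sum>l\<le>j. N2_scale (of_nat ((j choose l) * ?f (Suc l))) (?g (j - l) (Suc l)))"
    by (simp del: of_nat_mult of_nat_Suc fact_Suc add: algebra_simps sum.distrib N2_scale_add_left add_mult_distrib)
  also have "\<dots> = N2_der (inner_prod x y j m) + N2_scale (of_nat m) (inner_prod x y j (m - 1))"
    unfolding A B by (subst sum.atMost_Suc_shift) simp
  finally show ?thesis .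
qed

lemma basic_prod_inner: "basic_prod x i y j n = N2_scale ((-1) ^ i * of_nat ((n choose i) * fact i)) (inner_prod x y j (n - i))"
  by (simp add: basic_prod_def inner_prod_def)

lemma basic_prod_Suc_right:
  "basic_prod x i y (Suc j) n = N2_der (basic_prod x i y j n) + N2_scale (of_nat n) (basic_prod x i y j (n - 1))"
proof -
  \<comment> \<open>Trades the factor n - i produced by the recursion for \<open>inner_prod\<close>
    for the factor n of the axiom.\<close>
  have *: "(n choose i) * fact i * (n - i) = n * ((n - 1 choose i) * fact i)"
  proof (cases n)
    case (Suc m)
    have "(Suc m choose i) * (Suc m - i) = Suc m * (m choose i)"
      using binomial_absorb_comp[of "Suc m" i] by (simp add: mult.commute)
    then show ?thesis
      by (simp add: Suc mult_ac del: binomial_Suc_Suc)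
  qed simp
  have "(- 1) ^ i * of_nat ((n choose i) * fact i) * of_nat (n - i) = of_nat n * ((- 1) ^ i * (of_nat ((n - 1 choose i) * fact i) :: 'a))"
    using arg_cong[OF *, of "of_nat :: nat \<Rightarrow> 'a"] by (simp add: mult_ac)
  moreover have "n - i - 1 = n - 1 - i"
    by simp
  ultimately show ?thesis
    by (simp only: basic_prod_inner inner_prod_Suc N2_scale_add N2_der_scale N2_scale_scale)
qed

lemma basic_prod_00: "basic_prod x 0 y 0 n = gp n x y"
  by (simp add: basic_prod_def)

text \<open>Derivatives on the left lower the index by i, those on the right by at most j, so only
  \<open>gp\<close> with index at least 2 occurs.\<close>

lemma basic_prod_large: "n > Suc (i + j) \<Longrightarrow> basic_prod x i y j n = 0"
  by (auto simp: basic_prod_inner inner_prod_def gp_def intro!: sum.neutral arg_cong[where f="N2_scale _" and y=0, simplified])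

text \<open>The pointwise rules would eta-expand function-valued sums and differences and so block the
  additivity lemmas; they are applied explicitly where needed.\<close>

lemmas fun_ops = plus_fun_apply zero_fun_apply uminus_apply minus_apply

declare fun_ops [simp del]

section \<open>Bilinearity of the n-products of A via coefficient functions\<close>

lemma supp_coeff_subset: "supp (coeff p) \<subseteq> {..degree p}"
  by (auto simp: supp_def intro: le_degree)

lemma fs_coeff [simp]: "fs (coeff p)"
  using supp_coeff_subset finite_subset by blast

lemma coeff_add_fun: "coeff (p + q) = coeff p + coeff q"
  by (auto simp: fun_eq_iff fun_ops)

lemma coeff_monom_fun: "coeff (monom c i) = at_pt i c"
  by (auto simp: fun_eq_iff at_pt_apply)

lemma coeff_0_fun: "coeff 0 = 0"
  by (auto simp: fun_eq_iff fun_ops)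

lemma sum_degree:
  assumes "\<And>i. h i 0 = 0"
  shows "(\<Sum>i\<le>degree p. h i (coeff p i)) = (\<Sum>i\<in>supp (coeff p). h i (coeff p i))"
  by (rule sum_supp_superset[symmetric]) (use assms supp_coeff_subset in auto)

lemma sum_gen_el:
  assumes "\<And>z. F z 0 = 0"
  shows "(\<Sum>z\<in>gens. F z (gen_el x p z)) = F x p"
proof -
  have "(\<Sum>z\<in>gens. F z (gen_el x p z)) = (\<Sum>z\<in>gens. if z = x then F x p else 0)"
    by (rule sum.cong) (auto simp: gen_el_apply assms)
  then show ?thesis
    by simp
qed

text \<open>Sums up to the degree change their range when polynomials are added; sums over the
  support of the coefficient function fall under \<open>sum_supp_add\<close>, which yields
  bilinearity.\<close>

lemma N2_prod_alt:
  fixes a b :: "'k::field N2"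
  shows "N2_prod n a b = (\<Sum>x\<in>gens. \<Sum>y\<in>gens. \<Sum>i\<in>supp (coeff (a x)). \<Sum>j\<in>supp (coeff (b y)).
      N2_scale (coeff (a x) i * coeff (b y) j) (basic_prod x i y j n))"
proof -
  have "(\<Sum>i\<le>degree p. \<Sum>j\<le>degree q. N2_scale (coeff p i * coeff q j) (basic_prod x i y j n))
     = (\<Sum>i\<in>supp (coeff p). \<Sum>j\<in>supp (coeff q). N2_scale (coeff p i * coeff q j) (basic_prod x i y j n))"
    for p q :: "'k poly" and x y
    by (subst sum_degree[where h = "\<lambda>i c. \<Sum>j\<le>degree q. N2_scale (c * coeff q j) (basic_prod x i y j n)"])
      (auto intro!: sum.cong sum_degree[where h = "\<lambda>j c. N2_scale (_ * c) (basic_prod x _ y j n)"])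
  then show ?thesis
    by (simp add: N2_prod_def)
qed

lemma N2_prod_add_left: "N2_prod n (a + a') b = N2_prod n a b + N2_prod n a' b"
  unfolding N2_prod_alt sum.distrib[symmetric]
proof (intro sum.cong refl, goal_cases)
  case (1 x y)
  let ?h = "\<lambda>i c. \<Sum>j\<in>supp (coeff (b y)). N2_scale (c * coeff (b y) j) (basic_prod x i y j n)"
  have "(\<Sum>i\<in>supp (coeff (a x) + coeff (a' x)). ?h i ((coeff (a x) + coeff (a' x)) i)) =
     (\<Sum>i\<in>supp (coeff (a x)). ?h i (coeff (a x) i)) + (\<Sum>i\<in>supp (coeff (a' x)). ?h i (coeff (a' x) i))"
    by (rule sum_supp_add) (simp_all add: distrib_right N2_scale_add_left sum.distrib)
  then show ?case
    by (simp only: coeff_add_fun plus_fun_apply)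
qed

lemma N2_prod_add_right: "N2_prod n a (b + b') = N2_prod n a b + N2_prod n a b'"
  unfolding N2_prod_alt sum.distrib[symmetric]
proof (intro sum.cong refl, goal_cases)
  case (1 x y i)
  let ?h = "\<lambda>j c. N2_scale (coeff (a x) i * c) (basic_prod x i y j n)"
  have "(\<Sum>j\<in>supp (coeff (b y) + coeff (b' y)). ?h j ((coeff (b y) + coeff (b' y)) j)) =
     (\<Sum>j\<in>supp (coeff (b y)). ?h j (coeff (b y) j)) + (\<Sum>j\<in>supp (coeff (b' y)). ?h j (coeff (b' y) j))"
    by (rule sum_supp_add) (simp_all add: distrib_left N2_scale_add_left)
  then show ?case
    by (simp only: coeff_add_fun plus_fun_apply sum.distrib)
qed

lemma N2_prod_mono:
  "N2_prod n (gen_el x (monom c i)) (gen_el y (monom d j)) = N2_scale (c * d) (basic_prod x i y j n)"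
proof -
  let ?H = "\<lambda>x i c y q. \<Sum>j\<in>supp (coeff q). N2_scale (c * coeff q j) (basic_prod x i y j n)"
  have "N2_prod n (gen_el x (monom c i)) (gen_el y (monom d j))
     = (\<Sum>x'\<in>gens. \<Sum>y'\<in>gens. \<Sum>i'\<in>supp (coeff (gen_el x (monom c i) x')).
         ?H x' i' (coeff (gen_el x (monom c i) x') i') y' (gen_el y (monom d j) y'))"
    by (simp add: N2_prod_alt)
  also have "\<dots> = (\<Sum>y'\<in>gens. \<Sum>i'\<in>supp (coeff (monom c i)).
         ?H x i' (coeff (monom c i) i') y' (gen_el y (monom d j) y'))"
    by (rule sum_gen_el) (simp add: coeff_0_fun)
  also have "\<dots> = (\<Sum>i'\<in>supp (coeff (monom c i)). ?H x i' (coeff (monom c i) i') y (monom d j))"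
    by (rule sum_gen_el) (simp add: coeff_0_fun)
  also have "\<dots> = ?H x i c y (monom d j)"
    unfolding coeff_monom_fun[of c i]
    by (rule sum_supp_at_pt[where h = "\<lambda>i' c. ?H x i' c y (monom d j)"]) simp
  also have "\<dots> = N2_scale (c * d) (basic_prod x i y j n)"
    unfolding coeff_monom_fun by (rule sum_supp_at_pt) simp
  finally show ?thesis .
qed

lemma N2_prod_zero_left [simp]: "N2_prod n 0 b = 0"
  using N2_prod_add_left[of n 0 0 b] by simp
lemma N2_prod_zero_right [simp]: "N2_prod n a 0 = 0"
  using N2_prod_add_right[of n a 0 0] by simp

lemma N2_prod_scale_left: "N2_prod n (N2_scale c a) b = N2_scale c (N2_prod n a b)"
proof (induction a rule: N2_induct)
  case (mono x d i)
  show ?case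
    by (induction b rule: N2_induct)
      (simp_all add: N2_scale_gen_el smult_monom N2_prod_mono N2_prod_add_right N2_scale_add mult.assoc)
qed (simp add: N2_scale_add N2_prod_add_left)

lemma N2_prod_scale_right: "N2_prod n a (N2_scale c b) = N2_scale c (N2_prod n a b)"
proof (induction a rule: N2_induct)
  case (mono x d i)
  show ?case
    by (induction b rule: N2_induct)
      (simp_all add: N2_scale_gen_el smult_monom N2_prod_mono N2_prod_add_right N2_scale_add mult_ac)
qed (simp add: N2_scale_add N2_prod_add_left)

lemma N2_prod_der_left: "N2_prod n (N2_der a) b = - N2_scale (of_nat n) (N2_prod (n - 1) a b)"
proof (induction a rule: N2_induct)
  case (mono x d i)
  show ?case
    by (induction b rule: N2_induct)
      (simp_all add: N2_der_gen_el_monom N2_prod_mono basic_prod_Suc_left N2_prod_add_right N2_scale_uminus N2_scale_add mult_ac)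
qed (simp add: N2_der_add N2_scale_add N2_prod_add_left)

lemma N2_prod_der_right:
  "N2_prod n a (N2_der b) = N2_der (N2_prod n a b) + N2_scale (of_nat n) (N2_prod (n - 1) a b)"
proof (induction a rule: N2_induct)
  case (mono x d i)
  show ?case
    by (induction b rule: N2_induct)
      (simp_all add: N2_der_gen_el_monom N2_prod_mono basic_prod_Suc_right N2_prod_add_right N2_scale_add N2_der_add N2_der_scale mult_ac)
qed (simp add: N2_der_add N2_scale_add N2_prod_add_left)

lemma N2_prod_local: "\<exists>N. \<forall>m\<ge>N. N2_prod m a b = 0"
proof (induction a rule: N2_induct)
  case (mono x c i)
  show ?case
  proof (induction b rule: N2_induct)
    case (mono y d j)
    show ?case
      by (rule exI[of _ "Suc (Suc (i + j))"]) (auto simp: N2_prod_mono basic_prod_large)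
  next
    case (add b b')
    then obtain N N' where "\<forall>m\<ge>N. N2_prod m (gen_el x (monom c i)) b = 0" "\<forall>m\<ge>N'. N2_prod m (gen_el x (monom c i)) b' = 0"
      by blast
    then show ?case
      by (intro exI[of _ "max N N'"]) (simp add: N2_prod_add_right)
  qed
next
  case (add a a')
  then obtain N N' where "\<forall>m\<ge>N. N2_prod m a b = 0" "\<forall>m\<ge>N'. N2_prod m a' b = 0"
    by blast
  then show ?case
    by (intro exI[of _ "max N N'"]) (simp add: N2_prod_add_left)
qed

lemma prod_bound_local:
  assumes "\<exists>N. \<forall>m\<ge>N. p m a b = 0" and m: "m \<ge> prod_bound p a b"
  shows "p m a b = 0"
proof -
  have "\<forall>m\<ge>prod_bound p a b. p m a b = 0"
    unfolding prod_bound_def by (rule LeastI_ex) (fact assms(1))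
  with m show ?thesis
    by blast
qed

lemma prod_bound_le: "\<forall>m\<ge>N. p m a b = 0 \<Longrightarrow> prod_bound p a b \<le> N"
  unfolding prod_bound_def by (rule Least_le)

section \<open>The conformal superalgebra over Puiseux polynomials\<close>

lemma single_sum: "(\<Sum>q\<in>Poly_Mapping.keys r. Poly_Mapping.single q (Poly_Mapping.lookup r q)) = r"
  by (rule poly_mapping_eqI) (simp add: lookup_sum lookup_single when_def in_keys_iff)

lemma puis_induct [case_names single add]:
  assumes "\<And>q c. P (Poly_Mapping.single q c)" "\<And>r s. P r \<Longrightarrow> P s \<Longrightarrow> P (r + s)"
  shows "P (r :: 'k::comm_ring_1 puis)"
proof -
  have z: "P 0"
    using assms(1)[of 0 0] by simp
  have "P (\<Sum>q\<in>A. Poly_Mapping.single q (Poly_Mapping.lookup r q))" for A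
    by (induction A rule: infinite_finite_induct) (auto intro: z assms)
  then show ?thesis
    using single_sum[of r] by metis
qed

lemma puis_deriv_single: "puis_deriv (Poly_Mapping.single q c) = Poly_Mapping.single (q - 1) (of_rat q * c)"
  by (auto simp: puis_deriv_def)

lemma puis_deriv_pow_single:
  "(puis_deriv ^^ j) (Poly_Mapping.single p c) = Poly_Mapping.single (p - of_nat j) (fact j * (of_rat p gchoose j) * c)"
proof (induction j)
  case (Suc j)
  have "of_rat (p - of_nat j) * (of_rat p gchoose j) = of_nat (Suc j) * ((of_rat p :: 'a) gchoose Suc j)"
    by (simp only: of_rat_diff of_rat_of_nat_eq gbinomial_absorb_comp gbinomial_absorption)
  then have *: "of_rat (p - of_nat j) * (fact j * (of_rat p gchoose j) * c) = fact (Suc j) * (of_rat p gchoose Suc j) * c"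
    by (simp add: mult_ac del: of_nat_Suc)
  have "(puis_deriv ^^ Suc j) (Poly_Mapping.single p c) = puis_deriv (Poly_Mapping.single (p - of_nat j) (fact j * (of_rat p gchoose j) * c))"
    using Suc by simp
  also have "\<dots> = Poly_Mapping.single (p - of_nat (Suc j)) (fact (Suc j) * (of_rat p gchoose Suc j) * c)"
    unfolding puis_deriv_single * by (simp add: diff_diff_eq add.commute del: fact_Suc)
  finally show ?case .
qed simp

text \<open>The j-th derivative of t^p carries the falling factorial of p, so division by j! leaves
  a binomial coefficient with rational upper entry. The conformal axioms below thereby become
  binomial identities.\<close>

lemma divided_deriv_tpow:
  "kconst (inverse (fact j)) * (puis_deriv ^^ j) (tpow p) = Poly_Mapping.single (p - of_nat j) (of_rat p gchoose j)"
  by (simp add: tpow_def kconst_def puis_deriv_pow_single mult_single mult.assoc[symmetric])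

section \<open>Scalars and derivation on A (x) S-hat\<close>

lemma embedK_apply: "embedK b r p = N2_scale (Poly_Mapping.lookup r p) b"
proof -
  have "embedK b r p = (\<Sum>q\<in>Poly_Mapping.keys r. if p = q then N2_scale (Poly_Mapping.lookup r q) b else 0)"
    by (simp add: embedK_def sum_fun_app at_pt_apply)
  also have "\<dots> = N2_scale (Poly_Mapping.lookup r p) b"
    by (simp add: in_keys_iff)
  finally show ?thesis .
qed

lemma embedK_add: "embedK (a + b) r = embedK a r + embedK b r"
  by (rule ext) (simp add: fun_ops embedK_apply N2_scale_add)
lemma embedK_add_right: "embedK a (r + s) = embedK a r + embedK a s"
  by (rule ext) (simp add: fun_ops embedK_apply lookup_add N2_scale_add_left)
lemma embedK_single: "embedK a (Poly_Mapping.single q c) = at_pt q (N2_scale c a)"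
  by (rule ext) (simp add: fun_ops embedK_apply at_pt_apply lookup_single when_def)
lemma embedK_zero [simp]: "embedK 0 r = 0"
  by (rule ext) (simp add: fun_ops embedK_apply)
lemma fs_embedK [simp]: "fs (embedK a r)"
  by (rule finite_subset[of _ "Poly_Mapping.keys r"]) (auto simp: supp_def embedK_apply in_keys_iff)

lemma AS_smul_add: "fs f \<Longrightarrow> fs g \<Longrightarrow> AS_smul r (f + g) = AS_smul r f + AS_smul r g"
  unfolding AS_smul_def by (rule sum_supp_add) (simp_all add: embedK_add)
lemma AS_smul_add_left: "AS_smul (r + s) f = AS_smul r f + AS_smul s f"
  by (simp add: AS_smul_def distrib_right embedK_add_right sum.distrib)
lemma AS_smul_at_pt: "AS_smul r (at_pt q a) = embedK a (r * tpow q)"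
  unfolding AS_smul_def by (rule sum_supp_at_pt) simp
lemma AS_smul_single: "AS_smul (Poly_Mapping.single r c) (at_pt q a) = at_pt (r + q) (N2_scale c a)"
  by (simp add: AS_smul_at_pt tpow_def mult_single embedK_single)
lemma AS_smul_zero [simp]: "AS_smul r 0 = 0"
  by (simp add: AS_smul_def)
lemma fs_AS_smul [simp]: "fs f \<Longrightarrow> fs (AS_smul r f)"
  unfolding AS_smul_def by (rule fs_sum) simp
lemma AS_smul_sum: "(\<And>i. i \<in> A \<Longrightarrow> fs (h i)) \<Longrightarrow> AS_smul r (\<Sum>i\<in>A. h i) = (\<Sum>i\<in>A. AS_smul r (h i))"
proof (induction A rule: infinite_finite_induct)
  case (insert x F)
  have "AS_smul r (h x + sum h F) = AS_smul r (h x) + AS_smul r (sum h F)"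
    by (rule AS_smul_add) (simp_all add: fs_sum insert.prems)
  moreover have "AS_smul r (sum h F) = (\<Sum>i\<in>F. AS_smul r (h i))"
    by (rule insert.IH) (simp add: insert.prems)
  ultimately show ?case
    by (simp only: sum.insert insert.hyps not_False_eq_True)
qed simp_all

lemma AS_smul_mult:
  assumes "fs f"
  shows "AS_smul (r * s) f = AS_smul r (AS_smul s f)"
  using assms
proof (induction rule: fs_induct)
  case (at_pt q a)
  show ?case
  proof (induction r rule: puis_induct)
    case (single p c)
    show ?case
      by (induction s rule: puis_induct)
        (simp_all add: distrib_left AS_smul_add_left AS_smul_add mult_single AS_smul_single add.assoc)
  qed (simp add: distrib_right AS_smul_add_left)
qed (simp_all add: AS_smul_add)

lemma AS_smul_one [simp]: "fs f \<Longrightarrow> AS_smul 1 f = f"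
proof (induction rule: fs_induct)
  case (at_pt q a)
  show ?case
    using AS_smul_single[of 0 1 q a] by simp
qed (simp_all add: AS_smul_add)

lemma AS_der_add: "fs f \<Longrightarrow> fs g \<Longrightarrow> AS_der (f + g) = AS_der f + AS_der g"
  unfolding AS_der_def by (rule sum_supp_add) (simp_all add: embedK_add at_pt_add N2_der_add add_ac)
lemma AS_der_at_pt: "AS_der (at_pt q a) = at_pt q (N2_der a) + at_pt (q - 1) (N2_scale (of_rat q) a)"
proof -
  have "AS_der (at_pt q a) = at_pt q (N2_der a) + embedK a (puis_deriv (tpow q))"
    unfolding AS_der_def by (rule sum_supp_at_pt) simp
  then show ?thesis
    by (simp add: tpow_def puis_deriv_single embedK_single)
qed
lemma fs_AS_der [simp]: "fs f \<Longrightarrow> fs (AS_der f)"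
  unfolding AS_der_def by (rule fs_sum) simp
lemma AS_der_zero [simp]: "AS_der 0 = 0"
  by (simp add: AS_der_def)

lemma AS_der_smul_single:
  assumes "fs f"
  shows "AS_der (AS_smul (Poly_Mapping.single s c) f) =
    AS_smul (Poly_Mapping.single s c) (AS_der f) + AS_smul (Poly_Mapping.single (s - 1) (of_rat s * c)) f"
  using assms
proof (induction rule: fs_induct)
  case (at_pt q a)
  have e: "s + q - 1 = s + (q - 1)" "s - 1 + q = s + (q - 1)"
    by simp_all
  have "at_pt (s + (q - 1)) (N2_scale (of_rat (s + q) * c) a) =
    at_pt (s + (q - 1)) (N2_scale (c * of_rat q) a) + at_pt (s + (q - 1)) (N2_scale (of_rat s * c) a)"
    unfolding at_pt_add[symmetric] N2_scale_add_left[symmetric]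
    by (simp add: of_rat_add algebra_simps)
  then show ?case
    by (simp only: AS_smul_single AS_der_at_pt AS_smul_add fs_at_pt N2_der_scale N2_scale_scale e add.assoc)
qed (simp_all add: AS_smul_add AS_der_add)

definition AS_scale :: "'k::comm_ring_1 \<Rightarrow> (rat \<Rightarrow> 'k N2) \<Rightarrow> rat \<Rightarrow> 'k N2" where
  "AS_scale c f = (\<lambda>q. N2_scale c (f q))"

lemma AS_scale_at_pt: "AS_scale c (at_pt q a) = at_pt q (N2_scale c a)"
  by (auto simp: AS_scale_def at_pt_def)
lemma AS_scale_add: "AS_scale c (f + g) = AS_scale c f + AS_scale c g"
  by (auto simp: AS_scale_def fun_ops N2_scale_add)
lemma AS_scale_zero [simp]: "AS_scale c 0 = 0"
  by (auto simp: AS_scale_def fun_ops)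
lemma AS_scale_sum: "AS_scale c (\<Sum>i\<in>A. h i) = (\<Sum>i\<in>A. AS_scale c (h i))"
  by (rule ext) (simp add: AS_scale_def sum_fun_app N2_scale_sum)
lemma fs_AS_scale [simp]: "fs f \<Longrightarrow> fs (AS_scale c f)"
  by (rule finite_subset[of _ "supp f"]) (auto simp: supp_def AS_scale_def)
lemma AS_smul_const: "fs f \<Longrightarrow> AS_smul (Poly_Mapping.single 0 c) f = AS_scale c f"
  by (induction rule: fs_induct) (simp_all add: AS_smul_add AS_scale_add AS_smul_single AS_scale_at_pt)

section \<open>The n-products of A (x) S-hat and their axioms\<close>

definition pt_prod :: "nat \<Rightarrow> rat \<Rightarrow> 'k::field_char_0 N2 \<Rightarrow> rat \<Rightarrow> 'k N2 \<Rightarrow> rat \<Rightarrow> 'k N2" where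
  "pt_prod n p a q b = (\<Sum>j<prod_bound N2_prod a b.
      embedK (N2_prod (n + j) a b) (kconst (inverse (fact j)) * (puis_deriv ^^ j) (tpow p) * tpow q))"

text \<open>The cut-off \<open>prod_bound\<close> is a minimum depending on both factors and is not
  additive; any common bound \<open>N\<close> may replace it, since the additional terms
  vanish.\<close>

lemma pt_prod_eq:
  fixes a b :: "'k::field_char_0 N2"
  assumes N: "\<forall>m\<ge>N. N2_prod m a b = 0"
  shows "pt_prod n p a q b = (\<Sum>j<N. at_pt (p + q - of_nat j) (N2_scale (of_rat p gchoose j) (N2_prod (n + j) a b)))"
proof -
  have "embedK (N2_prod (n + j) a b) (kconst (inverse (fact j)) * (puis_deriv ^^ j) (tpow p) * tpow q)
     = at_pt (p + q - of_nat j) (N2_scale (of_rat p gchoose j) (N2_prod (n + j) a b))" for j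
    unfolding divided_deriv_tpow by (simp add: tpow_def mult_single embedK_single algebra_simps)
  then show ?thesis
    unfolding pt_prod_def
    using prod_bound_le[of N N2_prod a b, OF N] prod_bound_local[of N2_prod a b, OF N2_prod_local]
    by (auto intro!: sum.mono_neutral_cong_left)
qed

lemma N2_prod_local2:
  "\<exists>N. (\<forall>m\<ge>N. N2_prod m a b = 0) \<and> (\<forall>m\<ge>N. N2_prod m a' b' = 0)"
proof -
  obtain N N' where "\<forall>m\<ge>N. N2_prod m a b = 0" "\<forall>m\<ge>N'. N2_prod m a' b' = 0"
    using N2_prod_local by metis
  then show ?thesis
    by (intro exI[of _ "max N N'"]) simp
qed

lemma pt_prod_add_left: "pt_prod n p (a + a') q b = pt_prod n p a q b + pt_prod n p a' q b"
proof -
  obtain N where N: "\<forall>m\<ge>N. N2_prod m a b = 0" "\<forall>m\<ge>N. N2_prod m a' b = 0"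
    using N2_prod_local2 by blast
  then have N3: "\<forall>m\<ge>N. N2_prod m (a + a') b = 0"
    by (simp add: N2_prod_add_left)
  show ?thesis
    by (simp add: pt_prod_eq[OF N(1)] pt_prod_eq[OF N(2)] pt_prod_eq[OF N3] N2_prod_add_left N2_scale_add at_pt_add sum.distrib)
qed

lemma pt_prod_add_right: "pt_prod n p a q (b + b') = pt_prod n p a q b + pt_prod n p a q b'"
proof -
  obtain N where N: "\<forall>m\<ge>N. N2_prod m a b = 0" "\<forall>m\<ge>N. N2_prod m a b' = 0"
    using N2_prod_local2 by blast
  then have N3: "\<forall>m\<ge>N. N2_prod m a (b + b') = 0"
    by (simp add: N2_prod_add_right)
  show ?thesis
    by (simp add: pt_prod_eq[OF N(1)] pt_prod_eq[OF N(2)] pt_prod_eq[OF N3] N2_prod_add_right N2_scale_add at_pt_add sum.distrib)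
qed

lemma pt_prod_zero [simp]: "pt_prod n p 0 q b = 0" "pt_prod n p a q 0 = 0"
  using pt_prod_add_left[of n p 0 0 q b] pt_prod_add_right[of n p a q 0 0] by simp_all

lemma AS_prod_alt: "AS_prod n f g = (\<Sum>p\<in>supp f. \<Sum>q\<in>supp g. pt_prod n p (f p) q (g q))"
  by (simp add: AS_prod_def pt_prod_def)

lemma AS_prod_add_left:
  "fs f \<Longrightarrow> fs f' \<Longrightarrow> AS_prod n (f + f') g = AS_prod n f g + AS_prod n f' g"
  unfolding AS_prod_alt
  by (rule sum_supp_add[where h = "\<lambda>p a. \<Sum>q\<in>supp g. pt_prod n p a q (g q)"])
    (simp_all add: pt_prod_add_left sum.distrib)

lemma AS_prod_add_right:
  assumes "fs g" "fs g'"
  shows "AS_prod n f (g + g') = AS_prod n f g + AS_prod n f g'"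
proof -
  have "(\<Sum>q\<in>supp (g + g'). pt_prod n p (f p) q ((g + g') q)) =
    (\<Sum>q\<in>supp g. pt_prod n p (f p) q (g q)) + (\<Sum>q\<in>supp g'. pt_prod n p (f p) q (g' q))" for p
    by (rule sum_supp_add) (use assms in \<open>simp_all add: pt_prod_add_right\<close>)
  then show ?thesis
    by (simp add: AS_prod_alt sum.distrib)
qed

lemma AS_prod_zero [simp]: "AS_prod n 0 g = 0" "AS_prod n f 0 = 0"
  by (simp_all add: AS_prod_def)

lemma fs_pt_prod [simp]: "fs (pt_prod n p a q b)"
  unfolding pt_prod_def by (rule fs_sum) simp

lemma fs_AS_prod [simp]: "fs (AS_prod n f g)"
  unfolding AS_prod_alt by (intro fs_sum) simp

lemma AS_prod_at_pt: "AS_prod n (at_pt p a) (at_pt q b) = pt_prod n p a q b"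
proof -
  have "AS_prod n (at_pt p a) (at_pt q b) = (\<Sum>q'\<in>supp (at_pt q b). pt_prod n p a q' (at_pt q b q'))"
    unfolding AS_prod_alt
    by (rule sum_supp_at_pt[where h = "\<lambda>p a. \<Sum>q'\<in>supp (at_pt q b). pt_prod n p a q' (at_pt q b q')"]) simp
  also have "\<dots> = pt_prod n p a q b"
    by (rule sum_supp_at_pt) simp
  finally show ?thesis .
qed

lemma fs_induct2 [consumes 2, case_names zero_left zero_right at_pt add_left add_right]:
  fixes f :: "'i \<Rightarrow> 'b::comm_monoid_add" and g :: "'j \<Rightarrow> 'c::comm_monoid_add"
  assumes "fs f" "fs g" and "\<And>g. fs g \<Longrightarrow> P 0 g" and "\<And>f. fs f \<Longrightarrow> P f 0" and "\<And>p a q b. P (at_pt p a) (at_pt q b)"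
    and "\<And>f f' g. fs f \<Longrightarrow> fs f' \<Longrightarrow> fs g \<Longrightarrow> P f g \<Longrightarrow> P f' g \<Longrightarrow> P (f + f') g"
    and "\<And>f g g'. fs f \<Longrightarrow> fs g \<Longrightarrow> fs g' \<Longrightarrow> P f g \<Longrightarrow> P f g' \<Longrightarrow> P f (g + g')"
  shows "P f g"
  using assms(1)
proof (induction rule: fs_induct)
  case (at_pt p a)
  from assms(2) show ?case
    by (induction rule: fs_induct) (use assms in auto)
qed (use assms in auto)

lemma AS_prod_local: "fs f \<Longrightarrow> fs g \<Longrightarrow> \<exists>N. \<forall>m\<ge>N. AS_prod m f g = 0"
proof (induction rule: fs_induct2)
  case (at_pt p a q b)
  obtain N where N: "\<forall>m\<ge>N. N2_prod m a b = 0"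
    using N2_prod_local by blast
  then show ?case
    by (intro exI[of _ N]) (simp add: AS_prod_at_pt pt_prod_eq)
next
  case (add_left f f' g)
  then obtain N N' where "\<forall>m\<ge>N. AS_prod m f g = 0" "\<forall>m\<ge>N'. AS_prod m f' g = 0"
    by blast
  with add_left show ?case
    by (intro exI[of _ "max N N'"]) (simp add: AS_prod_add_left)
next
  case (add_right f g g')
  then obtain N N' where "\<forall>m\<ge>N. AS_prod m f g = 0" "\<forall>m\<ge>N'. AS_prod m f g' = 0"
    by blast
  with add_right show ?case
    by (intro exI[of _ "max N N'"]) (simp add: AS_prod_add_right)
qed auto

text \<open>In the j-th term the part d (x) 1 contributes the factor -(n + j). The part 1 (x) d/dt
  contributes + j, by the absorption p (p - 1 gchoose j) = (j + 1) (p gchoose j + 1) and a shift of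
  j. What remains is -n.\<close>

lemma AS_prod_der_left:
  fixes f g :: "rat \<Rightarrow> 'k::field_char_0 N2"
  assumes "fs f" "fs g"
  shows "AS_prod n (AS_der f) g = AS_scale (- of_nat n) (AS_prod (n - 1) f g)"
  using assms
proof (induction rule: fs_induct2)
  case (at_pt p a q b)
  obtain N where N: "\<forall>m\<ge>N. N2_prod m a b = 0"
    using N2_prod_local by blast
  let ?P = "of_rat p :: 'k" and ?X = "\<lambda>m. N2_prod m a b"
  have N1: "\<forall>m\<ge>Suc N. N2_prod m (N2_der a) b = 0"
    using N by (simp add: N2_prod_der_left)
  have N2: "\<forall>m\<ge>N. N2_prod m (N2_scale ?P a) b = 0"
    using N by (simp add: N2_prod_scale_left)
  have N3: "\<forall>m\<ge>Suc N. N2_prod m a b = 0"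
    using N by simp
  have "AS_prod n (AS_der (at_pt p a)) (at_pt q b) = pt_prod n p (N2_der a) q b + pt_prod n (p - 1) (N2_scale ?P a) q b"
    by (simp add: AS_der_at_pt AS_prod_add_left AS_prod_at_pt)
  also have "pt_prod n p (N2_der a) q b =
      (\<Sum>j<Suc N. at_pt (p + q - of_nat j) (N2_scale (- of_nat (n + j) * (?P gchoose j)) (?X (n + j - 1))))"
    by (simp only: pt_prod_eq[OF N1] N2_prod_der_left N2_scale_minus_left[symmetric] N2_scale_scale mult.commute)
  also have "pt_prod n (p - 1) (N2_scale ?P a) q b =
      (\<Sum>j<N. at_pt (p + q - of_nat (Suc j)) (N2_scale (of_nat (Suc j) * (?P gchoose Suc j)) (?X (n + Suc j - 1))))"
  proof -
    have e: "p - 1 + q - of_nat j = p + q - of_nat (Suc j)" for j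
      by simp
    show ?thesis
      unfolding pt_prod_eq[OF N2] gbinomial_absorption e
      by (simp add: N2_prod_scale_left of_rat_diff mult.commute)
  qed
  also have "\<dots> = (\<Sum>j<Suc N. at_pt (p + q - of_nat j) (N2_scale (of_nat j * (?P gchoose j)) (?X (n + j - 1))))"
    by (subst sum.lessThan_Suc_shift) simp
  also have "(\<Sum>j<Suc N. at_pt (p + q - of_nat j) (N2_scale (- of_nat (n + j) * (?P gchoose j)) (?X (n + j - 1)))) + \<dots>
     = (\<Sum>j<Suc N. AS_scale (- of_nat n) (at_pt (p + q - of_nat j) (N2_scale (?P gchoose j) (?X (n - 1 + j)))))"
    unfolding sum.distrib[symmetric]
  proof (rule sum.cong, goal_cases)
    case (2 j)
    have "- of_nat (n + j) * (?P gchoose j) + of_nat j * (?P gchoose j) = - of_nat n * (?P gchoose j)"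
      by (simp add: algebra_simps)
    \<comment> \<open>For n = 0 the truncated indices n + j - 1 and n - 1 + j may differ, but their
      coefficient is 0.\<close>
    then show ?case
      unfolding at_pt_add[symmetric] N2_scale_add_left[symmetric] AS_scale_at_pt N2_scale_scale
      by (cases n) auto
  qed simp
  also have "\<dots> = AS_scale (- of_nat n) (AS_prod (n - 1) (at_pt p a) (at_pt q b))"
    unfolding AS_prod_at_pt pt_prod_eq[OF N3] AS_scale_sum ..
  finally show ?case .
qed (simp_all add: AS_der_add AS_prod_add_left AS_prod_add_right AS_scale_add)

text \<open>Moving d across gives the factor n + j. Its part n is the correction term; its part j
  turns, after a shift, into p - j and joins the factor q from differentiating t^q. Since p + q - j
  is the exponent of t in the j-th term, this completes the derivative of the product.\<close>

lemma AS_prod_der_right: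
  fixes f g :: "rat \<Rightarrow> 'k::field_char_0 N2"
  assumes "fs f" "fs g"
  shows "AS_prod n f (AS_der g) = AS_der (AS_prod n f g) + AS_scale (of_nat n) (AS_prod (n - 1) f g)"
  using assms
proof (induction rule: fs_induct2)
  case (at_pt p a q b)
  obtain N where N: "\<forall>m\<ge>N. N2_prod m a b = 0"
    using N2_prod_local by blast
  let ?P = "of_rat p :: 'k" and ?Q = "of_rat q :: 'k" and ?X = "\<lambda>m. N2_prod m a b"
  let ?e = "\<lambda>j c m. at_pt (p + q - of_nat j) (N2_scale c (?X m))"
  let ?D = "\<lambda>j. at_pt (p + q - of_nat j) (N2_scale (?P gchoose j) (N2_der (?X (n + j))))"
  have N1: "\<forall>m\<ge>Suc N. N2_prod m a (N2_der b) = 0"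
    using N by (simp add: N2_prod_der_right)
  have N2: "\<forall>m\<ge>N. N2_prod m a (N2_scale ?Q b) = 0"
    using N by (simp add: N2_prod_scale_right)
  have N3: "\<forall>m\<ge>Suc N. N2_prod m a b = 0"
    using N by simp
  have der_sum: "AS_der (\<Sum>j\<in>A. h j) = (\<Sum>j\<in>A. AS_der (h j))" if "\<And>j. fs (h j)" for h :: "nat \<Rightarrow> rat \<Rightarrow> 'k N2" and A
    by (induction A rule: infinite_finite_induct) (simp_all add: AS_der_add that fs_sum)
  have "AS_prod n (at_pt p a) (AS_der (at_pt q b)) = pt_prod n p a q (N2_der b) + pt_prod n p a (q - 1) (N2_scale ?Q b)"
    by (simp add: AS_der_at_pt AS_prod_add_right AS_prod_at_pt)
  also have "pt_prod n p a q (N2_der b) =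
      (\<Sum>j<Suc N. ?D j) + (\<Sum>j<Suc N. ?e j (of_nat j * (?P gchoose j)) (n + j - 1))
      + (\<Sum>j<Suc N. ?e j (of_nat n * (?P gchoose j)) (n - 1 + j))"
    unfolding pt_prod_eq[OF N1] N2_prod_der_right N2_scale_add at_pt_add sum.distrib add.assoc
      N2_scale_scale
  proof (rule arg_cong2[where f = "(+)"], rule refl, unfold sum.distrib[symmetric], rule sum.cong, goal_cases)
    case (2 j)
    have "(?P gchoose j) * of_nat (n + j) = of_nat j * (?P gchoose j) + of_nat n * (?P gchoose j)"
      by (simp add: algebra_simps)
    then show ?case
      unfolding at_pt_add[symmetric] by (cases n) (auto simp: N2_scale_add_left mult.commute)
  qed simp
  also have "(\<Sum>j<Suc N. ?e j (of_nat j * (?P gchoose j)) (n + j - 1))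
     = (\<Sum>j<N. ?e (Suc j) ((?P - of_nat j) * (?P gchoose j)) (n + j))"
    by (subst sum.lessThan_Suc_shift) (simp add: gbinomial_absorption gbinomial_absorb_comp del: of_nat_Suc)
  also have "pt_prod n p a (q - 1) (N2_scale ?Q b) = (\<Sum>j<N. ?e (Suc j) (?Q * (?P gchoose j)) (n + j))"
    unfolding pt_prod_eq[OF N2] by (simp add: N2_prod_scale_right mult.commute algebra_simps)
  also have "(\<Sum>j<Suc N. ?D j) + (\<Sum>j<N. ?e (Suc j) ((?P - of_nat j) * (?P gchoose j)) (n + j))
      + (\<Sum>j<Suc N. ?e j (of_nat n * (?P gchoose j)) (n - 1 + j)) + (\<Sum>j<N. ?e (Suc j) (?Q * (?P gchoose j)) (n + j))
     = (\<Sum>j<Suc N. ?D j) + (\<Sum>j<N. ?e (Suc j) ((?P + ?Q - of_nat j) * (?P gchoose j)) (n + j))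
      + (\<Sum>j<Suc N. ?e j (of_nat n * (?P gchoose j)) (n - 1 + j))"
  proof -
    have "(\<Sum>j<N. ?e (Suc j) ((?P - of_nat j) * (?P gchoose j)) (n + j)) + (\<Sum>j<N. ?e (Suc j) (?Q * (?P gchoose j)) (n + j))
      = (\<Sum>j<N. ?e (Suc j) ((?P + ?Q - of_nat j) * (?P gchoose j)) (n + j))"
      unfolding sum.distrib[symmetric] at_pt_add[symmetric] N2_scale_add_left[symmetric] distrib_right[symmetric]
      by (simp add: algebra_simps)
    moreover have "D + A + E + C = D + B + E" if "A + C = B" for A B C D E :: "rat \<Rightarrow> 'k N2"
      unfolding that[symmetric] by (simp add: add_ac)
    ultimately show ?thesis
      by blast
  qed
  also have "(\<Sum>j<Suc N. ?D j) = (\<Sum>j<N. ?D j)"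
    using N by simp
  also have "(\<Sum>j<N. ?D j) + (\<Sum>j<N. ?e (Suc j) ((?P + ?Q - of_nat j) * (?P gchoose j)) (n + j)) = AS_der (AS_prod n (at_pt p a) (at_pt q b))"
    unfolding AS_prod_at_pt pt_prod_eq[OF N]
    by (subst der_sum) (simp_all add: AS_der_at_pt N2_der_scale sum.distrib of_rat_diff of_rat_add algebra_simps)
  also have "(\<Sum>j<Suc N. ?e j (of_nat n * (?P gchoose j)) (n - 1 + j)) = AS_scale (of_nat n) (AS_prod (n - 1) (at_pt p a) (at_pt q b))"
    unfolding AS_prod_at_pt pt_prod_eq[OF N3] AS_scale_sum AS_scale_at_pt N2_scale_scale ..
  finally show ?case .
qed (simp_all add: AS_der_add AS_prod_add_left AS_prod_add_right AS_scale_add)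

lemma AS_smul_single_sum_at_pt:
  "AS_smul (Poly_Mapping.single s c) (\<Sum>j\<in>A. at_pt (h j) (k j)) = (\<Sum>j\<in>A. at_pt (s + h j) (N2_scale c (k j)))"
  by (subst AS_smul_sum) (simp_all add: AS_smul_single)

lemma AS_prod_smul_right:
  fixes f g :: "rat \<Rightarrow> 'k::field_char_0 N2"
  assumes "fs f" "fs g"
  shows "AS_prod n f (AS_smul (Poly_Mapping.single s c) g) = AS_smul (Poly_Mapping.single s c) (AS_prod n f g)"
  using assms
proof (induction rule: fs_induct2)
  case (at_pt p a q b)
  obtain N where N: "\<forall>m\<ge>N. N2_prod m a b = 0"
    using N2_prod_local by blast
  have N1: "\<forall>m\<ge>N. N2_prod m a (N2_scale c b) = 0"
    using N by (simp add: N2_prod_scale_right)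
  have e: "p + (s + q) - of_nat j = s + (p + q - of_nat j)" for j
    by simp
  show ?case
    by (simp only: AS_smul_single AS_prod_at_pt pt_prod_eq[OF N] pt_prod_eq[OF N1] N2_prod_scale_right
        AS_smul_single_sum_at_pt N2_scale_scale e mult.commute)
qed (simp_all add: AS_smul_add AS_prod_add_left AS_prod_add_right)

text \<open>The right-hand side of the axiom for (r a)_(n) b with r = c t^s. The cut-off is an
  argument so that summands with different bounds can be compared.\<close>

definition leibniz_left :: "nat \<Rightarrow> rat \<Rightarrow> 'k::field_char_0 \<Rightarrow> (rat \<Rightarrow> 'k N2) \<Rightarrow> (rat \<Rightarrow> 'k N2) \<Rightarrow> nat \<Rightarrow> rat \<Rightarrow> 'k N2" where
  "leibniz_left n s c f g N =
     (\<Sum>j<N. AS_smul (Poly_Mapping.single (s - of_nat j) ((of_rat s gchoose j) * c)) (AS_prod (n + j) f g))"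

lemma leibniz_left_bound:
  assumes "\<forall>m\<ge>N. AS_prod m f g = 0" "\<forall>m\<ge>N'. AS_prod m f g = 0"
  shows "leibniz_left n s c f g N = leibniz_left n s c f g N'"
proof -
  have "leibniz_left n s c f g K = leibniz_left n s c f g (max K K')" if "\<forall>m\<ge>K. AS_prod m f g = 0" for K K'
    unfolding leibniz_left_def using that by (intro sum.mono_neutral_left) auto
  then show ?thesis
    using assms by (metis max.commute)
qed

text \<open>The expansions of t^s and of t^p are compared with the single one of t^(s+p): the terms
  of the square with i + j >= N vanish, the remaining triangle is summed along l = i + j, and
  Vandermonde's identity evaluates each diagonal.\<close>

lemma AS_prod_smul_left_at_pt:
  fixes a b :: "'k::field_char_0 N2"
  assumes N: "\<forall>m\<ge>N. N2_prod m a b = 0"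
  shows "AS_prod n (AS_smul (Poly_Mapping.single s c) (at_pt p a)) (at_pt q b)
    = leibniz_left n s c (at_pt p a) (at_pt q b) N"
proof -
  let ?P = "of_rat p :: 'k" and ?S = "of_rat s :: 'k" and ?X = "\<lambda>m. N2_prod m a b"
  have N1: "\<forall>m\<ge>N. N2_prod m (N2_scale c a) b = 0"
    using N by (simp add: N2_prod_scale_left)
  let ?t = "\<lambda>i j. at_pt (s + p + q - of_nat (i + j)) (N2_scale ((?S gchoose j) * c * (?P gchoose i)) (?X (n + (i + j))))"
  have "leibniz_left n s c (at_pt p a) (at_pt q b) N = (\<Sum>j<N. \<Sum>i<N. ?t i j)"
  proof -
    have e: "s - of_nat j + (p + q - of_nat i) = s + p + q - of_nat (i + j)" "n + j + i = n + (i + j)" for i j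
      by simp_all
    show ?thesis
      unfolding leibniz_left_def AS_prod_at_pt pt_prod_eq[OF N] AS_smul_single_sum_at_pt N2_scale_scale e ..
  qed
  also have "\<dots> = (\<Sum>(j, i)\<in>{..<N} \<times> {..<N}. ?t i j)"
    by (rule sum.cartesian_product)
  also have "\<dots> = (\<Sum>(j, i)\<in>(SIGMA l:{..<N}. {..l}). ?t (j - i) i)"
  proof -
    have "(\<Sum>(j, i)\<in>(SIGMA l:{..<N}. {..l}). ?t (j - i) i) = (\<Sum>(j, i)\<in>{(j, i). j + i < N}. ?t i j)"
      by (rule sum.reindex_bij_witness[of _ "\<lambda>(j, i). (j + i, j)" "\<lambda>(l, i). (i, l - i)"]) auto
    also have "\<dots> = (\<Sum>(j, i)\<in>{..<N} \<times> {..<N}. ?t i j)"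
      using N by (intro sum.mono_neutral_left) auto
    finally show ?thesis ..
  qed
  also have "\<dots> = (\<Sum>l<N. \<Sum>i\<le>l. ?t (l - i) i)"
    by (subst sum.Sigma[symmetric]) auto
  also have "\<dots> = (\<Sum>l<N. at_pt (s + p + q - of_nat l) (N2_scale (((?S + ?P) gchoose l) * c) (?X (n + l))))"
  proof (rule sum.cong, goal_cases)
    case (2 l)
    have "(\<Sum>i\<le>l. ?t (l - i) i) = (\<Sum>i\<le>l. at_pt (s + p + q - of_nat l) (N2_scale ((?S gchoose i) * (?P gchoose (l - i)) * c) (?X (n + l))))"
      by (rule sum.cong) (auto simp: mult_ac)
    also have "\<dots> = at_pt (s + p + q - of_nat l) (N2_scale ((\<Sum>i\<le>l. (?S gchoose i) * (?P gchoose (l - i))) * c) (?X (n + l)))"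
      by (simp only: at_pt_sum[symmetric] N2_scale_sum_left[symmetric] sum_distrib_right[symmetric])
    finally show ?case
      by (simp only: gbinomial_Vandermonde[unfolded atLeast0AtMost])
  qed simp
  also have "\<dots> = AS_prod n (AS_smul (Poly_Mapping.single s c) (at_pt p a)) (at_pt q b)"
    unfolding AS_smul_single AS_prod_at_pt pt_prod_eq[OF N1] N2_prod_scale_left of_rat_add N2_scale_scale ..
  finally show ?thesis ..
qed

lemma AS_prod_smul_left:
  fixes f g :: "rat \<Rightarrow> 'k::field_char_0 N2"
  assumes "fs f" "fs g" and N: "\<forall>m\<ge>N. AS_prod m f g = 0"
  shows "AS_prod n (AS_smul (Poly_Mapping.single s c) f) g =
     (\<Sum>j<N. AS_smul (Poly_Mapping.single (s - of_nat j) ((of_rat s gchoose j) * c)) (AS_prod (n + j) f g))"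
proof -
  \<comment> \<open>The induction carries only some bound: a bound for f + f' need not be one for f
    and for f'.\<close>
  have "\<exists>N0. (\<forall>m\<ge>N0. AS_prod m f g = 0) \<and> AS_prod n (AS_smul (Poly_Mapping.single s c) f) g = leibniz_left n s c f g N0"
    using assms(1,2)
  proof (induction rule: fs_induct2)
    case (at_pt p a q b)
    obtain N where N: "\<forall>m\<ge>N. N2_prod m a b = 0"
      using N2_prod_local by blast
    then show ?case
      by (intro exI[of _ N]) (simp add: AS_prod_smul_left_at_pt AS_prod_at_pt pt_prod_eq)
  next
    case (add_left f f' g)
    then obtain N N' where N: "\<forall>m\<ge>N. AS_prod m f g = 0" "\<forall>m\<ge>N'. AS_prod m f' g = 0"
      and e: "AS_prod n (AS_smul (Poly_Mapping.single s c) f) g = leibniz_left n s c f g N"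
        "AS_prod n (AS_smul (Poly_Mapping.single s c) f') g = leibniz_left n s c f' g N'"
      by blast
    let ?M = "max N N'"
    from N have "leibniz_left n s c f g N = leibniz_left n s c f g ?M" "leibniz_left n s c f' g N' = leibniz_left n s c f' g ?M"
      by (auto intro: leibniz_left_bound)
    with e N add_left.hyps show ?case
      by (intro exI[of _ ?M])
        (simp add: AS_smul_add AS_prod_add_left leibniz_left_def sum.distrib)
  next
    case (add_right f g g')
    then obtain N N' where N: "\<forall>m\<ge>N. AS_prod m f g = 0" "\<forall>m\<ge>N'. AS_prod m f g' = 0"
      and e: "AS_prod n (AS_smul (Poly_Mapping.single s c) f) g = leibniz_left n s c f g N"
        "AS_prod n (AS_smul (Poly_Mapping.single s c) f) g' = leibniz_left n s c f g' N'"
      by blast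
    let ?M = "max N N'"
    from N have "leibniz_left n s c f g N = leibniz_left n s c f g ?M" "leibniz_left n s c f g' N' = leibniz_left n s c f g' ?M"
      by (auto intro: leibniz_left_bound)
    with e N add_right.hyps show ?case
      by (intro exI[of _ ?M])
        (simp add: AS_smul_add AS_prod_add_right leibniz_left_def sum.distrib)
  qed (auto simp: leibniz_left_def)
  then show ?thesis
    using leibniz_left_bound[OF N] by (auto simp: leibniz_left_def)
qed

section \<open>Monomials, generators and structure constants\<close>

definition gmon :: "gen \<Rightarrow> 'k::comm_ring_1 \<Rightarrow> nat \<Rightarrow> 'k N2" where
  "gmon x c i = gen_el x (monom c i)"

lemma N2_scale_gmon: "N2_scale d (gmon x c i) = gmon x (d * c) i"
  by (simp add: gmon_def N2_scale_gen_el smult_monom)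
lemma N2_der_gmon: "N2_der (gmon x c i) = gmon x c (Suc i)"
  by (simp add: gmon_def N2_der_gen_el_monom)
lemma gmon_0 [simp]: "gmon x 0 i = 0"
  by (simp add: gmon_def)
lemma gmon_add: "gmon x (c + d) i = gmon x c i + gmon x d i"
  by (simp add: gmon_def add_monom[symmetric] gen_el_add)
lemma gmon_minus: "gmon x (- c) i = - gmon x c i"
  by (simp add: gmon_def minus_monom[symmetric] gen_el_uminus)
lemma gmon_apply: "gmon x c i z = (if z = x then monom c i else 0)"
  by (simp add: gmon_def gen_el_apply)
lemma gmon_eq_0_iff [simp]: "gmon x c i = 0 \<longleftrightarrow> c = 0"
  by (auto simp: fun_eq_iff gmon_apply fun_ops)

lemmas N2_mono_induct = N2_induct[folded gmon_def, case_names mono add]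

lemma N2_prod_gmon: "N2_prod n (gmon x c i) (gmon y d j) = N2_scale (c * d) (basic_prod x i y j n)"
  by (simp add: gmon_def N2_prod_mono)

lemma gp0_table:
  "gp0 gL gL = gmon gL 1 1" "gp0 gL gJ = gmon gJ 1 1" "gp0 gL gGp = gmon gGp 1 1" "gp0 gL gGm = gmon gGm 1 1"
  "gp0 gJ gL = 0" "gp0 gJ gJ = 0" "gp0 gJ gGp = gmon gGp 1 0" "gp0 gJ gGm = gmon gGm (- 1) 0"
  "gp0 gGp gL = gmon gGp (1/2) 1" "gp0 gGm gL = gmon gGm (1/2) 1"
  "gp0 gGp gJ = gmon gGp (- 1) 0" "gp0 gGm gJ = gmon gGm 1 0" "gp0 gGp gGp = 0" "gp0 gGm gGm = 0"
  "gp0 gGp gGm = gmon gL 1 0 + gmon gJ (1/2) 1" "gp0 gGm gGp = gmon gL 1 0 + gmon gJ (- 1/2) 1"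
  by (simp_all add: gmon_def monom_0 one_pCons gen_el_uminus[symmetric] minus_monom diff_conv_add_uminus del: add_uminus_conv_diff)

lemma gp1_table:
  "gp1 gL gL = gmon gL 2 0" "gp1 gL gJ = gmon gJ 1 0" "gp1 gL gGp = gmon gGp (3/2) 0" "gp1 gL gGm = gmon gGm (3/2) 0"
  "gp1 gJ gL = gmon gJ 1 0" "gp1 gJ gJ = 0" "gp1 gJ gGp = 0" "gp1 gJ gGm = 0"
  "gp1 gGp gL = gmon gGp (3/2) 0" "gp1 gGm gL = gmon gGm (3/2) 0"
  "gp1 gGp gJ = 0" "gp1 gGm gJ = 0" "gp1 gGp gGp = 0" "gp1 gGm gGm = 0"
  "gp1 gGp gGm = gmon gJ 1 0" "gp1 gGm gGp = gmon gJ (- 1) 0"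
  by (simp_all add: gmon_def monom_0 one_pCons gen_el_uminus[symmetric] minus_monom)

declare gp0.simps [simp del] gp1.simps [simp del]

lemma gp_0: "gp 0 x y = gp0 x y" and gp_1: "gp (Suc 0) x y = gp1 x y" and gp_ge2: "n \<ge> 2 \<Longrightarrow> gp n x y = 0"
  by (auto simp: gp_def)

definition Gen :: "gen \<Rightarrow> rat \<Rightarrow> 'k::comm_ring_1 N2" where
  "Gen x = at_pt 0 (gmon x 1 0)"

lemma fs_Gen [simp]: "fs (Gen x)"
  by (simp add: Gen_def)

lemma AS_der_at_0: "AS_der (at_pt 0 a) = at_pt 0 (N2_der a)"
  by (simp add: AS_der_at_pt)

lemma AS_der_pow_Gen: "(AS_der ^^ i) (Gen x) = at_pt 0 (gmon x 1 i)"
  by (induction i) (simp_all add: Gen_def AS_der_at_0 N2_der_gmon)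

lemma at_pt_gmon_eq: "at_pt q (gmon x c i) = AS_smul (Poly_Mapping.single q c) ((AS_der ^^ i) (Gen x))"
  by (simp add: AS_der_pow_Gen AS_smul_single N2_scale_gmon)

lemma AS_mono_induct [consumes 1, case_names gmon add]:
  fixes f :: "rat \<Rightarrow> 'k::comm_ring_1 N2"
  assumes f: "fs f" and m: "\<And>q x c i. P (at_pt q (gmon x c i))"
    and a: "\<And>f g. fs f \<Longrightarrow> fs g \<Longrightarrow> P f \<Longrightarrow> P g \<Longrightarrow> P (f + g)"
  shows "P f"
  using f
proof (induction rule: fs_induct)
  case zero
  show ?case
    using m[of 0 _ 0] by simp
next
  case (at_pt q b)
  show ?case
    by (induction b rule: N2_mono_induct) (simp_all add: m a at_pt_add)
qed (use a in auto)

text \<open>The closure operations are those that a semilinear map respects by definition, so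
  equality and multiplicativity of such maps can be tested on the four generators.\<close>

lemma AS_gen_induct [consumes 1, case_names Gen der smul add]:
  fixes f :: "rat \<Rightarrow> 'k::field_char_0 N2"
  assumes f: "fs f" and G: "\<And>x. P (Gen x)" and d: "\<And>f. fs f \<Longrightarrow> P f \<Longrightarrow> P (AS_der f)"
    and s: "\<And>q c f. fs f \<Longrightarrow> P f \<Longrightarrow> P (AS_smul (Poly_Mapping.single q c) f)"
    and a: "\<And>f g. fs f \<Longrightarrow> fs g \<Longrightarrow> P f \<Longrightarrow> P g \<Longrightarrow> P (f + g)"
  shows "P f"
  using f
proof (induction rule: AS_mono_induct)
  case (gmon q x c i)
  have "P ((AS_der ^^ i) (Gen x)) \<and> fs ((AS_der ^^ i) (Gen x) :: rat \<Rightarrow> 'k N2)"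
    by (induction i) (auto intro: G d)
  then show ?case
    by (simp add: at_pt_gmon_eq s)
qed (use a in auto)

section \<open>Semilinear homomorphisms\<close>

text \<open>Constant \<open>\<kappa>\<close> = 1 gives S-hat-linear maps such as the spectral flow,
  \<open>\<kappa>\<close> = \<open>chi\<close> gives Gamma-semilinear ones. The clauses are
  restricted to finitely supported functions, as only these represent elements of A (x)
  S-hat.\<close>

definition conf_lin :: "(rat \<Rightarrow> 'k::field_char_0) \<Rightarrow> ((rat \<Rightarrow> 'k N2) \<Rightarrow> rat \<Rightarrow> 'k N2) \<Rightarrow> bool" where
  "conf_lin \<kappa> u \<longleftrightarrow> (\<forall>f. fs f \<longrightarrow> fs (u f)) \<and> (\<forall>f g. fs f \<longrightarrow> fs g \<longrightarrow> u (f + g) = u f + u g)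
    \<and> (\<forall>q c f. fs f \<longrightarrow> u (AS_smul (Poly_Mapping.single q c) f) = AS_smul (Poly_Mapping.single q (\<kappa> q * c)) (u f))
    \<and> (\<forall>f. fs f \<longrightarrow> u (AS_der f) = AS_der (u f))"

definition conf_hom :: "(rat \<Rightarrow> 'k::field_char_0) \<Rightarrow> ((rat \<Rightarrow> 'k N2) \<Rightarrow> rat \<Rightarrow> 'k N2) \<Rightarrow> bool" where
  "conf_hom \<kappa> u \<longleftrightarrow> conf_lin \<kappa> u
    \<and> (\<forall>n f g. fs f \<longrightarrow> fs g \<longrightarrow> u (AS_prod n f g) = AS_prod n (u f) (u g))"

lemma conf_linD:
  assumes "conf_lin \<kappa> u"
  shows "fs f \<Longrightarrow> fs (u f)" "fs f \<Longrightarrow> fs g \<Longrightarrow> u (f + g) = u f + u g"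
    "fs f \<Longrightarrow> u (AS_smul (Poly_Mapping.single q c) f) = AS_smul (Poly_Mapping.single q (\<kappa> q * c)) (u f)"
    "fs f \<Longrightarrow> u (AS_der f) = AS_der (u f)"
  using assms by (auto simp: conf_lin_def)

lemma conf_lin_0: "conf_lin \<kappa> u \<Longrightarrow> u 0 = 0"
  using conf_linD(2)[of \<kappa> u 0 0] by simp

lemma conf_lin_sum:
  assumes "conf_lin \<kappa> u" "\<And>i. i \<in> A \<Longrightarrow> fs (h i)"
  shows "u (\<Sum>i\<in>A. h i) = (\<Sum>i\<in>A. u (h i))"
  using assms(2)
proof (induction A rule: infinite_finite_induct)
  case (insert x F)
  have "u (h x + sum h F) = u (h x) + u (sum h F)"
    by (rule conf_linD(2)[OF assms(1)]) (simp_all add: fs_sum insert.prems)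
  with insert show ?case
    by simp
qed (simp_all add: conf_lin_0[OF assms(1)])

lemma conf_lin_scale: "conf_lin \<kappa> u \<Longrightarrow> \<kappa> 0 = 1 \<Longrightarrow> fs f \<Longrightarrow> u (AS_scale c f) = AS_scale c (u f)"
  using conf_linD(3)[of \<kappa> u f 0 c] conf_linD(1)[of \<kappa> u f] by (simp add: AS_smul_const)

lemma conf_lin_comp:
  "conf_lin \<kappa> u \<Longrightarrow> conf_lin \<kappa>' v \<Longrightarrow> conf_lin (\<lambda>q. \<kappa> q * \<kappa>' q) (\<lambda>f. u (v f))"
  by (auto simp: conf_lin_def mult.assoc)

lemma conf_hom_comp:
  "conf_hom \<kappa> u \<Longrightarrow> conf_hom \<kappa>' v \<Longrightarrow> conf_hom (\<lambda>q. \<kappa> q * \<kappa>' q) (\<lambda>f. u (v f))"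
  by (auto simp: conf_hom_def conf_lin_def mult.assoc)

lemma conf_lin_eqI:
  assumes "conf_lin \<kappa> u" "conf_lin \<kappa> v" "\<And>x. u (Gen x) = v (Gen x)" "fs f"
  shows "u f = v f"
  using assms(4)
  by (induction rule: AS_gen_induct)
    (simp_all add: assms(3) conf_linD[OF assms(1)] conf_linD[OF assms(2)])

text \<open>Induction on both arguments by the axioms. The Leibniz sum for a scalar t^s contains
  t^(s-j), whence the invariance of \<open>\<kappa>\<close> under integer shifts;
  \<open>\<kappa> 0 = 1\<close> lets the integer factors from the derivation pass.\<close>

lemma conf_homI:
  fixes u :: "(rat \<Rightarrow> 'k::field_char_0 N2) \<Rightarrow> rat \<Rightarrow> 'k N2"
  assumes u: "conf_lin \<kappa> u" and k0: "\<kappa> 0 = 1" and kj: "\<And>q j. \<kappa> (q - of_nat j) = \<kappa> q"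
    and gen: "\<And>n x y. u (AS_prod n (Gen x) (Gen y)) = AS_prod n (u (Gen x)) (u (Gen y))"
  shows "conf_hom \<kappa> u"
proof -
  note us = conf_lin_scale[OF u k0] and usum = conf_lin_sum[OF u] and u = conf_linD[OF u]
  have 1: "u (AS_prod n (Gen x) g) = AS_prod n (u (Gen x)) (u g)" if "fs g" for n x g
    using that
  proof (induction arbitrary: n rule: AS_gen_induct)
    case (der g)
    then show ?case
      by (simp add: u us AS_prod_der_right)
  qed (simp_all add: gen u AS_prod_smul_right AS_prod_add_right)
  have 2: "u (AS_prod n f g) = AS_prod n (u f) (u g)" if ff: "fs f" and gg: "fs g" for n f g
    using ff
  proof (induction arbitrary: n rule: AS_gen_induct)
    case (der f)
    then show ?case
      using gg by (simp add: u us AS_prod_der_left)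
  next
    case (smul s c f)
    obtain N where N: "\<forall>m\<ge>N. AS_prod m f g = 0"
      using AS_prod_local[OF smul.hyps gg] by blast
    have N': "\<forall>m\<ge>N. AS_prod m (u f) (u g) = 0"
      using N by (simp add: conf_lin_0[OF assms(1)] flip: smul.IH)
    show ?case
      unfolding u(3)[OF smul.hyps] AS_prod_smul_left[OF smul.hyps gg N]
        AS_prod_smul_left[OF u(1)[OF smul.hyps] u(1)[OF gg] N']
      by (subst usum) (simp_all add: u(3) smul.IH kj mult_ac)
  qed (simp_all add: 1 u gg AS_prod_add_left)
  then show ?thesis
    using assms(1) by (simp add: conf_hom_def)
qed

lemma AS_prod_at_0: "AS_prod n (at_pt 0 a) (at_pt 0 b) = at_pt 0 (N2_prod n a b)"
proof -
  obtain N where N: "\<forall>m\<ge>N. N2_prod m a b = 0"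
    using N2_prod_local by blast
  then have N1: "\<forall>m\<ge>Suc N. N2_prod m a b = 0"
    by simp
  show ?thesis
    unfolding AS_prod_at_pt pt_prod_eq[OF N1] by (subst sum.lessThan_Suc_shift) simp
qed

lemma N2_prod_gmon_0: "N2_prod n (gmon x c 0) (gmon y d 0) = N2_scale (c * d) (gp n x y)"
  by (simp add: N2_prod_gmon basic_prod_00)

lemma AS_prod_Gen: "AS_prod n (Gen x) (Gen y) = at_pt 0 (gp n x y)"
  by (simp add: Gen_def AS_prod_at_0 N2_prod_gmon_0)

lemma AS_prod_gmon_0:
  "AS_prod n (at_pt p (gmon x c 0)) (at_pt q (gmon y d 0)) =
    at_pt (p + q) (N2_scale (c * d) (gp n x y)) + at_pt (p + q - 1) (N2_scale (of_rat p * c * d) (gp (Suc n) x y))"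
proof -
  have N: "\<forall>m\<ge>2. N2_prod m (gmon x c 0) (gmon y d 0) = 0"
    by (simp add: N2_prod_gmon_0 gp_ge2)
  show ?thesis
    unfolding AS_prod_at_pt pt_prod_eq[OF N] by (simp add: numeral_2_eq_2 N2_prod_gmon_0 mult.assoc)
qed

text \<open>For \<open>\<kappa>\<close> = \<open>chi\<close> this is sigma (x) Gamma, for constant 1
  it is sigma (x) 1.\<close>

definition twist :: "(rat \<Rightarrow> 'k::comm_ring_1) \<Rightarrow> ('k N2 \<Rightarrow> 'k N2) \<Rightarrow> (rat \<Rightarrow> 'k N2) \<Rightarrow> rat \<Rightarrow> 'k N2" where
  "twist \<kappa> \<sigma> f = (\<lambda>q. N2_scale (\<kappa> q) (\<sigma> (f q)))"

lemma twist_at_pt: "\<sigma> 0 = 0 \<Longrightarrow> twist \<kappa> \<sigma> (at_pt q a) = at_pt q (N2_scale (\<kappa> q) (\<sigma> a))"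
  by (auto simp: twist_def at_pt_def)

lemma conf_lin_twist:
  fixes \<sigma> :: "'k::field_char_0 N2 \<Rightarrow> 'k N2"
  assumes add: "\<And>a b. \<sigma> (a + b) = \<sigma> a + \<sigma> b" and sc: "\<And>c a. \<sigma> (N2_scale c a) = N2_scale c (\<sigma> a)"
    and der: "\<And>a. \<sigma> (N2_der a) = N2_der (\<sigma> a)"
    and \<kappa>: "\<And>p q. \<kappa> (p + q) = \<kappa> p * \<kappa> q" "\<And>q. \<kappa> (q - 1) = \<kappa> q"
  shows "conf_lin \<kappa> (twist \<kappa> \<sigma>)"
proof -
  have z: "\<sigma> 0 = 0"
    using sc[of 0 0] by simp
  have A: "twist \<kappa> \<sigma> (f + g) = twist \<kappa> \<sigma> f + twist \<kappa> \<sigma> g" for f g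
    by (auto simp: twist_def fun_ops add N2_scale_add)
  have [simp]: "twist \<kappa> \<sigma> 0 = 0"
    by (auto simp: twist_def fun_ops z)
  have F: "fs (twist \<kappa> \<sigma> f)" if "fs f" for f
    by (rule finite_subset[OF _ that]) (auto simp: supp_def twist_def z)
  have S: "twist \<kappa> \<sigma> (AS_smul (Poly_Mapping.single q c) f) = AS_smul (Poly_Mapping.single q (\<kappa> q * c)) (twist \<kappa> \<sigma> f)"
    if "fs f" for q c f
    using that
    by (induction rule: fs_induct)
      (simp_all add: AS_smul_add A F AS_smul_single twist_at_pt z sc \<kappa> mult_ac)
  have D: "twist \<kappa> \<sigma> (AS_der f) = AS_der (twist \<kappa> \<sigma> f)" if "fs f" for f
    using that
    by (induction rule: fs_induct)
      (simp_all add: AS_der_add A F AS_der_at_pt twist_at_pt z sc der \<kappa>(2) N2_der_scale mult.commute)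
  show ?thesis
    using A F S D by (simp add: conf_lin_def)
qed

lemma conf_hom_twist:
  fixes \<sigma> :: "'k::field_char_0 N2 \<Rightarrow> 'k N2"
  assumes add: "\<And>a b. \<sigma> (a + b) = \<sigma> a + \<sigma> b" and sc: "\<And>c a. \<sigma> (N2_scale c a) = N2_scale c (\<sigma> a)"
    and der: "\<And>a. \<sigma> (N2_der a) = N2_der (\<sigma> a)"
    and prod: "\<And>n x y. \<sigma> (gp n x y) = N2_prod n (\<sigma> (gmon x 1 0)) (\<sigma> (gmon y 1 0))"
    and \<kappa>: "\<And>p q. \<kappa> (p + q) = \<kappa> p * \<kappa> q" "\<And>q. \<kappa> (q - 1) = \<kappa> q" "\<kappa> 0 = 1"
  shows "conf_hom \<kappa> (twist \<kappa> \<sigma>)"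
proof (rule conf_homI)
  have z: "\<sigma> 0 = 0"
    using sc[of 0 0] by simp
  show "conf_lin \<kappa> (twist \<kappa> \<sigma>)"
    using assms by (intro conf_lin_twist) auto
  show "\<kappa> (q - of_nat j) = \<kappa> q" for q j
  proof (induction j)
    case (Suc j)
    have "\<kappa> (q - of_nat (Suc j)) = \<kappa> (q - of_nat j - 1)"
      by (simp add: algebra_simps)
    with Suc show ?case
      by (simp only: \<kappa>(2))
  qed simp
  show "twist \<kappa> \<sigma> (AS_prod n (Gen x) (Gen y)) = AS_prod n (twist \<kappa> \<sigma> (Gen x)) (twist \<kappa> \<sigma> (Gen y))" for n x y
    unfolding AS_prod_Gen
    unfolding Gen_def twist_at_pt[of \<sigma>, OF z] \<kappa>(3) N2_scale_1 AS_prod_at_0 prod ..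
qed (fact \<kappa>(3))

section \<open>The involution omega\<close>

lemma omega_gmon:
  "omega (gmon gL c i) = gmon gL c i" "omega (gmon gJ c i) = gmon gJ (- c) i"
  "omega (gmon gGp c i) = gmon gGm c i" "omega (gmon gGm c i) = gmon gGp c i"
  by (auto simp: fun_eq_iff omega_def gmon_apply minus_monom split: gen.split)

lemma omega_add: "omega (a + b) = omega a + omega b"
  by (auto simp: fun_eq_iff omega_def fun_ops split: gen.split)
lemma omega_scale: "omega (N2_scale c a) = N2_scale c (omega a)"
  by (auto simp: fun_eq_iff omega_def N2_scale_def split: gen.split)
lemma omega_der: "omega (N2_der a) = N2_der (omega a)"
  by (auto simp: fun_eq_iff omega_def N2_der_def N2_derpow_def split: gen.split)
lemma omega_omega [simp]: "omega (omega a) = a"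
  by (auto simp: fun_eq_iff omega_def split: gen.split)
lemma omega_zero [simp]: "omega 0 = 0"
  by (auto simp: fun_eq_iff omega_def fun_ops split: gen.split)

text \<open>Omega is a signed permutation of the generators. With permutation and sign separated,
  \<open>basic_prod\<close> is seen to be equivariant term by term.\<close>

fun omega_gen :: "gen \<Rightarrow> gen" where
  "omega_gen gL = gL" | "omega_gen gJ = gJ" | "omega_gen gGp = gGm" | "omega_gen gGm = gGp"

fun omega_sign :: "gen \<Rightarrow> 'k::comm_ring_1" where
  "omega_sign gL = 1" | "omega_sign gJ = - 1" | "omega_sign gGp = 1" | "omega_sign gGm = 1"

lemma omega_gmon_gen: "omega (gmon x c i) = gmon (omega_gen x) (omega_sign x * c) i"
  by (cases x) (simp_all add: omega_gmon)

lemma omega_gp_gen: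
  "omega (gp n x y) = N2_scale (omega_sign x * omega_sign y) (gp n (omega_gen x) (omega_gen y))"
proof -
  consider "n = 0" | "n = Suc 0" | "n \<ge> 2"
    by linarith
  then show ?thesis
  proof cases
    case 1
    show ?thesis
      unfolding 1 by (cases x; cases y) (simp_all add: omega_gmon gp_0 gp0_table omega_add N2_scale_gmon N2_scale_add)
  next
    case 2
    show ?thesis
      unfolding 2 by (cases x; cases y) (simp_all add: omega_gmon gp_1 gp1_table N2_scale_gmon)
  next
    case 3
    then show ?thesis
      by (simp add: gp_ge2)
  qed
qed

lemma omega_sum: "omega (\<Sum>i\<in>A. h i) = (\<Sum>i\<in>A. omega (h i))"
  by (induction A rule: infinite_finite_induct) (simp_all add: omega_add)

lemma omega_derpow: "omega (N2_derpow n a) = N2_derpow n (omega a)"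
  by (auto simp: fun_eq_iff omega_def N2_derpow_def split: gen.split)

lemma omega_N2_prod:
  fixes a b :: "'k::field N2"
  shows "omega (N2_prod n a b) = N2_prod n (omega a) (omega b)"
proof (induction a rule: N2_mono_induct)
  case (mono x c i)
  show ?case
  proof (induction b rule: N2_mono_induct)
    case (mono y d j)
    have "omega (basic_prod x i y j n :: 'k N2) = N2_scale (omega_sign x * omega_sign y) (basic_prod (omega_gen x) i (omega_gen y) j n)"
      by (simp add: basic_prod_def omega_scale omega_sum omega_derpow omega_gp_gen N2_scale_sum N2_derpow_scale mult_ac)
    then show ?case
      by (simp add: N2_prod_gmon omega_scale omega_gmon_gen mult_ac)
  qed (simp add: N2_prod_add_right omega_add)
qed (simp add: N2_prod_add_left omega_add)

lemma omega_gp: "omega (gp n x y) = N2_prod n (omega (gmon x 1 0)) (omega (gmon y 1 0))"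
  using omega_N2_prod[of n "gmon x 1 0" "gmon y 1 0"] by (simp add: N2_prod_gmon_0)

lemma conf_hom_twist_omega:
  assumes "\<And>p q. \<kappa> (p + q) = \<kappa> p * \<kappa> q" "\<And>q. \<kappa> (q - 1) = \<kappa> q" "\<kappa> 0 = 1"
  shows "conf_hom \<kappa> (twist \<kappa> omega)"
  by (rule conf_hom_twist) (simp_all add: omega_add omega_scale omega_der omega_gp assms)

section \<open>Spectral flow\<close>

text \<open>The elements t^q \<open>(AS_der ^^ i) (Gen x)\<close> form a k-basis of A (x) S-hat, so
  the images \<open>w x\<close> may be prescribed freely; the extension then sends each basis
  element to the same expression in \<open>w x\<close>.\<close>

definition ext_pt :: "(gen \<Rightarrow> rat \<Rightarrow> 'k::field_char_0 N2) \<Rightarrow> rat \<Rightarrow> 'k N2 \<Rightarrow> rat \<Rightarrow> 'k N2" where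
  "ext_pt w q a = (\<Sum>x\<in>gens. \<Sum>i\<in>supp (coeff (a x)).
     AS_smul (Poly_Mapping.single q (coeff (a x) i)) ((AS_der ^^ i) (w x)))"

definition AS_ext :: "(gen \<Rightarrow> rat \<Rightarrow> 'k::field_char_0 N2) \<Rightarrow> (rat \<Rightarrow> 'k N2) \<Rightarrow> rat \<Rightarrow> 'k N2" where
  "AS_ext w f = (\<Sum>q\<in>supp f. ext_pt w q (f q))"

lemma AS_smul_0_left [simp]: "AS_smul 0 f = 0"
  using AS_smul_add_left[of 0 0 f] by simp

lemma ext_pt_add: "ext_pt w q (a + b) = ext_pt w q a + ext_pt w q b"
proof -
  let ?h = "\<lambda>x i c. AS_smul (Poly_Mapping.single q c) ((AS_der ^^ i) (w x))"
  have "(\<Sum>i\<in>supp (coeff (a x) + coeff (b x)). ?h x i ((coeff (a x) + coeff (b x)) i)) =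
     (\<Sum>i\<in>supp (coeff (a x)). ?h x i (coeff (a x) i)) + (\<Sum>i\<in>supp (coeff (b x)). ?h x i (coeff (b x) i))" for x
    by (rule sum_supp_add) (simp_all add: single_add AS_smul_add_left)
  then show ?thesis
    by (simp only: ext_pt_def coeff_add_fun plus_fun_apply sum.distrib)
qed

lemma ext_pt_0 [simp]: "ext_pt w q 0 = 0"
  using ext_pt_add[of w q 0 0] by simp

lemma ext_pt_gmon: "ext_pt w q (gmon x c i) = AS_smul (Poly_Mapping.single q c) ((AS_der ^^ i) (w x))"
proof -
  let ?h = "\<lambda>x i c. AS_smul (Poly_Mapping.single q c) ((AS_der ^^ i) (w x))"
  have "ext_pt w q (gmon x c i) = (\<Sum>i'\<in>supp (coeff (monom c i)). ?h x i' (coeff (monom c i) i'))"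
    unfolding ext_pt_def gmon_def by (rule sum_gen_el) (simp add: coeff_0_fun)
  also have "\<dots> = ?h x i c"
    unfolding coeff_monom_fun by (rule sum_supp_at_pt) simp
  finally show ?thesis .
qed

lemma AS_ext_add: "fs f \<Longrightarrow> fs g \<Longrightarrow> AS_ext w (f + g) = AS_ext w f + AS_ext w g"
  unfolding AS_ext_def by (rule sum_supp_add) (simp_all add: ext_pt_add)

lemma AS_ext_gmon: "AS_ext w (at_pt q (gmon x c i)) = AS_smul (Poly_Mapping.single q c) ((AS_der ^^ i) (w x))"
  unfolding AS_ext_def by (subst sum_supp_at_pt) (simp_all add: ext_pt_gmon)

lemma fs_AS_der_pow [simp]: "fs f \<Longrightarrow> fs ((AS_der ^^ i) f)"
  by (induction i) auto

lemma conf_lin_AS_ext: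
  assumes w: "\<And>x. fs (w x)"
  shows "conf_lin (\<lambda>_. 1) (AS_ext w)"
proof -
  have F: "fs (AS_ext w f)" if "fs f" for f
    using that by (induction rule: AS_mono_induct) (simp_all add: AS_ext_gmon AS_ext_add w)
  have S: "AS_ext w (AS_smul (Poly_Mapping.single q c) f) = AS_smul (Poly_Mapping.single q c) (AS_ext w f)"
    if "fs f" for q c f
    using that
  proof (induction rule: AS_mono_induct)
    case (gmon p x d i)
    show ?case
      by (simp add: AS_smul_single N2_scale_gmon AS_ext_gmon w AS_smul_mult[symmetric] mult_single)
  qed (simp add: AS_ext_add AS_smul_add F)
  have D: "AS_ext w (AS_der f) = AS_der (AS_ext w f)" if "fs f" for f
    using that
  proof (induction rule: AS_mono_induct)
    case (gmon p x d i)
    show ?case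
      by (simp add: AS_der_at_pt AS_ext_add N2_scale_gmon N2_der_gmon AS_ext_gmon w AS_der_smul_single)
  qed (simp add: AS_ext_add AS_der_add F)
  show ?thesis
    using F S D by (simp add: conf_lin_def AS_ext_add)
qed

lemma AS_ext_Gen: "fs (w x) \<Longrightarrow> AS_ext w (Gen x) = w x"
  by (simp add: Gen_def AS_ext_gmon AS_smul_const)

text \<open>The spectral flow of the unit s = c t^p. The correction p t^{-1} J = (s'/s) J of L is forced by
  the value of the 0-th product of s G+ and s^{-1} G-.\<close>

fun flow_gen :: "'k::field_char_0 \<Rightarrow> rat \<Rightarrow> gen \<Rightarrow> rat \<Rightarrow> 'k N2" where
  "flow_gen c p gL = at_pt 0 (gmon gL 1 0) + at_pt (- 1) (gmon gJ (of_rat p) 0)"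
| "flow_gen c p gJ = at_pt 0 (gmon gJ 1 0)"
| "flow_gen c p gGp = at_pt p (gmon gGp c 0)"
| "flow_gen c p gGm = at_pt (- p) (gmon gGm (inverse c) 0)"

definition flow :: "'k::field_char_0 \<Rightarrow> rat \<Rightarrow> (rat \<Rightarrow> 'k N2) \<Rightarrow> rat \<Rightarrow> 'k N2" where
  "flow c p = AS_ext (flow_gen c p)"

lemma fs_flow_gen [simp]: "fs (flow_gen c p x)"
  by (cases x) auto

lemma flow_Gen: "flow c p (Gen x) = flow_gen c p x"
  by (simp add: flow_def AS_ext_Gen)

lemma conf_lin_flow: "conf_lin (\<lambda>_. 1) (flow c p)"
  by (simp add: flow_def conf_lin_AS_ext)

lemma flow_add: "fs f \<Longrightarrow> fs g \<Longrightarrow> flow c p (f + g) = flow c p f + flow c p g"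
  by (simp add: flow_def AS_ext_add)

lemma flow_gmon: "flow c p (at_pt q (gmon x d i)) = AS_smul (Poly_Mapping.single q d) ((AS_der ^^ i) (flow_gen c p x))"
  by (simp add: flow_def AS_ext_gmon)

text \<open>By \<open>conf_homI\<close> only pairs of generators are checked. The decisive entry is
  L_(0) G+ = d G+: differentiating s G+ produces s' G+ in addition, and this is what the J-term in
  the image of L supplies.\<close>

lemma conf_hom_flow:
  assumes c: "c \<noteq> (0 :: 'k::field_char_0)"
  shows "conf_hom (\<lambda>_. 1) (flow c p)"
proof (rule conf_homI)
  fix n x y
  have two: "2 * at_pt q (gmon z d i) = at_pt q (gmon z (2 * d) i)" for q :: rat and z i and d :: 'k
    by (simp only: mult_2 gmon_add at_pt_add)
  consider "n = 0" | "n = Suc 0" | "n \<ge> 2"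
    by linarith
  then show "flow c p (AS_prod n (Gen x) (Gen y)) = AS_prod n (flow c p (Gen x)) (flow c p (Gen y))"
  proof cases
    case 1
    show ?thesis
      unfolding 1 flow_Gen AS_prod_Gen
      by (cases x; cases y)
        (simp_all add: AS_prod_gmon_0 AS_prod_add_left AS_prod_add_right gp_0 gp_1 gp0_table gp1_table c at_pt_add
        flow_gmon flow_add AS_smul_single AS_smul_add N2_scale_gmon N2_scale_add AS_der_at_pt AS_der_add N2_der_gmon of_rat_minus
        conf_lin_0[OF conf_lin_flow],
        (auto simp: fun_eq_iff fun_ops at_pt_apply gmon_apply add_monom c field_simps)?)
  next
    case 2
    show ?thesis
      unfolding 2 flow_Gen AS_prod_Gen
      by (cases x; cases y)
        (simp_all add: AS_prod_gmon_0 AS_prod_add_left AS_prod_add_right gp_ge2 gp_1 gp1_table c at_pt_add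
        flow_gmon flow_add AS_smul_single AS_smul_add N2_scale_gmon conf_lin_0[OF conf_lin_flow]
        two del: single_numeral, (auto simp: fun_eq_iff fun_ops at_pt_apply gmon_apply add_monom c field_simps)?)
  next
    case 3
    then show ?thesis
      unfolding flow_Gen AS_prod_Gen
      by (cases x; cases y)
        (simp_all add: AS_prod_gmon_0 AS_prod_add_left AS_prod_add_right gp_ge2 conf_lin_0[OF conf_lin_flow])
  qed
qed (simp_all add: conf_lin_flow)

lemma conf_lin_id: "conf_lin (\<lambda>_. 1) (\<lambda>f. f)"
  by (simp add: conf_lin_def)

text \<open>On L the corrections with factors p and -p cancel because every flow fixes J; on G+ and
  G- inverse units are multiplied.\<close>

lemma flow_inverse:
  assumes c: "c \<noteq> (0 :: 'k::field_char_0)" and f: "fs f"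
  shows "flow (inverse c) (- p) (flow c p f) = f"
proof (rule conf_lin_eqI[OF _ conf_lin_id _ f, where u = "\<lambda>f. flow (inverse c) (- p) (flow c p f)"])
  show "conf_lin (\<lambda>_. 1) (\<lambda>f. flow (inverse c) (- p) (flow c p f))"
    using conf_lin_comp[OF conf_lin_flow conf_lin_flow] by simp
  show "flow (inverse c) (- p) (flow c p (Gen x)) = Gen x" for x
    unfolding flow_Gen
    by (cases x) (simp_all add: c flow_gmon flow_add AS_smul_single AS_smul_add N2_scale_gmon Gen_def of_rat_minus gmon_minus at_pt_uminus)
qed

lemma flow_inverse':
  assumes c: "c \<noteq> (0 :: 'k::field_char_0)" and f: "fs f"
  shows "flow c p (flow (inverse c) (- p) f) = f"
  using flow_inverse[of "inverse c" f "- p"] assms by simp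

section \<open>Components, parity, and generation by G+ and G-\<close>

definition vanishes :: "gen \<Rightarrow> (rat \<Rightarrow> 'k::zero N2) \<Rightarrow> bool" where
  "vanishes z f \<longleftrightarrow> (\<forall>q. f q z = 0)"

lemma vanishes_add: "vanishes z f \<Longrightarrow> vanishes z g \<Longrightarrow> vanishes z (f + g)"
  by (simp add: vanishes_def fun_ops)
lemma vanishes_sum: "(\<And>i. i \<in> A \<Longrightarrow> vanishes z (h i)) \<Longrightarrow> vanishes z (\<Sum>i\<in>A. h i)"
  by (simp add: vanishes_def sum_fun_app)
lemma vanishes_smul: "vanishes z f \<Longrightarrow> vanishes z (AS_smul r f)"
  unfolding AS_smul_def by (rule vanishes_sum) (simp add: vanishes_def embedK_apply N2_scale_def)
lemma vanishes_der: "vanishes z f \<Longrightarrow> vanishes z (AS_der f)"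
  unfolding AS_der_def
  by (intro vanishes_sum vanishes_add)
    (simp_all add: vanishes_def embedK_apply N2_scale_def at_pt_apply N2_der_def N2_derpow_def fun_ops)
lemma vanishes_der_pow: "vanishes z f \<Longrightarrow> vanishes z ((AS_der ^^ i) f)"
  by (induction i) (auto intro: vanishes_der)
lemma vanishes_at_pt_gmon: "x \<noteq> z \<Longrightarrow> vanishes z (at_pt q (gmon x c i))"
  by (simp add: vanishes_def at_pt_apply gmon_apply fun_ops)

lemma vanishes_AS_ext:
  assumes "\<And>x. vanishes x f \<or> vanishes z (w x)"
  shows "vanishes z (AS_ext w f)"
  unfolding AS_ext_def ext_pt_def
proof (intro vanishes_sum)
  fix q x i assume "i \<in> supp (coeff (f q x))"
  then have "f q x \<noteq> 0"
    by (auto simp: supp_def)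
  then have "\<not> vanishes x f"
    by (auto simp: vanishes_def)
  then show "vanishes z (AS_smul (Poly_Mapping.single q (coeff (f q x) i)) ((AS_der ^^ i) (w x)))"
    using assms by (intro vanishes_smul vanishes_der_pow) blast
qed

definition AS_even :: "(rat \<Rightarrow> 'k::zero N2) \<Rightarrow> bool" where
  "AS_even f \<longleftrightarrow> vanishes gGp f \<and> vanishes gGm f"
definition AS_odd :: "(rat \<Rightarrow> 'k::zero N2) \<Rightarrow> bool" where
  "AS_odd f \<longleftrightarrow> vanishes gL f \<and> vanishes gJ f"

lemma AS_even_iff: "AS_even f \<longleftrightarrow> (\<forall>q. f q \<in> N2_even)"
  by (auto simp: AS_even_def vanishes_def N2_even_def)
lemma AS_odd_iff: "AS_odd f \<longleftrightarrow> (\<forall>q. f q \<in> N2_odd)"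
  by (auto simp: AS_odd_def vanishes_def N2_odd_def)

lemma flow_even: "AS_even f \<Longrightarrow> AS_even (flow c p f)"
  unfolding flow_def AS_even_def
proof (intro conjI vanishes_AS_ext, goal_cases)
  case (1 x) then show ?case
    by (cases x) (auto intro!: vanishes_add vanishes_at_pt_gmon)
next
  case (2 x) then show ?case
    by (cases x) (auto intro!: vanishes_add vanishes_at_pt_gmon)
qed

lemma flow_odd: "AS_odd f \<Longrightarrow> AS_odd (flow c p f)"
  unfolding flow_def AS_odd_def
proof (intro conjI vanishes_AS_ext, goal_cases)
  case (1 x) then show ?case
    by (cases x) (auto intro!: vanishes_add vanishes_at_pt_gmon)
next
  case (2 x) then show ?case
    by (cases x) (auto intro!: vanishes_add vanishes_at_pt_gmon)
qed

lemma Gen_J_eq: "Gen gJ = AS_prod 1 (Gen gGp) (Gen gGm)"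
  unfolding AS_prod_Gen by (simp add: Gen_def gp_1 gp1_table)

text \<open>The bracket of G+ and G- gives G+_(0) G- = L + (1/2) d J, here solved for L.\<close>

lemma Gen_L_eq: "Gen gL = AS_prod 0 (Gen gGp) (Gen gGm) + AS_scale (- 1/2) (AS_der (Gen gJ))"
  unfolding AS_prod_Gen
  by (simp add: Gen_def gp_0 gp0_table AS_der_at_0 N2_der_gmon AS_scale_at_pt N2_scale_gmon at_pt_add gmon_minus at_pt_uminus)

text \<open>G+ and G- generate J and L through their products, so the two odd images determine a
  semilinear homomorphism.\<close>

lemma conf_hom_eqI:
  assumes "conf_hom \<kappa> u" "conf_hom \<kappa> v" "\<kappa> 0 = 1"
    and p: "u (Gen gGp) = v (Gen gGp)" and m: "u (Gen gGm) = v (Gen gGm)" and f: "fs f"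
  shows "u f = v f"
proof -
  have L: "conf_lin \<kappa> u" "conf_lin \<kappa> v"
    using assms by (auto simp: conf_hom_def)
  have P: "u (AS_prod n (Gen gGp) (Gen gGm)) = v (AS_prod n (Gen gGp) (Gen gGm))" for n
    using assms by (simp add: conf_hom_def)
  have J: "u (Gen gJ) = v (Gen gJ)"
    unfolding Gen_J_eq by (rule P)
  have "u (Gen gL) = v (Gen gL)"
    unfolding Gen_L_eq
    by (simp add: conf_linD[OF L(1)] conf_linD[OF L(2)] conf_lin_scale[OF L(1) assms(3)] conf_lin_scale[OF L(2) assms(3)] J P)
  with J p m have "u (Gen x) = v (Gen x)" for x
    by (cases x) auto
  then show ?thesis
    using conf_lin_eqI L f by metis
qed

section \<open>Odd elements with vanishing self-products\<close>

text \<open>At the last index where the product can be nonzero, every derivative is spent on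
  lowering the index; a factorial and the sign of the left derivatives are left in front of
  \<open>gp1\<close>.\<close>

lemma basic_prod_top1:
  "basic_prod x i y j (Suc (i + j)) = N2_scale ((- 1) ^ i * fact (Suc (i + j))) (gp1 x y :: 'k::field_char_0 N2)"
proof (induction i)
  case 0
  show ?case
  proof (induction j)
    case 0
    show ?case
      by (simp add: basic_prod_00 gp_1)
  next
    case (Suc j)
    then show ?case
      by (simp add: basic_prod_Suc_right basic_prod_large del: of_nat_Suc)
  qed
next
  case (Suc i)
  then show ?case
    by (simp add: basic_prod_Suc_left N2_scale_minus_left[symmetric] mult_ac del: of_nat_Suc)
qed

text \<open>Terms with an unspent derivative are multiples of d; taking the constant coefficient
  discards them.\<close>

lemma basic_prod_top0:
  "coeff (basic_prod x i y j (i + j) z) 0 = (- 1) ^ i * fact (i + j) * coeff (gp0 x y z :: 'k::field_char_0 poly) 0"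
proof (induction i)
  case 0
  show ?case
  proof (induction j)
    case 0
    show ?case
      by (simp add: basic_prod_00 gp_0)
  next
    case (Suc j)
    then show ?case
      by (simp add: basic_prod_Suc_right fun_ops N2_scale_def N2_der_def N2_derpow_def coeff_monom_mult del: of_nat_Suc)
  qed
next
  case (Suc i)
  then show ?case
    by (simp add: basic_prod_Suc_left fun_ops N2_scale_def mult_ac del: of_nat_Suc)
qed

section \<open>Leading terms of elements with a single component\<close>

definition pure :: "gen \<Rightarrow> (rat \<Rightarrow> 'k::zero N2) \<Rightarrow> bool" where
  "pure x f \<longleftrightarrow> (\<forall>z. z \<noteq> x \<longrightarrow> vanishes z f)"

definition mons :: "gen \<Rightarrow> (rat \<Rightarrow> 'k::zero N2) \<Rightarrow> (rat \<times> nat) set" where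
  "mons x f = (SIGMA p:supp f. supp (coeff (f p x)))"

definition cf :: "gen \<Rightarrow> (rat \<Rightarrow> 'k::zero N2) \<Rightarrow> rat \<times> nat \<Rightarrow> 'k" where
  "cf x f = (\<lambda>(p, i). coeff (f p x) i)"

lemma finite_mons: "fs f \<Longrightarrow> finite (mons x f)"
  by (simp add: mons_def)

lemma mons_iff: "m \<in> mons x f \<longleftrightarrow> cf x f m \<noteq> 0"
  by (auto simp: mons_def cf_def supp_def fun_ops split: prod.splits)

lemma pure_decomp:
  fixes f :: "rat \<Rightarrow> 'k::comm_ring_1 N2"
  assumes f: "fs f" and p: "pure x f"
  shows "f = (\<Sum>m\<in>mons x f. at_pt (fst m) (gmon x (cf x f m) (snd m)))"
proof -
  have dec: "f q = (\<Sum>i\<in>supp (coeff (f q x)). gmon x (coeff (f q x) i) i)" for q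
  proof -
    have "(\<Sum>i\<in>supp (coeff (f q x)). gmon x (coeff (f q x) i) i) = gen_el x (\<Sum>i\<le>degree (f q x). monom (coeff (f q x) i) i)"
      by (subst sum_degree[where h = "\<lambda>i c. monom c i"]) (simp_all add: gmon_def gen_el_sum)
    also have "\<dots> = gen_el x (f q x)"
      by (simp add: poly_as_sum_of_monoms)
    also have "\<dots> = f q"
      using p by (auto simp: fun_eq_iff gen_el_apply pure_def vanishes_def)
    finally show ?thesis ..
  qed
  have "at_pt q (f q) = (\<Sum>i\<in>supp (coeff (f q x)). at_pt q (gmon x (coeff (f q x) i) i))" for q
    using arg_cong[OF dec[of q], of "at_pt q"] by (simp only: at_pt_sum)
  then have "f = (\<Sum>q\<in>supp f. \<Sum>i\<in>supp (coeff (f q x)). at_pt q (gmon x (coeff (f q x) i) i))"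
    using fs_decomp[OF f] by simp
  also have "\<dots> = (\<Sum>(q, i)\<in>mons x f. at_pt q (gmon x (coeff (f q x) i) i))"
    unfolding mons_def using f by (intro sum.Sigma) auto
  finally show ?thesis
    by (simp add: cf_def case_prod_unfold)
qed

text \<open>The power of d is compared first because it governs the largest index with a nonzero
  product; terms with derivatives of coefficients have a smaller exponent of t, so the second
  comparison excludes them.\<close>

definition is_top :: "gen \<Rightarrow> (rat \<Rightarrow> 'k::zero N2) \<Rightarrow> rat \<Rightarrow> nat \<Rightarrow> bool" where
  "is_top x f P I \<longleftrightarrow> (P, I) \<in> mons x f \<and> (\<forall>(p, i)\<in>mons x f. i < I \<or> i = I \<and> p \<le> P)"

lemma ex_top:
  fixes f :: "rat \<Rightarrow> 'k::zero N2"
  assumes "fs f" "\<not> vanishes x f"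
  shows "\<exists>P I. is_top x f P I"
proof -
  obtain q where "f q x \<noteq> 0"
    using assms(2) by (auto simp: vanishes_def)
  then obtain i where "coeff (f q x) i \<noteq> 0"
    by (auto simp: poly_eq_iff)
  then have ne: "(q, i) \<in> mons x f"
    by (simp add: mons_iff cf_def)
  let ?S = "mons x f"
  define I where "I = Max (snd ` ?S)"
  have fin: "finite (snd ` ?S)" "finite (fst ` (?S \<inter> {m. snd m = I}))"
    using finite_mons[OF assms(1)] by auto
  have "I \<in> snd ` ?S"
    unfolding I_def using fin ne by (intro Max_in) auto
  then have ne2: "fst ` (?S \<inter> {m. snd m = I}) \<noteq> {}"
    by auto
  define P where "P = Max (fst ` (?S \<inter> {m. snd m = I}))"
  have "P \<in> fst ` (?S \<inter> {m. snd m = I})"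
    unfolding P_def using fin ne2 by (intro Max_in)
  then have "(P, I) \<in> ?S"
    by auto
  moreover have "j < I \<or> j = I \<and> p \<le> P" if "(p, j) \<in> ?S" for p j
  proof -
    have "j \<le> I"
      unfolding I_def using fin(1) that by (intro Max_ge) force+
    moreover have "p \<le> P" if "j = I"
      unfolding P_def using fin(2) \<open>(p, j) \<in> ?S\<close> that by (intro Max_ge) force+
    ultimately show ?thesis
      by linarith
  qed
  ultimately show ?thesis
    unfolding is_top_def by blast
qed

lemma AS_prod_sum_left:
  "finite A \<Longrightarrow> (\<And>i. i \<in> A \<Longrightarrow> fs (h i)) \<Longrightarrow> AS_prod n (\<Sum>i\<in>A. h i) g = (\<Sum>i\<in>A. AS_prod n (h i) g)"
proof (induction A rule: finite_induct)
  case (insert x F)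
  have "AS_prod n (h x + sum h F) g = AS_prod n (h x) g + AS_prod n (sum h F) g"
    by (rule AS_prod_add_left) (simp_all add: fs_sum insert.prems)
  with insert show ?case
    by simp
qed simp

lemma AS_prod_sum_right:
  "finite A \<Longrightarrow> (\<And>i. i \<in> A \<Longrightarrow> fs (h i)) \<Longrightarrow> AS_prod n g (\<Sum>i\<in>A. h i) = (\<Sum>i\<in>A. AS_prod n g (h i))"
proof (induction A rule: finite_induct)
  case (insert x F)
  have "AS_prod n g (h x + sum h F) = AS_prod n g (h x) + AS_prod n g (sum h F)"
    by (rule AS_prod_add_right) (simp_all add: fs_sum insert.prems)
  with insert show ?case
    by simp
qed simp

lemma AS_prod_pure:
  assumes f: "fs f" "pure x f" and g: "fs g" "pure y g"
  shows "AS_prod n f g = (\<Sum>m\<in>mons x f. \<Sum>m'\<in>mons y g.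
     AS_prod n (at_pt (fst m) (gmon x (cf x f m) (snd m))) (at_pt (fst m') (gmon y (cf y g m') (snd m'))))"
proof -
  let ?F = "\<lambda>m. at_pt (fst m) (gmon x (cf x f m) (snd m))"
  let ?G = "\<lambda>m. at_pt (fst m) (gmon y (cf y g m) (snd m))"
  have "AS_prod n f g = AS_prod n (\<Sum>m\<in>mons x f. ?F m) (\<Sum>m\<in>mons y g. ?G m)"
    using pure_decomp[OF f] pure_decomp[OF g] by simp
  also have "\<dots> = (\<Sum>m\<in>mons x f. AS_prod n (?F m) (\<Sum>m\<in>mons y g. ?G m))"
    by (rule AS_prod_sum_left) (simp_all add: finite_mons f)
  also have "\<dots> = (\<Sum>m\<in>mons x f. \<Sum>m'\<in>mons y g. AS_prod n (?F m) (?G m'))"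
    by (intro sum.cong refl AS_prod_sum_right) (simp_all add: finite_mons g)
  finally show ?thesis .
qed

lemma AS_prod_gmon:
  fixes c d :: "'k::field_char_0"
  shows "AS_prod n (at_pt p (gmon x c i)) (at_pt q (gmon y d j)) =
    (\<Sum>l<Suc (Suc (i + j)). at_pt (p + q - of_nat l) (N2_scale ((of_rat p gchoose l) * (c * d)) (basic_prod x i y j (n + l))))"
proof -
  have N: "\<forall>m\<ge>Suc (Suc (i + j)). N2_prod m (gmon x c i) (gmon y d j) = 0"
    by (simp add: N2_prod_gmon basic_prod_large)
  show ?thesis
    unfolding AS_prod_at_pt pt_prod_eq[OF N] N2_prod_gmon N2_scale_scale ..
qed

text \<open>Leading terms with respect to the lexicographic order on (power of the derivation, power of t):
  no lower pair of monomials and no term with a derivative of a coefficient reaches them.\<close>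

lemma top_product:
  fixes f g :: "rat \<Rightarrow> 'k::field_char_0 N2"
  assumes f: "fs f" "pure x f" "is_top x f P I" and g: "fs g" "pure y g" "is_top y g Q J"
    and van: "\<And>i j m. i \<le> I \<Longrightarrow> j \<le> J \<Longrightarrow> n \<le> m \<Longrightarrow> (i, j, m) \<noteq> (I, J, n) \<Longrightarrow> coeff (basic_prod x i y j m z :: 'k poly) 0 = 0"
  shows "coeff (AS_prod n f g (P + Q) z) 0 = cf x f (P, I) * cf y g (Q, J) * coeff (basic_prod x I y J n z) 0"
proof -
  let ?K = "coeff (basic_prod x I y J n z :: 'k poly) 0"
  have m: "coeff (AS_prod n (at_pt p (gmon x c i)) (at_pt q (gmon y d j)) (P + Q) z) 0 =
      (if (p, i) = (P, I) then if (q, j) = (Q, J) then c * d * ?K else 0 else 0)"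
    if A: "i < I \<or> i = I \<and> p \<le> P" and B: "j < J \<or> j = J \<and> q \<le> Q" for p q i j c d
  proof -
    have "coeff (AS_prod n (at_pt p (gmon x c i)) (at_pt q (gmon y d j)) (P + Q) z) 0 =
       (\<Sum>l<Suc (Suc (i + j)). if P + Q = p + q - of_nat l
         then (of_rat p gchoose l) * (c * d) * coeff (basic_prod x i y j (n + l) z) 0 else 0)"
      unfolding AS_prod_gmon sum_fun_app coeff_sum
      by (rule sum.cong) (simp_all add: at_pt_apply N2_scale_def fun_ops)
    also have "\<dots> = (\<Sum>l<Suc (Suc (i + j)). if l = 0 then
        if (p, i) = (P, I) then if (q, j) = (Q, J) then c * d * ?K else 0 else 0 else 0)"
    proof (rule sum.cong, goal_cases)
      case (2 l)
      show ?case
      proof (cases "(i, j, n + l) = (I, J, n)")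
        case True
        then have "p \<le> P" "q \<le> Q" "l = 0"
          using A B by auto
        with True show ?thesis
          by auto
      next
        case False
        then have "coeff (basic_prod x i y j (n + l) z :: 'k poly) 0 = 0"
          using A B by (intro van) auto
        with False show ?thesis
          by auto
      qed
    qed simp
    also have "\<dots> = (if (p, i) = (P, I) then if (q, j) = (Q, J) then c * d * ?K else 0 else 0)"
      by (simp only: sum.delta finite_lessThan lessThan_iff zero_less_Suc if_True)
    finally show ?thesis .
  qed
  have "coeff (AS_prod n f g (P + Q) z) 0 = (\<Sum>m\<in>mons x f. \<Sum>m'\<in>mons y g.
     coeff (AS_prod n (at_pt (fst m) (gmon x (cf x f m) (snd m))) (at_pt (fst m') (gmon y (cf y g m') (snd m'))) (P + Q) z) 0)"
    unfolding AS_prod_pure[OF f(1,2) g(1,2)] by (simp only: sum_fun_app coeff_sum)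
  also have "\<dots> = (\<Sum>m\<in>mons x f. \<Sum>m'\<in>mons y g. if m = (P, I) then if m' = (Q, J) then cf x f m * cf y g m' * ?K else 0 else 0)"
  proof (intro sum.cong refl, goal_cases)
    case (1 m m')
    then have "snd m < I \<or> snd m = I \<and> fst m \<le> P" "snd m' < J \<or> snd m' = J \<and> fst m' \<le> Q"
      using f(3) g(3) by (auto simp: is_top_def)
    from m[OF this] show ?case
      by simp
  qed
  also have "\<dots> = (\<Sum>m\<in>mons x f. if m = (P, I) then (\<Sum>m'\<in>mons y g. if m' = (Q, J) then cf x f m * cf y g m' * ?K else 0) else 0)"
    by (rule sum.cong) auto
  also have "\<dots> = cf x f (P, I) * cf y g (Q, J) * ?K"
    using f g by (simp add: finite_mons is_top_def)
  finally show ?thesis .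
qed

text \<open>The index I + J + 1 is beyond the reach of every pair of monomials with fewer
  derivatives.\<close>

lemma top_product_1:
  assumes f: "fs f" "pure x f" "is_top x f P I" and g: "fs g" "pure y g" "is_top y g Q J"
  shows "coeff (AS_prod (Suc (I + J)) f g (P + Q) z) 0 =
    cf x f (P, I) * cf y g (Q, J) * ((- 1) ^ I * fact (Suc (I + J)) * coeff (gp1 x y z) 0)"
proof -
  have "coeff (basic_prod x i y j m z :: 'a poly) 0 = 0"
    if "i \<le> I" "j \<le> J" "Suc (I + J) \<le> m" "(i, j, m) \<noteq> (I, J, Suc (I + J))" for i j m
  proof -
    have "m > Suc (i + j)"
      using that by auto
    then show ?thesis
      by (simp add: basic_prod_large fun_ops)
  qed
  from top_product[OF f g this] show ?thesis
    by (simp add: basic_prod_top1 N2_scale_def del: fact_Suc)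
qed

text \<open>At index I + J a pair with one derivative less still contributes through its first
  product; the assumption on \<open>gp1\<close> removes this in the component
  \<open>z\<close>.\<close>

lemma top_product_0:
  assumes f: "fs f" "pure x f" "is_top x f P I" and g: "fs g" "pure y g" "is_top y g Q J"
    and z: "gp1 x y z = (0 :: 'k::field_char_0 poly)"
  shows "coeff (AS_prod (I + J) f g (P + Q) z) 0 =
    cf x f (P, I) * cf y g (Q, J) * ((- 1) ^ I * fact (I + J) * coeff (gp0 x y z) (0::nat) :: 'k)"
proof -
  have "coeff (basic_prod x i y j m z :: 'k poly) 0 = 0"
    if "i \<le> I" "j \<le> J" "I + J \<le> m" "(i, j, m) \<noteq> (I, J, I + J)" for i j m
  proof (cases "m = Suc (i + j)")
    case True
    then show ?thesis
      using z by (simp add: basic_prod_top1 N2_scale_def)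
  next
    case False
    then have "m > Suc (i + j)"
      using that by auto
    then show ?thesis
      by (simp add: basic_prod_large fun_ops)
  qed
  from top_product[OF f g this] show ?thesis
    by (simp add: basic_prod_top0)
qed

lemma AS_prod_pure_0:
  assumes "fs f" "pure x f" "fs g" "pure y g" and gp: "\<And>n. gp n x y = (0 :: 'k::field_char_0 N2)"
  shows "AS_prod n f g = (0 :: rat \<Rightarrow> 'k N2)"
proof -
  have "basic_prod x i y j n = (0 :: 'k N2)" for i j n
    by (simp add: basic_prod_def gp)
  then show ?thesis
    unfolding AS_prod_pure[OF assms(1-4)] by (intro sum.neutral ballI) (simp add: AS_prod_gmon)
qed

lemma gp_self_0: "gp n gGp gGp = 0" "gp n gGm gGm = 0"
  by (simp_all add: gp_def gp0_table gp1_table)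

definition part :: "gen \<Rightarrow> (rat \<Rightarrow> 'k::zero N2) \<Rightarrow> rat \<Rightarrow> 'k N2" where
  "part x f = (\<lambda>q. gen_el x (f q x))"

lemma pure_part: "pure x (part x f)"
  by (simp add: pure_def part_def vanishes_def gen_el_apply)
lemma fs_part: "fs f \<Longrightarrow> fs (part x f)"
  by (rule finite_subset[of _ "supp f"]) (auto simp: supp_def part_def fun_ops)
lemma vanishes_part: "vanishes x (part x f) \<longleftrightarrow> vanishes x f"
  by (simp add: part_def vanishes_def gen_el_apply)

text \<open>If both G+ and G- occurred, with leading powers I and J of d, mixed products in both
  orders would have to cancel. The component of L at index I + J gives (-1)^I + (-1)^J = 0, as both
  0-th products contain + L. The component of the generator J at index I + J + 1 gives (-1)^I -
  (-1)^J = 0, as the first products are opposite. Together these contradict characteristic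
  0.\<close>

lemma odd_self_commuting:
  fixes f :: "rat \<Rightarrow> 'k::field_char_0 N2"
  assumes f: "fs f" and odd: "AS_odd f" and z: "\<And>n. AS_prod n f f = 0"
  shows "vanishes gGp f \<or> vanishes gGm f"
proof (rule ccontr)
  assume "\<not> ?thesis"
  then have nv: "\<not> vanishes gGp f" "\<not> vanishes gGm f"
    by auto
  let ?g = "part gGp f" and ?h = "part gGm f"
  have fgh: "f = ?g + ?h"
  proof (intro ext)
    fix q z show "f q z = (?g + ?h) q z"
      using odd by (cases z) (auto simp: part_def gen_el_apply fun_ops AS_odd_def vanishes_def)
  qed
  have g: "fs ?g" "pure gGp ?g" and h: "fs ?h" "pure gGm ?h"
    using f by (simp_all add: fs_part pure_part)
  obtain P I where gt: "is_top gGp ?g P I"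
    using ex_top[of ?g gGp] g nv by (auto simp: vanishes_part)
  obtain Q J where ht: "is_top gGm ?h Q J"
    using ex_top[of ?h gGm] h nv by (auto simp: vanishes_part)
  have s: "AS_prod n ?g ?h + AS_prod n ?h ?g = 0" for n
  proof -
    have "AS_prod n ?g ?g = 0" "AS_prod n ?h ?h = 0"
      using g h by (auto intro!: AS_prod_pure_0 simp: gp_self_0)
    moreover have "AS_prod n (?g + ?h) (?g + ?h) = 0"
      using z fgh by simp
    ultimately show ?thesis
      using g h by (simp add: AS_prod_add_left AS_prod_add_right add.commute)
  qed
  define a where "a = cf gGp ?g (P, I)"
  define b where "b = cf gGm ?h (Q, J)"
  have ab: "a \<noteq> 0" "b \<noteq> 0"
    using gt ht by (auto simp: a_def b_def is_top_def mons_iff)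
  have ev: "coeff (AS_prod n ?g ?h (P + Q) z) 0 + coeff (AS_prod n ?h ?g (Q + P) z) 0 = 0" for n z
    using arg_cong[OF s[of n], of "\<lambda>f. coeff (f (P + Q) z) 0"] by (simp add: fun_ops add.commute)
  have "a * b * ((- 1) ^ I * fact (I + J)) + b * a * ((- 1) ^ J * fact (J + I)) = 0"
    using ev[of "I + J" gL]
      top_product_0[OF g gt h ht, of gL] top_product_0[OF h ht g gt, of gL]
    by (simp add: gp0_table gp1_table gmon_apply fun_ops a_def b_def add.commute[of J I])
  then have "(a * b * fact (I + J)) * ((- 1) ^ I + (- 1) ^ J) = 0"
    by (simp add: algebra_simps)
  then have 1: "(- 1) ^ I + (- 1 :: 'k) ^ J = 0"
    using ab by simp
  have "a * b * ((- 1) ^ I * fact (Suc (I + J))) - b * a * ((- 1) ^ J * fact (Suc (J + I))) = 0"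
    using ev[of "Suc (I + J)" gJ]
      top_product_1[OF g gt h ht, of gJ] top_product_1[OF h ht g gt, of gJ]
    by (simp add: gp1_table gmon_apply fun_ops a_def b_def add.commute[of J I] del: fact_Suc)
  then have "(a * b * fact (Suc (I + J))) * ((- 1) ^ I - (- 1) ^ J) = 0"
    by (simp add: algebra_simps del: fact_Suc)
  then have "(- 1) ^ I - (- 1 :: 'k) ^ J = 0"
    using ab by (simp del: fact_Suc)
  with 1 have "2 * (- 1 :: 'k) ^ I = 0"
    by (simp add: algebra_simps)
  then show False
    by simp
qed

section \<open>Images of the odd generators\<close>

lemma lookup_mult_sum:
  "Poly_Mapping.lookup (A * B) k = (\<Sum>p\<in>Poly_Mapping.keys A. \<Sum>q\<in>Poly_Mapping.keys B.
     if p + q = k then Poly_Mapping.lookup A p * Poly_Mapping.lookup B q else 0)"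
  for A B :: "'k::comm_ring_1 puis"
proof -
  have "A * B = (\<Sum>p\<in>Poly_Mapping.keys A. Poly_Mapping.single p (Poly_Mapping.lookup A p)) *
    (\<Sum>q\<in>Poly_Mapping.keys B. Poly_Mapping.single q (Poly_Mapping.lookup B q))"
    by (simp only: single_sum)
  then show ?thesis
    by (simp add: sum_product mult_single lookup_sum lookup_single when_def)
qed

lemma lookup_mult_extremal:
  fixes A B :: "'k::comm_ring_1 puis"
  assumes "P \<in> Poly_Mapping.keys A" "Q \<in> Poly_Mapping.keys B"
    and u: "\<And>p q. p \<in> Poly_Mapping.keys A \<Longrightarrow> q \<in> Poly_Mapping.keys B \<Longrightarrow> p + q = P + Q \<Longrightarrow> p = P \<and> q = Q"
  shows "Poly_Mapping.lookup (A * B) (P + Q) = Poly_Mapping.lookup A P * Poly_Mapping.lookup B Q"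
proof -
  have "Poly_Mapping.lookup (A * B) (P + Q) = (\<Sum>p\<in>Poly_Mapping.keys A. if p = P then
     (\<Sum>q\<in>Poly_Mapping.keys B. if q = Q then Poly_Mapping.lookup A p * Poly_Mapping.lookup B q else 0) else 0)"
    unfolding lookup_mult_sum
  proof (rule sum.cong, goal_cases)
    case (2 p)
    show ?case
    proof (cases "p = P")
      case True
      then show ?thesis
        by simp
    next
      case False
      then have "(if p + q = P + Q then Poly_Mapping.lookup A p * Poly_Mapping.lookup B q else 0) = 0"
        if "q \<in> Poly_Mapping.keys B" for q
        using u[of p q] that 2 by auto
      with False show ?thesis
        by simp
    qed
  qed simp
  with assms(1,2) show ?thesis
    by simp
qed

text \<open>The two largest exponents form the only pair with their sum, so this sum is an exponent
  of 1, that is 0; likewise for the smallest ones. Hence largest and smallest exponent agree in each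
  factor.\<close>

lemma puis_units:
  fixes A B :: "'k::field puis"
  assumes AB: "A * B = 1"
  shows "\<exists>p c. c \<noteq> 0 \<and> A = Poly_Mapping.single p c \<and> B = Poly_Mapping.single (- p) (inverse c)"
proof -
  let ?A = "Poly_Mapping.keys A" and ?B = "Poly_Mapping.keys B"
  have ne: "?A \<noteq> {}" "?B \<noteq> {}"
    using AB by auto
  have one: "P + Q = 0 \<and> Poly_Mapping.lookup A P * Poly_Mapping.lookup B Q = 1"
    if PQ: "P \<in> ?A" "Q \<in> ?B" and u: "\<And>p q. p \<in> ?A \<Longrightarrow> q \<in> ?B \<Longrightarrow> p + q = P + Q \<Longrightarrow> p = P \<and> q = Q" for P Q
  proof -
    have l: "Poly_Mapping.lookup (A * B) (P + Q) = Poly_Mapping.lookup A P * Poly_Mapping.lookup B Q"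
      by (rule lookup_mult_extremal) (use PQ u in auto)
    moreover have "Poly_Mapping.lookup A P * Poly_Mapping.lookup B Q \<noteq> 0"
      using PQ by (simp add: in_keys_iff)
    ultimately show ?thesis
      unfolding AB by (simp add: lookup_one when_def split: if_splits)
  qed
  have M: "Max ?A + Max ?B = 0 \<and> Poly_Mapping.lookup A (Max ?A) * Poly_Mapping.lookup B (Max ?B) = 1"
  proof (rule one)
    fix p q assume pq: "p \<in> ?A" "q \<in> ?B" "p + q = Max ?A + Max ?B"
    show "p = Max ?A \<and> q = Max ?B"
      using Max_ge[OF finite_keys pq(1)] Max_ge[OF finite_keys pq(2)] pq(3) by linarith
  qed (use ne in auto)
  have m: "Min ?A + Min ?B = 0 \<and> Poly_Mapping.lookup A (Min ?A) * Poly_Mapping.lookup B (Min ?B) = 1"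
  proof (rule one)
    fix p q assume pq: "p \<in> ?A" "q \<in> ?B" "p + q = Min ?A + Min ?B"
    show "p = Min ?A \<and> q = Min ?B"
      using Min_le[OF finite_keys pq(1)] Min_le[OF finite_keys pq(2)] pq(3) by linarith
  qed (use ne in auto)
  have "Min ?A \<le> Max ?A" "Min ?B \<le> Max ?B"
    using ne by auto
  with M m have eq: "Min ?A = Max ?A" "Min ?B = Max ?B"
    by linarith+
  have kA: "p = Max ?A" if "p \<in> ?A" for p
    using eq(1) Max_ge[OF finite_keys that] Min_le[OF finite_keys that] by linarith
  have kB: "p = Max ?B" if "p \<in> ?B" for p
    using eq(2) Max_ge[OF finite_keys that] Min_le[OF finite_keys that] by linarith
  let ?P = "Max ?A" and ?c = "Poly_Mapping.lookup A (Max ?A)"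
  have "A = Poly_Mapping.single ?P ?c"
    by (rule poly_mapping_eqI) (use kA in \<open>auto simp: lookup_single when_def in_keys_iff\<close>)
  moreover have "B = Poly_Mapping.single (- ?P) (inverse ?c)"
  proof (rule poly_mapping_eqI)
    have "- ?P = Max ?B" "inverse ?c = Poly_Mapping.lookup B (Max ?B)"
      using M by (auto simp: inverse_unique add_eq_0_iff)
    then show "Poly_Mapping.lookup B k = Poly_Mapping.lookup (Poly_Mapping.single (- ?P) (inverse ?c)) k" for k
      using kB by (auto simp: lookup_single when_def in_keys_iff)
  qed
  moreover have "?c \<noteq> 0"
    using M by auto
  ultimately show ?thesis
    by blast
qed

lemma AS_smul_sum_left: "AS_smul (\<Sum>i\<in>A. r i) f = (\<Sum>i\<in>A. AS_smul (r i) f)"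
  by (induction A rule: infinite_finite_induct) (simp_all add: AS_smul_add_left)

lemma AS_smul_Gen: "AS_smul (Poly_Mapping.single p c) (Gen x) = at_pt p (gmon x c 0)"
  by (simp add: Gen_def AS_smul_single N2_scale_gmon)

lemma AS_smul_Gen_inj: "AS_smul A (Gen x) = AS_smul B (Gen x) \<Longrightarrow> A = B"
  for A B :: "'k::comm_ring_1 puis"
proof -
  have e: "AS_smul A (Gen x) q x = monom (Poly_Mapping.lookup A q) 0" for A :: "'k puis" and q
    by (simp add: Gen_def AS_smul_at_pt embedK_apply tpow_def N2_scale_gmon gmon_apply)
  assume "AS_smul A (Gen x) = AS_smul B (Gen x)"
  then show "A = B"
    by (intro poly_mapping_eqI) (metis e monom_eq_iff)
qed

text \<open>Since the next product of the generators vanishes, no derivative of \<open>A\<close>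
  enters and the coefficients just multiply.\<close>

lemma AS_prod_smul_Gen:
  fixes A B :: "'k::field_char_0 puis"
  assumes "gp n x y = (gmon z 1 0 :: 'k N2)" "gp (Suc n) x y = (0 :: 'k N2)"
  shows "AS_prod n (AS_smul A (Gen x)) (AS_smul B (Gen y)) = AS_smul (A * B) (Gen z)"
proof (induction A rule: puis_induct)
  case (single p c)
  show ?case
    by (induction B rule: puis_induct)
      (simp_all add: AS_smul_Gen AS_prod_gmon_0 assms N2_scale_gmon mult_single
        distrib_left AS_smul_add_left AS_prod_add_right)
qed (simp add: AS_smul_add_left AS_prod_add_left distrib_right)

lemma pure_0_eq_smul:
  fixes f :: "rat \<Rightarrow> 'k::field_char_0 N2"
  assumes f: "fs f" "pure x f" and t: "is_top x f P 0"
  shows "\<exists>A. f = AS_smul A (Gen x)"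
proof -
  have "snd m = 0" if "m \<in> mons x f" for m
    using t that by (auto simp: is_top_def)
  then have "f = (\<Sum>m\<in>mons x f. AS_smul (Poly_Mapping.single (fst m) (cf x f m)) (Gen x))"
    using pure_decomp[OF f] by (simp add: AS_smul_Gen)
  then show ?thesis
    by (metis AS_smul_sum_left)
qed

lemma pure_vanishes_0: "pure x f \<Longrightarrow> vanishes x f \<Longrightarrow> f = 0"
  by (auto simp: pure_def vanishes_def fun_eq_iff fun_ops)

text \<open>Vanishing of X_(n) Y for n >= 2 bounds the leading index I + J + 1 by 1, so no powers of
  d occur and X = A G+, Y = B G-. The relation (X_(1) Y)_(0) X = X, inherited from J_(0) G+ = G+,
  then reads A B A = A, so A is a unit with inverse B.\<close>

lemma pure_pair:
  fixes X Y :: "rat \<Rightarrow> 'k::field_char_0 N2"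
  assumes X: "fs X" "pure gGp X" "X \<noteq> 0" and Y: "fs Y" "pure gGm Y"
    and XY: "\<And>n. n \<ge> 2 \<Longrightarrow> AS_prod n X Y = 0" and XYX: "AS_prod 0 (AS_prod 1 X Y) X = X"
  shows "\<exists>p c. c \<noteq> 0 \<and> X = at_pt p (gmon gGp c 0) \<and> Y = at_pt (- p) (gmon gGm (inverse c) 0)"
proof -
  have "Y \<noteq> 0"
    using X XYX by auto
  obtain P I where tX: "is_top gGp X P I"
    using ex_top X pure_vanishes_0 by metis
  obtain Q J where tY: "is_top gGm Y Q J"
    using ex_top Y \<open>Y \<noteq> 0\<close> pure_vanishes_0 by metis
  have "cf gGp X (P, I) \<noteq> 0" "cf gGm Y (Q, J) \<noteq> 0"
    using tX tY by (auto simp: is_top_def mons_iff)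
  then have "coeff (AS_prod (Suc (I + J)) X Y (P + Q) gJ) 0 \<noteq> 0"
    unfolding top_product_1[OF X(1,2) tX Y(1,2) tY] by (simp add: gp1_table gmon_apply del: fact_Suc)
  then have "\<not> Suc (I + J) \<ge> 2"
    using XY by (auto simp: fun_ops)
  then have IJ: "I = 0" "J = 0"
    by auto
  obtain A where A: "X = AS_smul A (Gen gGp)"
    using pure_0_eq_smul X tX IJ by blast
  obtain B where B: "Y = AS_smul B (Gen gGm)"
    using pure_0_eq_smul Y tY IJ by blast
  have "AS_prod 1 X Y = AS_smul (A * B) (Gen gJ)"
    unfolding A B by (rule AS_prod_smul_Gen) (simp_all add: gp_1 gp1_table gp_ge2)
  moreover have "AS_prod 0 (AS_smul (A * B) (Gen gJ)) (AS_smul A (Gen gGp)) = AS_smul (A * B * A) (Gen gGp)"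
    by (rule AS_prod_smul_Gen) (simp_all add: gp_0 gp_1 gp0_table gp1_table)
  ultimately have "AS_smul (A * B * A) (Gen gGp) = AS_smul A (Gen gGp)"
    using XYX A by simp
  then have "A * B * A = A"
    by (rule AS_smul_Gen_inj)
  moreover have "A \<noteq> 0"
    using A X by auto
  ultimately have "A * B = 1"
    by simp
  then obtain p c where "c \<noteq> 0" "A = Poly_Mapping.single p c" "B = Poly_Mapping.single (- p) (inverse c)"
    using puis_units by blast
  then show ?thesis
    using A B by (auto simp: AS_smul_Gen)
qed

lemma odd_pure:
  assumes "AS_odd f"
  shows "vanishes gGm f \<Longrightarrow> pure gGp f" "vanishes gGp f \<Longrightarrow> pure gGm f"
  using assms by (auto simp: pure_def AS_odd_def) (metis gen.exhaust)+

lemma twist_omega_involution: "twist (\<lambda>_. 1) omega (twist (\<lambda>_. 1) omega f) = f"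
  by (simp add: twist_def)

text \<open>Each image involves one odd generator. It cannot be the same for both, since then X_(1)
  Y = 0, against (X_(1) Y)_(0) X = X with X nonzero. The exchanged case is carried to the other one
  by omega (x) 1.\<close>

lemma conf_hom_image_classification:
  fixes T :: "(rat \<Rightarrow> 'k::field_char_0 N2) \<Rightarrow> rat \<Rightarrow> 'k N2"
  assumes T: "conf_hom \<kappa> T" and odd: "AS_odd (T (Gen gGp))" "AS_odd (T (Gen gGm))" and nz: "T (Gen gGp) \<noteq> 0"
  shows "\<exists>p c. c \<noteq> 0 \<and>
     (T (Gen gGp) = at_pt p (gmon gGp c 0) \<and> T (Gen gGm) = at_pt (- p) (gmon gGm (inverse c) 0) \<or>
      T (Gen gGp) = at_pt p (gmon gGm c 0) \<and> T (Gen gGm) = at_pt (- p) (gmon gGp (inverse c) 0))"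
proof -
  let ?X = "T (Gen gGp)" and ?Y = "T (Gen gGm)"
  have P: "AS_prod n (T f) (T g) = T (AS_prod n f g)" if "fs f" "fs g" for n f g
    using T that by (simp add: conf_hom_def)
  have L: "conf_lin \<kappa> T"
    using T by (simp add: conf_hom_def)
  note [simp] = conf_lin_0[OF L]
  have fs: "fs ?X" "fs ?Y"
    by (simp_all add: conf_linD(1)[OF L])
  have XX: "AS_prod n ?X ?X = 0" "AS_prod n ?Y ?Y = 0" for n
    by (simp_all add: P AS_prod_Gen gp_self_0)
  have XY: "AS_prod n ?X ?Y = 0" if "n \<ge> 2" for n
    using that by (simp add: P AS_prod_Gen gp_ge2)
  have XYX: "AS_prod 0 (AS_prod 1 ?X ?Y) ?X = ?X"
  proof -
    have "AS_prod 0 (AS_prod 1 ?X ?Y) ?X = T (AS_prod 0 (Gen gJ) (Gen gGp))"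
      by (simp only: P fs_Gen fs_AS_prod Gen_J_eq)
    also have "AS_prod 0 (Gen gJ) (Gen gGp) = (Gen gGp :: rat \<Rightarrow> 'k N2)"
      unfolding AS_prod_Gen by (simp add: gp_0 gp0_table Gen_def)
    finally show ?thesis .
  qed
  have "vanishes gGp ?X \<or> vanishes gGm ?X" "vanishes gGp ?Y \<or> vanishes gGm ?Y"
    using odd_self_commuting fs odd XX by blast+
  moreover have False if "pure gGp ?X" "pure gGp ?Y"
  proof -
    have "AS_prod 1 ?X ?Y = 0"
      by (rule AS_prod_pure_0) (use fs that in \<open>auto simp: gp_self_0\<close>)
    with XYX nz show False
      by simp
  qed
  moreover have False if "pure gGm ?X" "pure gGm ?Y"
  proof -
    have "AS_prod 1 ?X ?Y = 0"
      by (rule AS_prod_pure_0) (use fs that in \<open>auto simp: gp_self_0\<close>)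
    with XYX nz show False
      by simp
  qed
  ultimately consider "pure gGp ?X" "pure gGm ?Y" | "pure gGm ?X" "pure gGp ?Y"
    using odd_pure[OF odd(1)] odd_pure[OF odd(2)] by blast
  then show ?thesis
  proof cases
    case 1
    then show ?thesis
      using pure_pair[of ?X ?Y] fs nz XY XYX by blast
  next
    case 2
    let ?w = "twist (\<lambda>_. 1) omega :: (rat \<Rightarrow> 'k N2) \<Rightarrow> rat \<Rightarrow> 'k N2"
    have w: "conf_hom (\<lambda>_. 1) ?w"
      by (simp add: conf_hom_twist_omega)
    then have wP: "AS_prod n (?w f) (?w g) = ?w (AS_prod n f g)" if "fs f" "fs g" for n f g
      using that by (simp add: conf_hom_def)
    have wL: "conf_lin (\<lambda>_. 1) ?w"
      using w by (simp add: conf_hom_def)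
    have wi: "?w f = g \<Longrightarrow> f = ?w g" for f g
      using twist_omega_involution by metis
    have pw: "pure gGp (?w f)" if "pure gGm f" for f
      using that by (auto simp: pure_def vanishes_def twist_def omega_def split: gen.split)
    have pw': "pure gGm (?w f)" if "pure gGp f" for f
      using that by (auto simp: pure_def vanishes_def twist_def omega_def split: gen.split)
    have "\<exists>p c. c \<noteq> 0 \<and> ?w ?X = at_pt p (gmon gGp c 0) \<and> ?w ?Y = at_pt (- p) (gmon gGm (inverse c) 0)"
    proof (rule pure_pair)
      show "?w ?X \<noteq> 0"
        using nz wi[of ?X 0] conf_lin_0[OF wL] by auto
      show "AS_prod n (?w ?X) (?w ?Y) = 0" if "2 \<le> n" for n
        using that by (simp add: wP fs XY conf_lin_0[OF wL])
      show "AS_prod 0 (AS_prod 1 (?w ?X) (?w ?Y)) (?w ?X) = ?w ?X"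
        using XYX by (simp add: wP fs)
    qed (use 2 fs pw pw' conf_linD(1)[OF wL] in auto)
    then obtain p c where c: "c \<noteq> 0" and e: "?w ?X = at_pt p (gmon gGp c 0)" "?w ?Y = at_pt (- p) (gmon gGm (inverse c) 0)"
      by blast
    have "?X = at_pt p (gmon gGm c 0)" "?Y = at_pt (- p) (gmon gGp (inverse c) 0)"
      using wi[OF e(1)] wi[OF e(2)] by (simp_all add: twist_at_pt omega_gmon)
    with c show ?thesis
      by blast
  qed
qed

section \<open>Normal forms of semilinear automorphisms\<close>

locale compatible_roots =
  fixes xi :: "nat \<Rightarrow> 'k::field_char_0"
  assumes xi_prim: "\<forall>m>0. xi m ^ m = 1 \<and> (\<forall>j. 0 < j \<and> j < m \<longrightarrow> xi m ^ j \<noteq> 1)"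
    and xi_compat: "\<forall>m>0. \<forall>l>0. xi (m * l) ^ l = xi m"
begin

lemma xi_nz: "m > 0 \<Longrightarrow> xi m \<noteq> 0"
  using xi_prim by (metis power_0_left zero_neq_one not_gr_zero)

lemma xi_1: "xi 1 = 1"
  using xi_prim by (metis less_one power_one_right)

definition chi :: "rat \<Rightarrow> 'k" where
  "chi q = xi (nat (snd (quotient_of q))) powi fst (quotient_of q)"

text \<open>Compatibility of the roots makes the value independent of the chosen fraction: i/m and
  the reduced fraction a/n are both compared at the denominator m n.\<close>

lemma chi_frac:
  assumes m: "m > 0"
  shows "chi (of_int i / of_nat m) = xi m powi i"
proof -
  let ?q = "of_int i / of_nat m :: rat"
  obtain a b where ab: "quotient_of ?q = (a, b)"
    by (cases "quotient_of ?q")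
  then have b: "b > 0" and q: "?q = of_int a / of_int b"
    using quotient_of_denom_pos quotient_of_div by auto
  have "rat_of_int (i * b) = of_int (a * int m)"
    using q b m by (simp add: field_simps)
  then have ib: "i * b = a * int m"
    by linarith
  define n where "n = nat b"
  have n: "n > 0" "b = int n"
    using b by (simp_all add: n_def)
  have "xi m powi i = (xi (m * n) ^ n) powi i"
    using xi_compat m n by simp
  also have "\<dots> = xi (m * n) powi (int n * i)"
    by (simp add: power_int_mult)
  also have "int n * i = int m * a"
    using ib n by (simp add: mult.commute)
  also have "xi (m * n) powi (int m * a) = (xi (n * m) ^ m) powi a"
    unfolding power_int_mult by (simp add: mult.commute[of m n])
  also have "\<dots> = xi n powi a"
    using xi_compat m n by simp
  finally show ?thesis
    using ab by (simp add: chi_def n_def)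
qed

lemma ex_frac: "\<exists>i m. m > 0 \<and> q = of_int i / of_nat m" for q :: rat
proof -
  obtain a b where ab: "quotient_of q = (a, b)"
    by (cases "quotient_of q")
  then have "b > 0" "q = of_int a / of_int b"
    using quotient_of_denom_pos quotient_of_div by auto
  then show ?thesis
    by (intro exI[of _ a] exI[of _ "nat b"]) auto
qed

lemma chi_add: "chi (p + q) = chi p * chi q"
proof -
  obtain a b c d where p: "b > 0" "p = of_int a / of_nat b" and q: "d > 0" "q = of_int c / of_nat d"
    using ex_frac by metis
  have p': "p = of_int (a * int d) / of_nat (b * d)" and q': "q = of_int (c * int b) / of_nat (b * d)"
    using p q by (simp_all add: field_simps)
  have s: "p + q = of_int (a * int d + c * int b) / of_nat (b * d)"
    unfolding p' q' by (simp add: add_divide_distrib)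
  have bd: "b * d > 0"
    using p q by simp
  show ?thesis
    unfolding s chi_frac[OF bd] unfolding p' q' chi_frac[OF bd] by (rule power_int_add) (use xi_nz[OF bd] in simp)
qed

lemma chi_of_int: "chi (of_int k) = 1"
  using chi_frac[of 1 k] xi_1 by simp

lemma chi_0 [simp]: "chi 0 = 1"
  using chi_of_int[of 0] by simp

lemma chi_nz: "chi q \<noteq> 0"
  using chi_add[of q "- q"] by auto

lemma chi_minus: "chi (- q) = inverse (chi q)"
  using chi_add[of q "- q"] by (simp add: inverse_unique)

lemma chi_diff_1: "chi (q - 1) = chi q"
  using chi_add[of q "of_int (- 1)"] chi_of_int[of "- 1"] by simp

lemma chi_diff_nat: "chi (q - of_nat j) = chi q"
  using chi_add[of q "of_int (- int j)"] chi_of_int[of "- int j"] by simp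

text \<open>Modulo the integers the numerator may be taken as j < m, and primitivity of
  \<open>xi m\<close> forces j = 0. This kernel is what identifies the fixed points of
  Gamma.\<close>

lemma chi_eq_1_iff: "chi q = 1 \<longleftrightarrow> q \<in> \<int>"
proof
  assume 1: "chi q = 1"
  obtain a m where m: "m > 0" and q: "q = of_int a / of_nat m"
    using ex_frac by blast
  define j where "j = nat (a mod int m)"
  have j: "int j = a mod int m" "j < m"
    using m by (simp_all add: j_def nat_less_iff)
  have "a = int m * (a div int m) + int j"
    using j by simp
  then have "rat_of_int a = of_nat m * of_int (a div int m) + of_int (int j)"
    by (metis of_int_add of_int_mult of_int_of_nat_eq)
  then have qj: "q = of_int (a div int m) + of_int (int j) / of_nat m"
    using m by (simp add: q add_divide_distrib)
  then have "chi q = chi (of_int (int j) / of_nat m)"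
    by (simp add: chi_add chi_of_int)
  then have "xi m ^ j = 1"
    using 1 chi_frac[OF m, of "int j"] by simp
  then have "j = 0"
    using xi_prim m j(2) by (metis not_gr_zero)
  with qj show "q \<in> \<int>"
    by simp
next
  assume "q \<in> \<int>"
  then show "chi q = 1"
    by (auto elim!: Ints_cases simp: chi_of_int)
qed

lemma chi_power: "chi (of_nat n * q) = chi q ^ n"
  by (induction n) (simp_all add: chi_add distrib_right)

text \<open>The powers of \<open>xi n\<close> below n are n distinct zeros of x^n - 1, hence all of
  them.\<close>

lemma root_of_unity_chi:
  assumes n: "n > 0" and c: "c ^ n = 1"
  shows "\<exists>r. c = chi r"
proof -
  let ?Z = "{x :: 'k. x ^ n = 1}"
  have Z: "?Z = {x. poly (monom 1 n - 1) x = 0}"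
    by (auto simp: poly_monom)
  have ne: "monom (1 :: 'k) n - 1 \<noteq> 0"
  proof
    assume "monom (1 :: 'k) n - 1 = 0"
    then have "coeff (monom (1 :: 'k) n - 1) n = 0"
      by simp
    with n show False
      by (simp add: coeff_1)
  qed
  have fin: "finite ?Z"
    unfolding Z by (rule poly_roots_finite[OF ne])
  have "card ?Z \<le> degree (monom (1 :: 'k) n - 1)"
    unfolding Z by (rule card_poly_roots_bound[OF ne])
  also have "\<dots> \<le> n"
    by (intro degree_diff_le degree_monom_le) simp
  finally have card: "card ?Z \<le> n" .
  have inj: "inj_on (\<lambda>j. xi n ^ j) {..<n}"
  proof (rule linorder_inj_onI)
    fix i j assume ij: "i < j" "i \<in> {..<n}" "j \<in> {..<n}"
    show "xi n ^ i \<noteq> xi n ^ j"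
    proof
      assume "xi n ^ i = xi n ^ j"
      also have "\<dots> = xi n ^ i * xi n ^ (j - i)"
        using ij by (simp flip: power_add)
      finally have "xi n ^ (j - i) = 1"
        using xi_nz[OF n] by simp
      with xi_prim ij n show False
        by auto
    qed
  qed auto
  have sub: "(\<lambda>j. xi n ^ j) ` {..<n} \<subseteq> ?Z"
  proof -
    have "(xi n ^ j) ^ n = (xi n ^ n) ^ j" for j
      by (simp add: mult.commute flip: power_mult)
    then show ?thesis
      using xi_prim n by auto
  qed
  have "(\<lambda>j. xi n ^ j) ` {..<n} = ?Z"
    by (rule card_seteq[OF fin sub]) (use card card_image[OF inj] in simp)
  then obtain j where "c = xi n ^ j"
    using c by auto
  then have "c = chi (of_int (int j) / of_nat n)"
    using chi_frac[OF n, of "int j"] by simp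
  then show ?thesis ..
qed

section \<open>Straightening semilinear automorphisms by spectral flow\<close>

lemma conf_hom_twist_chi_id: "conf_hom chi (twist chi (\<lambda>a. a))"
  by (rule conf_hom_twist) (simp_all add: N2_prod_gmon_0 chi_add chi_diff_1)

lemma conf_hom_twist_chi_omega: "conf_hom chi (twist chi omega)"
  by (rule conf_hom_twist_omega) (simp_all add: chi_add chi_diff_1)

text \<open>Both sides are chi-semilinear homomorphisms, so agreement on G+ and G- is
  enough.\<close>

lemma flow_intertwines:
  assumes T: "conf_hom chi T" and U: "conf_hom chi U" and c: "c \<noteq> 0"
    and e: "flow c p (T (Gen gGp)) = U (flow c p (Gen gGp))" "flow c p (T (Gen gGm)) = U (flow c p (Gen gGm))"
    and f: "fs f"
  shows "flow c p (T f) = U (flow c p f)"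
proof (rule conf_hom_eqI[of chi "\<lambda>f. flow c p (T f)" "\<lambda>f. U (flow c p f)"])
  show "conf_hom chi (\<lambda>f. flow c p (T f))"
    using conf_hom_comp[OF conf_hom_flow[OF c] T] by simp
  show "conf_hom chi (\<lambda>f. U (flow c p f))"
    using conf_hom_comp[OF U conf_hom_flow[OF c]] by simp
qed (use e f in simp_all)

lemma semilinear_normal_form:
  assumes alg_closed: "\<forall>p :: 'k poly. degree p > 0 \<longrightarrow> (\<exists>x. poly p x = 0)"
    and T: "conf_hom chi T" and odd: "AS_odd (T (Gen gGp))" "AS_odd (T (Gen gGm))" and nz: "T (Gen gGp) \<noteq> 0"
    and n: "n > 0" "(T ^^ n) (Gen gGp) = Gen gGp"
  shows "\<exists>c p. c \<noteq> 0 \<and> ((\<forall>f. fs f \<longrightarrow> flow c p (T f) = twist chi (\<lambda>a. a) (flow c p f))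
      \<or> (\<forall>f. fs f \<longrightarrow> flow c p (T f) = twist chi omega (flow c p f)))"
proof -
  have L: "conf_lin chi T"
    using T by (simp add: conf_hom_def)
  obtain p c where c: "c \<noteq> 0" and cases:
    "T (Gen gGp) = at_pt p (gmon gGp c 0) \<and> T (Gen gGm) = at_pt (- p) (gmon gGm (inverse c) 0) \<or>
     T (Gen gGp) = at_pt p (gmon gGm c 0) \<and> T (Gen gGm) = at_pt (- p) (gmon gGp (inverse c) 0)"
    using conf_hom_image_classification[OF T odd nz] by blast
  from cases show ?thesis
  proof (elim disjE conjE)
    assume e: "T (Gen gGp) = at_pt p (gmon gGp c 0)" "T (Gen gGm) = at_pt (- p) (gmon gGm (inverse c) 0)"
    have step: "T (at_pt q (gmon gGp d 0)) = at_pt (q + p) (gmon gGp (chi q * d * c) 0)" for q d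
      using conf_linD(3)[OF L fs_Gen[of gGp], of q d] e by (simp add: AS_smul_Gen AS_smul_single N2_scale_gmon)
    \<comment> \<open>At first only the exponent is followed: each application of T adds p, so T^n
      G+ = G+ forces n p = 0.\<close>
    have "\<exists>d :: 'k. (T ^^ k) (Gen gGp) = at_pt (of_nat k * p) (gmon gGp d 0)" for k
      by (induction k) (auto simp: Gen_def step algebra_simps)
    from this[of n] obtain d :: 'k where "at_pt 0 (gmon gGp 1 0) = at_pt (of_nat n * p) (gmon gGp d 0)"
      unfolding n(2) unfolding Gen_def by blast
    then have "at_pt 0 (gmon gGp (1::'k) 0) (0::rat) = at_pt (of_nat n * p) (gmon gGp d 0) 0"
      by (rule fun_cong)
    then have p: "p = 0"
      using n by (simp add: at_pt_apply split: if_splits)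
    \<comment> \<open>With p = 0 the exponent stays 0, where \<open>chi\<close> is 1, so each
      application just multiplies by c.\<close>
    have "(T ^^ k) (Gen gGp) = at_pt 0 (gmon gGp (c ^ k) 0)" for k
      by (induction k) (auto simp: Gen_def step p mult.commute)
    from this[of n] have "at_pt 0 (gmon gGp 1 0) (0::rat) = at_pt 0 (gmon gGp (c ^ n) 0) (0::rat)"
      unfolding n(2) unfolding Gen_def by (rule fun_cong)
    then have "gmon gGp (1::'k) 0 gGp = gmon gGp (c ^ n) 0 gGp"
      by (simp add: at_pt_apply)
    then have "monom (1::'k) 0 = monom (c ^ n) 0"
      unfolding gmon_apply by (simp only: if_True refl)
    then have "c ^ n = 1"
      by (simp only: monom_eq_iff)
    then obtain r where r: "c = chi r"
      using root_of_unity_chi n by blast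
    \<comment> \<open>The unit u = t^r solves Gamma(u) = c u.\<close>
    have "flow 1 r (T f) = twist chi (\<lambda>a. a) (flow 1 r f)" if "fs f" for f
      by (rule flow_intertwines[OF T conf_hom_twist_chi_id])
        (simp_all add: that e p flow_Gen flow_gmon AS_smul_single N2_scale_gmon twist_at_pt r chi_minus)
    then show ?thesis
      by (intro exI[of _ 1] exI[of _ r]) simp
  next
    assume e: "T (Gen gGp) = at_pt p (gmon gGm c 0)" "T (Gen gGm) = at_pt (- p) (gmon gGp (inverse c) 0)"
    \<comment> \<open>With u = d t^(p/2) the equation u Gamma(u) = c t^p becomes d^2 chi(p/2) = c;
      the quadratic polynomial is this condition on d.\<close>
    obtain d where d: "poly [: - (c / chi (p / 2)), 0, 1 :] d = 0"
      using alg_closed[rule_format, of "[: - (c / chi (p / 2)), 0, 1 :]"] by auto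
    then have d2: "c = d * d * chi (p / 2)"
      using chi_nz by (simp add: field_simps add_eq_0_iff)
    then have d0: "d \<noteq> 0"
      using c by auto
    have "flow d (p / 2) (T f) = twist chi omega (flow d (p / 2) f)" if "fs f" for f
      by (rule flow_intertwines[OF T conf_hom_twist_chi_omega])
        (simp_all add: that d0 e flow_Gen flow_gmon AS_smul_single N2_scale_gmon twist_at_pt omega_gmon chi_minus d2 chi_nz field_simps)
    then show ?thesis
      using d0 by blast
  qed
qed

end

section \<open>Loop algebras as fixed points\<close>

text \<open>Only the carrier and its parity parts shrink; the operations, including multiplication
  by all of S-hat, remain those of A (x) S-hat. Linearity can therefore be stated over
  \<open>UNIV\<close> and restricted to R or k by \<open>csa_iso_subset\<close>.\<close>

definition fix_csa :: "((rat \<Rightarrow> 'k::field_char_0 N2) \<Rightarrow> rat \<Rightarrow> 'k N2) \<Rightarrow> ('k, rat \<Rightarrow> 'k N2) csa" where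
  "fix_csa T = \<lparr> cs_carrier = {f. fs f \<and> T f = f}, cs_smul = AS_smul,
     cs_even = {f. fs f \<and> T f = f \<and> AS_even f}, cs_odd = {f. fs f \<and> T f = f \<and> AS_odd f},
     cs_der = AS_der, cs_prod = AS_prod \<rparr>"

lemma fix_csa_simps [simp]:
  "cs_carrier (fix_csa T) = {f. fs f \<and> T f = f}" "cs_smul (fix_csa T) = AS_smul"
  "cs_even (fix_csa T) = {f. fs f \<and> T f = f \<and> AS_even f}" "cs_odd (fix_csa T) = {f. fs f \<and> T f = f \<and> AS_odd f}"
  "cs_der (fix_csa T) = AS_der" "cs_prod (fix_csa T) = AS_prod"
  by (simp_all add: fix_csa_def)

lemma at_pt_eq_0_iff: "at_pt q a = 0 \<longleftrightarrow> a = 0"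
  by (auto simp: fun_eq_iff at_pt_apply fun_ops)

lemma csa_iso_subset: "csa_iso D S T f \<Longrightarrow> D' \<subseteq> D \<Longrightarrow> csa_iso D' S T f"
  unfolding csa_iso_def csa_hom_def by blast

lemma csa_iso_trans:
  assumes "csa_iso D S T f" "csa_iso D T U g"
  shows "csa_iso D S U (g \<circ> f)"
proof -
  have "bij_betw (g \<circ> f) (cs_carrier S) (cs_carrier U)"
    using assms by (auto simp: csa_iso_def intro: bij_betw_trans)
  then show ?thesis
    using assms unfolding csa_iso_def csa_hom_def by simp
qed

lemma conf_lin_smul:
  assumes "conf_lin (\<lambda>_. 1) u" "fs f"
  shows "u (AS_smul r f) = AS_smul r (u f)"
  using assms(2)
  by (induction r rule: puis_induct)
    (simp_all add: conf_linD[OF assms(1)] AS_smul_add_left)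

text \<open>A bijection of the ambient module that intertwines \<open>T\<close> and \<open>U\<close>
  matches their fixed points; the inverse flow is the inverse map.\<close>

lemma flow_fix_iso:
  assumes c: "c \<noteq> 0" and T: "\<And>f. fs f \<Longrightarrow> fs (T f)"
    and e: "\<And>f. fs f \<Longrightarrow> flow c p (T f) = U (flow c p f)"
  shows "csa_iso UNIV (fix_csa T) (fix_csa U) (flow c p)"
proof -
  note h = conf_hom_flow[OF c, of p]
  note l = conf_linD[OF conf_lin_flow[of c p]]
  have C: "fs (flow c p f) \<and> U (flow c p f) = flow c p f" if "fs f" "T f = f" for f
    using that e[of f] l(1)[of f] by simp
  have "bij_betw (flow c p) {f. fs f \<and> T f = f} {f. fs f \<and> U f = f}"
  proof (rule bij_betw_byWitness[where f' = "flow (inverse c) (- p)"])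
    show "flow (inverse c) (- p) ` {f. fs f \<and> U f = f} \<subseteq> {f. fs f \<and> T f = f}"
    proof safe
      fix f assume f: "fs f" "U f = f"
      let ?g = "flow (inverse c) (- p) f"
      show g: "fs ?g"
        by (rule conf_linD(1)[OF conf_lin_flow f(1)])
      have "flow c p (T ?g) = flow c p ?g"
        using e[OF g] f by (simp add: flow_inverse'[OF c])
      then show "T ?g = ?g"
        using flow_inverse[OF c T[OF g], of p] flow_inverse[OF c g, of p] by simp
    qed
  qed (use C flow_inverse[OF c] flow_inverse'[OF c] in auto)
  then show ?thesis
    using C h l conf_lin_smul[OF conf_lin_flow]
    by (auto simp: csa_iso_def csa_hom_def conf_hom_def flow_even flow_odd)
qed

definition N2_hom :: "('k::field_char_0 N2 \<Rightarrow> 'k N2) \<Rightarrow> bool" where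
  "N2_hom \<sigma> \<longleftrightarrow> (\<forall>a b. \<sigma> (a + b) = \<sigma> a + \<sigma> b) \<and> (\<forall>c a. \<sigma> (N2_scale c a) = N2_scale c (\<sigma> a))
    \<and> (\<forall>a. \<sigma> (N2_der a) = N2_der (\<sigma> a)) \<and> (\<forall>n a b. \<sigma> (N2_prod n a b) = N2_prod n (\<sigma> a) (\<sigma> b))
    \<and> (\<forall>a\<in>N2_odd. \<sigma> a \<in> N2_odd)"

lemma N2_hom_pow: "N2_hom \<sigma> \<Longrightarrow> N2_hom (\<sigma> ^^ j)"
  by (induction j) (auto simp: N2_hom_def)

lemma N2_hom_0: "N2_hom \<sigma> \<Longrightarrow> \<sigma> 0 = 0"
  by (metis N2_hom_def N2_scale_0)

lemma kconst_in_k_set: "kconst c \<in> k_set"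
  by (auto simp: kconst_def k_set_def)

lemma csa_iso_N2_hom: "csa_iso k_set N2_csa N2_csa \<sigma> \<Longrightarrow> N2_hom \<sigma>"
proof -
  assume s: "csa_iso k_set N2_csa N2_csa \<sigma>"
  have "\<sigma> (N2_scale c a) = N2_scale c (\<sigma> a)" for c a
  proof -
    have "\<sigma> (N2_scale (Poly_Mapping.lookup (kconst c) 0) a) = N2_scale (Poly_Mapping.lookup (kconst c) 0) (\<sigma> a)"
      using s kconst_in_k_set[of c] by (simp add: csa_iso_def csa_hom_def N2_csa_def)
    then show ?thesis
      by (simp add: kconst_def)
  qed
  then show ?thesis
    using s by (simp add: N2_hom_def csa_iso_def csa_hom_def N2_csa_def)
qed

lemma omega_csa_iso: "csa_iso k_set N2_csa N2_csa (omega :: 'k::field N2 \<Rightarrow> 'k N2)"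
proof -
  have "bij (omega :: 'k N2 \<Rightarrow> 'k N2)"
    by (rule o_bij[of omega]) auto
  then show ?thesis
    by (auto simp: csa_iso_def csa_hom_def N2_csa_def omega_add omega_scale omega_der omega_N2_prod)
      (auto simp: N2_even_def N2_odd_def omega_def)
qed

lemma omega_pow_2: "omega ^^ 2 = id"
  by (auto simp: numeral_2_eq_2)

context compatible_roots
begin

text \<open>Here \<open>\<sigma> ^^ (m - 1)\<close> is the inverse of \<open>\<sigma>\<close>, so
  being fixed at exponent q means \<open>\<sigma>\<close> a = chi(q) a. Conversely this equation
  puts q into (1/m) Z by itself: \<open>\<sigma> ^^ m = id\<close> yields chi(m q) = 1.\<close>

lemma loop_eq_fix:
  assumes m: "m > 0" and \<sigma>: "N2_hom \<sigma>" "\<sigma> ^^ m = id"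
  shows "loop xi m \<sigma> = fix_csa (twist chi (\<sigma> ^^ (m - 1)))"
proof -
  have sc: "\<sigma> (N2_scale c a) = N2_scale c (\<sigma> a)" for c a
    using \<sigma> by (simp add: N2_hom_def)
  have \<sigma>m: "\<sigma> ((\<sigma> ^^ (m - 1)) a) = a" for a
  proof -
    have "\<sigma> ((\<sigma> ^^ (m - 1)) a) = (\<sigma> ^^ Suc (m - 1)) a"
      by simp
    then show ?thesis
      using m \<sigma>(2) by simp
  qed
  have pw: "(\<sigma> ^^ k) a = N2_scale (c ^ k) a" if "\<sigma> a = N2_scale c a" for k c a
    by (induction k) (simp_all add: that sc mult.commute)
  have eq: "(\<exists>i::int. q = of_int i / of_nat m \<and> \<sigma> a = N2_scale (xi m powi i) a) \<longleftrightarrow> N2_scale (chi q) ((\<sigma> ^^ (m - 1)) a) = a"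
    if a: "a \<noteq> 0" for q a
  proof
    assume "\<exists>i::int. q = of_int i / of_nat m \<and> \<sigma> a = N2_scale (xi m powi i) a"
    then obtain i where q: "q = of_int i / of_nat m" and s: "\<sigma> a = N2_scale (chi q) a"
      using chi_frac[OF m] by metis
    have "N2_scale (chi q) ((\<sigma> ^^ (m - 1)) a) = N2_scale (chi q ^ m) a"
      using m by (simp add: pw[OF s] power_eq_if)
    also have "chi q ^ m = 1"
      unfolding chi_power[symmetric] using m by (simp add: q chi_eq_1_iff)
    finally show "N2_scale (chi q) ((\<sigma> ^^ (m - 1)) a) = a"
      by simp
  next
    assume e: "N2_scale (chi q) ((\<sigma> ^^ (m - 1)) a) = a"
    have s: "\<sigma> a = N2_scale (chi q) a"
      using arg_cong[OF e, of \<sigma>] by (simp add: sc \<sigma>m del: One_nat_def)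
    have "N2_scale (chi q ^ m - 1) a = 0"
      using pw[OF s, of m] \<sigma>(2) N2_scale_add_left[of "chi q ^ m" "- 1" a] by (simp add: N2_scale_minus_left)
    then have "chi (of_nat m * q) = 1"
      using a by (simp add: N2_scale_eq_0_iff chi_power)
    then obtain i where "of_nat m * q = of_int i"
      by (auto simp: chi_eq_1_iff elim: Ints_cases)
    then have q: "q = of_int i / of_nat m"
      using m by (simp add: field_simps)
    then show "\<exists>i::int. q = of_int i / of_nat m \<and> \<sigma> a = N2_scale (xi m powi i) a"
      using s chi_frac[OF m] by metis
  qed
  have z: "(\<sigma> ^^ (m - 1)) 0 = 0"
    by (rule N2_hom_0[OF N2_hom_pow[OF \<sigma>(1)]])
  have "(\<forall>q\<in>supp f. \<exists>i::int. q = of_int i / of_nat m \<and> \<sigma> (f q) = N2_scale (xi m powi i) (f q))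
      \<longleftrightarrow> twist chi (\<sigma> ^^ (m - 1)) f = f" for f
  proof -
    have "(\<forall>q\<in>supp f. \<exists>i::int. q = of_int i / of_nat m \<and> \<sigma> (f q) = N2_scale (xi m powi i) (f q))
      \<longleftrightarrow> (\<forall>q\<in>supp f. twist chi (\<sigma> ^^ (m - 1)) f q = f q)"
      using eq by (auto simp: supp_def twist_def)
    also have "\<dots> \<longleftrightarrow> (\<forall>q. twist chi (\<sigma> ^^ (m - 1)) f q = f q)"
    proof -
      have "twist chi (\<sigma> ^^ (m - 1)) f q = f q" if "f q = 0" for q
        unfolding twist_def that z by simp
      then show ?thesis
        unfolding supp_def by blast
    qed
    finally show ?thesis
      by (simp add: fun_eq_iff)
  qed
  then show ?thesis
    by (simp add: loop_def fix_csa_def AS_even_iff AS_odd_iff Let_def Collect_conj_eq[symmetric] conj_assoc)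
qed

lemma loop_id_eq: "loop xi 1 id = fix_csa (twist chi (\<lambda>a. a))"
  using loop_eq_fix[of 1 id] by (simp add: N2_hom_def id_def comp_def)

lemma N2_hom_omega: "N2_hom omega"
  by (rule csa_iso_N2_hom[OF omega_csa_iso])

lemma loop_omega_eq: "loop xi 2 omega = fix_csa (twist chi omega)"
  using loop_eq_fix[of 2 omega] by (simp add: N2_hom_omega omega_pow_2)

lemma fix_csa_classification:
  assumes alg_closed: "\<forall>p :: 'k poly. degree p > 0 \<longrightarrow> (\<exists>x. poly p x = 0)"
    and T: "conf_hom chi T" and odd: "AS_odd (T (Gen gGp))" "AS_odd (T (Gen gGm))" and nz: "T (Gen gGp) \<noteq> 0"
    and n: "n > 0" "(T ^^ n) (Gen gGp) = Gen gGp"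
  shows "(\<exists>\<phi>. csa_iso UNIV (fix_csa T) (loop xi 1 id) \<phi>) \<or> (\<exists>\<phi>. csa_iso UNIV (fix_csa T) (loop xi 2 omega) \<phi>)"
proof -
  have T': "fs f \<Longrightarrow> fs (T f)" for f
    using T by (auto simp: conf_hom_def conf_lin_def)
  obtain c p where "c \<noteq> 0" "(\<forall>f. fs f \<longrightarrow> flow c p (T f) = twist chi (\<lambda>a. a) (flow c p f))
      \<or> (\<forall>f. fs f \<longrightarrow> flow c p (T f) = twist chi omega (flow c p f))"
    using semilinear_normal_form[OF assms] by blast
  then show ?thesis
    unfolding loop_id_eq loop_omega_eq using flow_fix_iso[of c T p] T' by blast
qed

text \<open>The map \<open>?T\<close> is sigma^(-1) (x) Gamma. On A (x) 1 the factor chi is 1, so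
  there its m-th power is the identity, which supplies the finite order on G+.\<close>

lemma loop_classification:
  assumes alg_closed: "\<forall>p :: 'k poly. degree p > 0 \<longrightarrow> (\<exists>x. poly p x = 0)"
    and m: "m > 0" and s: "csa_iso k_set N2_csa N2_csa \<sigma>" and \<sigma>m: "\<sigma> ^^ m = id"
  shows "(\<exists>\<phi>. csa_iso UNIV (loop xi m \<sigma>) (loop xi 1 id) \<phi>) \<or> (\<exists>\<phi>. csa_iso UNIV (loop xi m \<sigma>) (loop xi 2 omega) \<phi>)"
proof -
  let ?t = "\<sigma> ^^ (m - 1)" and ?T = "twist chi (\<sigma> ^^ (m - 1))"
  note \<sigma> = csa_iso_N2_hom[OF s]
  note t = N2_hom_pow[OF \<sigma>, of "m - 1"]
  note t0 = N2_hom_0[OF t]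
  have T: "conf_hom chi ?T"
  proof (rule conf_hom_twist)
    show "?t (gp n x y) = N2_prod n (?t (gmon x 1 0)) (?t (gmon y 1 0))" for n x y
    proof -
      have "?t (N2_prod n (gmon x 1 0) (gmon y 1 0)) = N2_prod n (?t (gmon x 1 0)) (?t (gmon y 1 0))"
        using t by (simp add: N2_hom_def)
      then show ?thesis
        by (simp add: N2_prod_gmon_0)
    qed
  qed (use t in \<open>simp_all add: N2_hom_def chi_add chi_diff_1\<close>)
  have TG: "?T (at_pt 0 a) = at_pt 0 (?t a)" for a
    by (simp add: twist_at_pt t0 del: One_nat_def)
  have odd: "AS_odd (?T (Gen x))" if "gmon x 1 0 \<in> (N2_odd :: 'k N2 set)" for x
  proof -
    have "?t (gmon x 1 0) \<in> N2_odd" "0 \<in> (N2_odd :: 'k N2 set)"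
      using t that by (auto simp: N2_hom_def N2_odd_def fun_ops)
    then show ?thesis
      unfolding AS_odd_iff Gen_def TG by (simp add: at_pt_apply)
  qed
  have g: "gmon gGp 1 0 \<in> (N2_odd :: 'k N2 set)" "gmon gGm 1 0 \<in> (N2_odd :: 'k N2 set)"
    by (auto simp: N2_odd_def gmon_apply)
  have nz: "?T (Gen gGp) \<noteq> 0"
  proof
    assume "?T (Gen gGp) = 0"
    then have "?t (gmon gGp 1 0) = 0"
      unfolding Gen_def TG by (simp only: at_pt_eq_0_iff)
    then have "\<sigma> (?t (gmon gGp 1 0)) = 0"
      by (simp add: N2_hom_0[OF \<sigma>])
    moreover have "\<sigma> (?t a) = (\<sigma> ^^ Suc (m - 1)) a" for a
      by simp
    ultimately have "(\<sigma> ^^ m) (gmon gGp 1 0) = 0"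
      using m by simp
    then show False
      by (simp add: \<sigma>m)
  qed
  have "(?T ^^ k) (at_pt 0 a) = at_pt 0 ((?t ^^ k) a)" for k a
    by (induction k) (simp_all add: TG del: One_nat_def)
  moreover have "?t ^^ m = id"
  proof -
    have "?t ^^ m = (\<sigma> ^^ m) ^^ (m - 1)"
      by (simp add: funpow_mult mult.commute del: One_nat_def)
    then show ?thesis
      by (simp add: \<sigma>m)
  qed
  ultimately have "(?T ^^ m) (Gen gGp) = Gen gGp"
    by (simp add: Gen_def del: One_nat_def)
  from fix_csa_classification[OF alg_closed T odd[OF g(1)] odd[OF g(2)] nz m this]
  show ?thesis
    unfolding loop_eq_fix[OF m \<sigma> \<sigma>m] .
qed

lemma loops_not_isomorphic: "\<not> csa_iso k_set (loop xi 1 id) (loop xi 2 omega) \<phi>"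
proof
  assume "csa_iso k_set (loop xi 1 id) (loop xi 2 omega) \<phi>"
  then have hom: "csa_hom k_set (fix_csa (twist chi (\<lambda>a. a))) (fix_csa (twist chi omega)) \<phi>"
    and bij: "inj_on \<phi> {f. fs f \<and> twist chi (\<lambda>a. a) f = f}"
    unfolding loop_id_eq loop_omega_eq by (auto simp: csa_iso_def bij_betw_def)
  let ?G = "Gen gGp :: rat \<Rightarrow> 'k N2"
  let ?x = "\<phi> ?G"
  have G: "fs ?G" "twist chi (\<lambda>a. a) ?G = ?G" "AS_odd ?G"
    by (auto simp: Gen_def twist_at_pt AS_odd_def intro: vanishes_at_pt_gmon)
  have z: "twist chi (\<lambda>a. a) 0 = (0 :: rat \<Rightarrow> 'k N2)"
    by (auto simp: twist_def fun_ops)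
  have \<phi>0: "\<phi> 0 = 0"
  proof -
    have "\<phi> (f + g) = \<phi> f + \<phi> g" if "fs f" "twist chi (\<lambda>a. a) f = f" "fs g" "twist chi (\<lambda>a. a) g = g" for f g
      using hom that by (simp add: csa_hom_def)
    from this[of 0 0] z have "\<phi> (0 + 0) = \<phi> 0 + \<phi> 0"
      by simp
    then show ?thesis
      by simp
  qed
  have x: "fs ?x" "twist chi omega ?x = ?x" "AS_odd ?x"
    using hom G by (auto simp: csa_hom_def)
  have "AS_prod n ?x ?x = 0" for n
  proof -
    have "AS_prod n ?x ?x = \<phi> (AS_prod n ?G ?G)"
      using hom G by (simp add: csa_hom_def)
    then show ?thesis
      by (simp add: AS_prod_Gen gp_self_0 \<phi>0)
  qed
  then have v: "vanishes gGp ?x \<or> vanishes gGm ?x"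
    using odd_self_commuting x by blast
  \<comment> \<open>The fixed-point equation of omega (x) Gamma, read in the component of G+, ties
    it to that of G- by the nonzero factor chi(q).\<close>
  have sym: "?x q gGp = smult (chi q) (?x q gGm)" for q
    using fun_cong[OF fun_cong[OF x(2)], of q gGp] by (simp add: twist_def N2_scale_def omega_def)
  have "vanishes gGp ?x \<longleftrightarrow> vanishes gGm ?x"
    unfolding vanishes_def sym by (simp add: chi_nz)
  with v have "vanishes gGp ?x" "vanishes gGm ?x"
    by auto
  then have "?x = 0"
    using x(3) odd_pure pure_vanishes_0 by blast
  then have "?x = \<phi> 0"
    by (simp add: \<phi>0)
  then have "?G = 0"
    using bij G z by (auto simp: inj_on_def)
  then show False
    by (simp add: Gen_def at_pt_eq_0_iff)
qed

end

section \<open>Base change and forms\<close>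

lemma base_change_simps:
  "cs_carrier (base_change S) = {g. fs g \<and> supp g \<subseteq> {0..<1} \<and> (\<forall>q. g q \<in> cs_carrier S)}"
  "cs_smul (base_change S) r g = (\<Sum>q\<in>supp g. embedR S (g q) (r * tpow q))"
  "cs_even (base_change S) = {g \<in> cs_carrier (base_change S). \<forall>q. g q \<in> cs_even S}"
  "cs_odd (base_change S) = {g \<in> cs_carrier (base_change S). \<forall>q. g q \<in> cs_odd S}"
  "cs_der (base_change S) g = (\<Sum>q\<in>supp g. at_pt q (cs_der S (g q)) + embedR S (g q) (puis_deriv (tpow q)))"
  "cs_prod (base_change S) n g h = (\<Sum>p\<in>supp g. \<Sum>q\<in>supp h. \<Sum>j<prod_bound (cs_prod S) (g p) (h q).
      embedR S (cs_prod S (n + j) (g p) (h q)) (kconst (inverse (fact j)) * (puis_deriv ^^ j) (tpow p) * tpow q))"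
  by (simp_all add: base_change_def Let_def)

definition AS_csa :: "('k::field_char_0, rat \<Rightarrow> 'k N2) csa" where
  "AS_csa = fix_csa (\<lambda>f. f)"

lemma AS_csa_simps [simp]:
  "cs_carrier AS_csa = {f. fs f}" "cs_smul AS_csa = AS_smul"
  "cs_even AS_csa = {f. fs f \<and> AS_even f}" "cs_odd AS_csa = {f. fs f \<and> AS_odd f}"
  "cs_der AS_csa = AS_der" "cs_prod AS_csa = AS_prod"
  by (simp_all add: AS_csa_def)

lemma AS_smul_single_apply:
  assumes "fs f"
  shows "AS_smul (Poly_Mapping.single s c) f x = N2_scale c (f (x - s))"
  using assms
proof (induction arbitrary: x rule: fs_induct)
  case (at_pt q a)
  have "x = s + q \<longleftrightarrow> x - s = q"
    by auto
  then show ?case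
    unfolding AS_smul_single by (simp add: at_pt_apply)
qed (simp_all add: AS_smul_add fun_ops N2_scale_add)

text \<open>The element g of the base change stands for the sum of g(q) (x) t^q; here it is multiplied out in
  A (x) S-hat.\<close>

definition mult_out :: "(rat \<Rightarrow> rat \<Rightarrow> 'k::field_char_0 N2) \<Rightarrow> rat \<Rightarrow> 'k N2" where
  "mult_out g = (\<Sum>q\<in>supp g. AS_smul (tpow q) (g q))"

definition fs2 :: "(rat \<Rightarrow> rat \<Rightarrow> 'k::field_char_0 N2) \<Rightarrow> bool" where
  "fs2 g \<longleftrightarrow> fs g \<and> (\<forall>q. fs (g q))"

lemma fs2_add: "fs2 g \<Longrightarrow> fs2 h \<Longrightarrow> fs2 (g + h)"
  by (simp add: fs2_def plus_fun_apply)
lemma fs2_0: "fs2 0"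
  by (simp add: fs2_def zero_fun_apply)
lemma fs2_at_pt: "fs a \<Longrightarrow> fs2 (at_pt q a)"
  by (simp add: fs2_def at_pt_apply)

lemma mult_out_add: "fs2 g \<Longrightarrow> fs2 h \<Longrightarrow> mult_out (g + h) = mult_out g + mult_out h"
  unfolding mult_out_def fs2_def by (rule sum_supp_add_values) (simp_all add: AS_smul_add)

lemma mult_out_0: "mult_out 0 = 0"
  by (simp add: mult_out_def)

lemma mult_out_at_pt: "fs a \<Longrightarrow> mult_out (at_pt q a) = AS_smul (tpow q) a"
  unfolding mult_out_def by (rule sum_supp_at_pt) simp

lemma fs2_sum: "(\<And>i. i \<in> A \<Longrightarrow> fs2 (h i)) \<Longrightarrow> fs2 (\<Sum>i\<in>A. h i)"
  by (induction A rule: infinite_finite_induct) (simp_all add: fs2_0 fs2_add)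

lemma mult_out_sum: "(\<And>i. i \<in> A \<Longrightarrow> fs2 (h i)) \<Longrightarrow> mult_out (\<Sum>i\<in>A. h i) = (\<Sum>i\<in>A. mult_out (h i))"
proof (induction A rule: infinite_finite_induct)
  case (insert x F)
  have "mult_out (h x + sum h F) = mult_out (h x) + mult_out (sum h F)"
    by (rule mult_out_add) (simp_all add: fs2_sum insert.prems)
  with insert show ?case
    by simp
qed (simp_all add: mult_out_0)

lemma fs_mult_out: "fs2 g \<Longrightarrow> fs (mult_out g)"
  unfolding mult_out_def by (rule fs_sum) (simp add: fs2_def)

lemma rat_frac_floor: "frac p + of_int \<lfloor>p\<rfloor> = (p::rat)"
  by (simp add: frac_def)

text \<open>\<open>embedR\<close> splits t^p into its integral power, absorbed by b, and its
  fractional power, the basis index; multiplying out rejoins them.\<close>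

lemma mult_out_embedR:
  assumes S: "cs_smul S = AS_smul" and b: "fs b"
  shows "fs2 (embedR S b r) \<and> mult_out (embedR S b r) = AS_smul r b"
proof -
  let ?h = "\<lambda>p. at_pt (frac p) (AS_smul (Poly_Mapping.single (of_int \<lfloor>p\<rfloor>) (Poly_Mapping.lookup r p)) b)"
  have e: "embedR S b r = (\<Sum>p\<in>Poly_Mapping.keys r. ?h p)"
    by (simp add: embedR_def S)
  have h: "fs2 (?h p)" for p
    by (rule fs2_at_pt) (simp add: b)
  have "mult_out (?h p) = AS_smul (Poly_Mapping.single p (Poly_Mapping.lookup r p)) b" for p
    using b by (simp add: mult_out_at_pt AS_smul_mult[symmetric] tpow_def mult_single rat_frac_floor)
  then have "mult_out (embedR S b r) = AS_smul (\<Sum>p\<in>Poly_Mapping.keys r. Poly_Mapping.single p (Poly_Mapping.lookup r p)) b"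
    unfolding e AS_smul_sum_left using mult_out_sum[of "Poly_Mapping.keys r" ?h] h by simp
  then show ?thesis
    unfolding single_sum e using fs2_sum[of "Poly_Mapping.keys r" ?h] h by simp
qed

lemma AS_der_sum: "(\<And>i. i \<in> A \<Longrightarrow> fs (h i)) \<Longrightarrow> AS_der (\<Sum>i\<in>A. h i) = (\<Sum>i\<in>A. AS_der (h i))"
proof (induction A rule: infinite_finite_induct)
  case (insert x F)
  have "AS_der (h x + sum h F) = AS_der (h x) + AS_der (sum h F)"
    by (rule AS_der_add) (simp_all add: fs_sum insert.prems)
  with insert show ?case
    by simp
qed simp_all

section \<open>The base change of A (x) R is A (x) S-hat\<close>

context compatible_roots
begin

abbreviation L1 :: "('k, rat \<Rightarrow> 'k N2) csa" where
  "L1 \<equiv> fix_csa (twist chi (\<lambda>a. a))"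

lemma L1_carrier: "f \<in> cs_carrier L1 \<longleftrightarrow> fs f \<and> (\<forall>q. q \<notin> \<int> \<longrightarrow> f q = 0)"
proof -
  have "N2_scale (chi q) a = a \<longleftrightarrow> q \<in> \<int> \<or> a = 0" for q a
  proof -
    have "N2_scale (chi q) a = a \<longleftrightarrow> N2_scale (chi q - 1) a = 0"
      using N2_scale_add_left[of "chi q" "- 1" a] by (simp add: N2_scale_minus_left)
    then show ?thesis
      by (simp add: N2_scale_eq_0_iff chi_eq_1_iff)
  qed
  then show ?thesis
    by (auto simp: twist_def fun_eq_iff)
qed

lemma base_L1_fs2: "g \<in> cs_carrier (base_change L1) \<Longrightarrow> fs2 g"
  by (auto simp: base_change_simps fs2_def)

text \<open>Each g(q) is supported on the integers and q lies in [0,1), so only the index q = frac x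
  reaches the exponent x.\<close>

lemma mult_out_apply:
  assumes g: "g \<in> cs_carrier (base_change L1)"
  shows "mult_out g x = g (frac x) (of_int \<lfloor>x\<rfloor>)"
proof -
  note g2 = base_L1_fs2[OF g]
  have "mult_out g x = (\<Sum>q\<in>supp g. g q (x - q))"
    unfolding mult_out_def
    by (subst sum_fun_app, rule sum.cong) (use g2 in \<open>simp_all add: fs2_def tpow_def AS_smul_single_apply\<close>)
  also have "\<dots> = (\<Sum>q\<in>supp g. if q = frac x then g (frac x) (of_int \<lfloor>x\<rfloor>) else 0)"
  proof (rule sum.cong)
    fix q assume q: "q \<in> supp g"
    then have q01: "0 \<le> q" "q < 1"
      using g by (auto simp: base_change_simps)
    show "g q (x - q) = (if q = frac x then g (frac x) (of_int \<lfloor>x\<rfloor>) else 0)"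
    proof (cases "q = frac x")
      case True
      then show ?thesis
        by (simp add: frac_def)
    next
      case False
      have "x - q \<notin> \<int>"
      proof
        assume "x - q \<in> \<int>"
        then have "frac x = q"
          using q01 by (simp add: frac_unique_iff)
        with False show False
          by simp
      qed
      moreover have "g q \<in> cs_carrier L1"
        using g by (simp add: base_change_simps)
      ultimately have "g q (x - q) = 0"
        unfolding L1_carrier by blast
      with False show ?thesis
        by simp
    qed
  qed simp
  also have "\<dots> = g (frac x) (of_int \<lfloor>x\<rfloor>)"
    using g2 by (auto simp: fs2_def supp_def zero_fun_apply)
  finally show ?thesis .
qed

text \<open>Compatibility with products is the pair of sesquilinearity rules for
  \<open>AS_prod\<close>; bijectivity is the unique splitting of an exponent into fractional part
  and floor.\<close>

lemma mult_out_iso: "csa_iso UNIV (base_change L1) AS_csa mult_out"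
proof -
  let ?C = "cs_carrier (base_change L1)"
  have g2: "fs (g q)" "fs g" if "g \<in> ?C" for g q
    using base_L1_fs2[OF that] by (auto simp: fs2_def)
  note mR = mult_out_embedR[of L1, simplified]
  have add: "mult_out (g + h) = mult_out g + mult_out h" if "g \<in> ?C" "h \<in> ?C" for g h
    using that by (intro mult_out_add base_L1_fs2)
  have smul: "mult_out (cs_smul (base_change L1) r g) = AS_smul r (mult_out g)" if "g \<in> ?C" for r g
  proof -
    have "mult_out (cs_smul (base_change L1) r g) = (\<Sum>q\<in>supp g. AS_smul (r * tpow q) (g q))"
      unfolding base_change_simps using g2[OF that] by (simp add: mult_out_sum mR)
    also have "\<dots> = AS_smul r (mult_out g)"
      unfolding mult_out_def using g2[OF that] by (simp add: AS_smul_mult AS_smul_sum)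
    finally show ?thesis .
  qed
  have der: "mult_out (cs_der (base_change L1) g) = AS_der (mult_out g)" if "g \<in> ?C" for g
  proof -
    have h: "fs2 (at_pt q (AS_der (g q)) + embedR L1 (g q) (puis_deriv (tpow q)))" for q
      using g2[OF that] by (intro fs2_add fs2_at_pt) (simp_all add: mR)
    have "mult_out (at_pt q (AS_der (g q)) + embedR L1 (g q) (puis_deriv (tpow q))) = AS_der (AS_smul (tpow q) (g q))" for q
    proof -
      have "mult_out (at_pt q (AS_der (g q)) + embedR L1 (g q) (puis_deriv (tpow q)))
         = AS_smul (tpow q) (AS_der (g q)) + AS_smul (puis_deriv (tpow q)) (g q)"
        using g2[OF that] by (subst mult_out_add) (simp_all add: mR fs2_at_pt mult_out_at_pt)
      then show ?thesis
        using g2[OF that] by (simp add: tpow_def AS_der_smul_single puis_deriv_single)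
    qed
    then have "mult_out (cs_der (base_change L1) g) = (\<Sum>q\<in>supp g. AS_der (AS_smul (tpow q) (g q)))"
      unfolding base_change_simps using h by (simp add: mult_out_sum)
    also have "\<dots> = AS_der (mult_out g)"
      unfolding mult_out_def using g2[OF that] by (simp add: AS_der_sum)
    finally show ?thesis .
  qed
  have prod: "mult_out (cs_prod (base_change L1) n g h) = AS_prod n (mult_out g) (mult_out h)"
    if g: "g \<in> ?C" and h: "h \<in> ?C" for n g h
  proof -
    let ?e = "\<lambda>p q j. embedR L1 (AS_prod (n + j) (g p) (h q)) (kconst (inverse (fact j)) * (puis_deriv ^^ j) (tpow p) * tpow q)"
    let ?N = "\<lambda>p q. prod_bound AS_prod (g p) (h q)"
    have e: "fs2 (?e p q j)" "mult_out (?e p q j) = AS_smul (tpow q) (AS_smul (Poly_Mapping.single (p - of_nat j) ((of_rat p gchoose j) * 1)) (AS_prod (n + j) (g p) (h q)))"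
      for p q j
      by (simp_all add: mR divided_deriv_tpow AS_smul_mult[symmetric] mult.commute)
    have s: "(\<Sum>j<?N p q. mult_out (?e p q j)) = AS_prod n (AS_smul (tpow p) (g p)) (AS_smul (tpow q) (h q))" for p q
    proof -
      have N: "\<forall>m\<ge>?N p q. AS_prod m (g p) (h q) = 0"
        by (intro allI impI prod_bound_local[of AS_prod] AS_prod_local) (simp_all add: g2[OF g] g2[OF h])
      have "AS_prod n (AS_smul (tpow p) (g p)) (AS_smul (tpow q) (h q)) = AS_smul (tpow q) (AS_prod n (AS_smul (tpow p) (g p)) (h q))"
        unfolding tpow_def by (rule AS_prod_smul_right) (simp_all add: g2[OF g] g2[OF h])
      also have "AS_prod n (AS_smul (tpow p) (g p)) (h q) =
         (\<Sum>j<?N p q. AS_smul (Poly_Mapping.single (p - of_nat j) ((of_rat p gchoose j) * 1)) (AS_prod (n + j) (g p) (h q)))"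
        unfolding tpow_def by (rule AS_prod_smul_left[OF g2(1)[OF g] g2(1)[OF h] N])
      finally show ?thesis
        unfolding e by (simp only: AS_smul_sum fs_AS_smul fs_AS_prod)
    qed
    have "cs_prod (base_change L1) n g h = (\<Sum>p\<in>supp g. \<Sum>q\<in>supp h. \<Sum>j<?N p q. ?e p q j)"
      by (simp add: base_change_simps)
    moreover have "fs2 (\<Sum>j<?N p q. ?e p q j)" for p q
      by (rule fs2_sum) (rule e(1))
    moreover have "fs2 (\<Sum>q\<in>supp h. \<Sum>j<?N p q. ?e p q j)" for p
      by (intro fs2_sum) (rule e(1))
    ultimately have "mult_out (cs_prod (base_change L1) n g h) = (\<Sum>p\<in>supp g. \<Sum>q\<in>supp h. \<Sum>j<?N p q. mult_out (?e p q j))"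
      using e(1) by (simp only: mult_out_sum)
    also have "\<dots> = (\<Sum>p\<in>supp g. \<Sum>q\<in>supp h. AS_prod n (AS_smul (tpow p) (g p)) (AS_smul (tpow q) (h q)))"
      by (simp only: s)
    also have "\<dots> = AS_prod n (mult_out g) (mult_out h)"
      unfolding mult_out_def using g2[OF g] g2[OF h]
      by (subst AS_prod_sum_left) (simp_all add: AS_prod_sum_right)
    finally show ?thesis .
  qed
  have par: "vanishes z (mult_out g)" if "\<forall>q. vanishes z (g q)" for z and g :: "rat \<Rightarrow> rat \<Rightarrow> 'k N2"
    unfolding mult_out_def using that by (intro vanishes_sum vanishes_smul) simp
  have "inj_on mult_out ?C"
  proof (rule inj_onI, rule ext, rule ext)
    fix g h q x assume gh: "g \<in> ?C" "h \<in> ?C" "mult_out g = mult_out h"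
    show "g q x = h q x"
    proof (cases "q \<in> {0..<1} \<and> x \<in> \<int>")
      case True
      then obtain k where x: "x = of_int k"
        by (auto elim: Ints_cases)
      have "\<lfloor>q + x\<rfloor> = k" "frac (q + x) = q"
        using True x by (simp_all add: floor_eq_iff frac_unique_iff)
      then show ?thesis
        using mult_out_apply[OF gh(1), of "q + x"] mult_out_apply[OF gh(2), of "q + x"] gh(3) x by simp
    next
      case False
      have "g q x = 0" if "g \<in> ?C" for g
      proof (cases "q \<in> {0..<1}")
        case True
        with False have "x \<notin> \<int>"
          by simp
        moreover have "g q \<in> cs_carrier L1"
          using that by (simp add: base_change_simps)
        ultimately show ?thesis
          unfolding L1_carrier by blast
      next
        case False
        then have "g q = 0"
          using that by (auto simp: base_change_simps supp_def)
        then show ?thesis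
          by (simp add: zero_fun_apply)
      qed
      with gh show ?thesis
        by simp
    qed
  qed
  moreover have "mult_out ` ?C = {f. fs f}"
  proof safe
    fix f :: "rat \<Rightarrow> 'k N2" assume f: "fs f"
    \<comment> \<open>The preimage sorts the terms of f by the fractional part of their
      exponents.\<close>
    define g where "g = (\<lambda>q x. if q \<in> {0..<1} \<and> x \<in> \<int> then f (q + x) else 0)"
    have 1: "g q \<in> cs_carrier L1" for q
    proof -
      have "supp (g q) \<subseteq> (\<lambda>y. y - q) ` supp f"
      proof
        fix x assume "x \<in> supp (g q)"
        then have "q + x \<in> supp f"
          by (auto simp: supp_def g_def split: if_splits)
        then show "x \<in> (\<lambda>y. y - q) ` supp f"
          by (intro image_eqI[of _ _ "q + x"]) simp_all
      qed
      then have "fs (g q)"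
        using f by (meson finite_imageI finite_subset)
      then show ?thesis
        unfolding L1_carrier by (simp add: g_def)
    qed
    have "supp g \<subseteq> frac ` supp f"
    proof
      fix q assume "q \<in> supp g"
      then obtain x where "g q x \<noteq> 0"
        by (auto simp: supp_def fun_eq_iff zero_fun_apply)
      then have x: "q \<in> {0..<1}" "x \<in> \<int>" "q + x \<in> supp f"
        by (auto simp: g_def supp_def split: if_splits)
      then have "frac (q + x) = q"
        by (auto simp: frac_unique_iff)
      with x show "q \<in> frac ` supp f"
        by (intro image_eqI[of _ _ "q + x"]) simp_all
    qed
    then have 2: "fs g"
      using f by (meson finite_imageI finite_subset)
    have "g q = 0" if "q \<notin> {0..<1}" for q
      using that by (auto simp: g_def zero_fun_def)
    then have 3: "supp g \<subseteq> {0..<1}"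
      by (auto simp: supp_def)
    have g: "g \<in> ?C"
      using 1 2 3 by (simp add: base_change_simps)
    have "mult_out g = f"
    proof
      fix x :: rat
      have "frac x \<in> {0..<1}"
        by (simp add: frac_ge_0 frac_lt_1)
      then show "mult_out g x = f x"
        unfolding mult_out_apply[OF g] by (simp add: g_def rat_frac_floor)
    qed
    with g show "f \<in> mult_out ` ?C"
      by blast
  qed (use base_L1_fs2 fs_mult_out in blast)
  ultimately have bij: "bij_betw mult_out ?C {f. fs f}"
    by (simp add: bij_betw_def)
  have car: "fs (mult_out g)" if "g \<in> ?C" for g
    using base_L1_fs2[OF that] by (rule fs_mult_out)
  show ?thesis
    unfolding csa_iso_def csa_hom_def
    using bij add smul der prod car par
    by (auto simp: base_change_simps(3,4) AS_even_def AS_odd_def)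
qed

end

section \<open>Forms and their descent from A (x) S-hat\<close>

lemma common_denominator: "finite A \<Longrightarrow> \<exists>n>0. \<forall>q\<in>A. of_nat n * q \<in> (\<int> :: rat set)"
proof (induction A rule: finite_induct)
  case (insert q A)
  then obtain n where n: "n > 0" "\<forall>q\<in>A. of_nat n * q \<in> (\<int> :: rat set)"
    by blast
  obtain a b where ab: "quotient_of q = (a, b)"
    by (cases "quotient_of q")
  then have b: "b > 0" "q = of_int a / of_int b"
    using quotient_of_denom_pos quotient_of_div by auto
  let ?m = "n * nat b"
  have "of_nat ?m * q = of_nat n * of_int a"
    using b by simp
  then have 1: "of_nat ?m * q \<in> \<int>"
    by (simp only: Ints_mult Ints_of_int Ints_of_nat)
  have 2: "of_nat ?m * q' \<in> \<int>" if "q' \<in> A" for q'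
  proof -
    have "of_nat ?m * q' = of_int b * (of_nat n * q')"
      using b by simp
    moreover have "of_nat n * q' \<in> \<int>"
      using n that by blast
    ultimately show ?thesis
      by (simp only: Ints_mult Ints_of_int)
  qed
  show ?case
    by (intro exI[of _ ?m]) (use n b 1 2 in \<open>auto simp del: of_nat_mult\<close>)
qed auto

text \<open>The trivialisation \<open>\<Theta>\<close> takes values in \<open>AS_csa\<close> instead
  of the base change of the loop algebra, so that F is compared directly with subalgebras of A (x)
  S-hat; composing with \<open>mult_out\<close> provides it.\<close>

locale conformal_form = compatible_roots xi for xi :: "nat \<Rightarrow> 'k::field_char_0" +
  fixes F :: "('k, 'f::ab_group_add) csa" and \<Theta> :: "(rat \<Rightarrow> 'f) \<Rightarrow> rat \<Rightarrow> 'k N2"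
  assumes csa: "is_csa R_set F" and iso: "csa_iso UNIV (base_change F) AS_csa \<Theta>"
begin

abbreviation "M \<equiv> cs_carrier F"
abbreviation "sm \<equiv> cs_smul F"
abbreviation "C \<equiv> cs_carrier (base_change F)"

lemma F_closed: "0 \<in> M" "a \<in> M \<Longrightarrow> b \<in> M \<Longrightarrow> a + b \<in> M" "r \<in> R_set \<Longrightarrow> a \<in> M \<Longrightarrow> sm r a \<in> M"
  "a \<in> M \<Longrightarrow> cs_der F a \<in> M" "a \<in> M \<Longrightarrow> b \<in> M \<Longrightarrow> cs_prod F n a b \<in> M"
  using csa unfolding is_csa_def Let_def by simp_all

lemma F_smul: "r \<in> R_set \<Longrightarrow> a \<in> M \<Longrightarrow> b \<in> M \<Longrightarrow> sm r (a + b) = sm r a + sm r b"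
  "r \<in> R_set \<Longrightarrow> s \<in> R_set \<Longrightarrow> a \<in> M \<Longrightarrow> sm (r + s) a = sm r a + sm s a"
  "r \<in> R_set \<Longrightarrow> s \<in> R_set \<Longrightarrow> a \<in> M \<Longrightarrow> sm (r * s) a = sm r (sm s a)"
  "a \<in> M \<Longrightarrow> sm 1 a = a"
  using csa unfolding is_csa_def Let_def by simp_all

lemma F_additive: "a \<in> M \<Longrightarrow> b \<in> M \<Longrightarrow> cs_der F (a + b) = cs_der F a + cs_der F b"
  "a \<in> M \<Longrightarrow> b \<in> M \<Longrightarrow> c \<in> M \<Longrightarrow> cs_prod F n (a + b) c = cs_prod F n a c + cs_prod F n b c"
  "a \<in> M \<Longrightarrow> b \<in> M \<Longrightarrow> c \<in> M \<Longrightarrow> cs_prod F n a (b + c) = cs_prod F n a b + cs_prod F n a c"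
  using csa unfolding is_csa_def Let_def by simp_all

lemma F_parity: "is_submod R_set F (cs_even F)" "is_submod R_set F (cs_odd F)"
  "a \<in> M \<Longrightarrow> \<exists>x\<in>cs_even F. \<exists>y\<in>cs_odd F. a = x + y"
  using csa unfolding is_csa_def Let_def by simp_all

lemma F_local: "a \<in> M \<Longrightarrow> b \<in> M \<Longrightarrow> \<exists>N. \<forall>n\<ge>N. cs_prod F n a b = 0"
  using csa unfolding is_csa_def Let_def by simp

lemma R_set_single: "q \<in> \<int> \<Longrightarrow> Poly_Mapping.single q c \<in> R_set"
  by (auto simp: R_set_def)
lemma R_set_0: "0 \<in> R_set" and R_set_1: "1 \<in> R_set"
  by (auto simp: R_set_def)
lemma R_set_add: "r \<in> R_set \<Longrightarrow> s \<in> R_set \<Longrightarrow> r + s \<in> R_set"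
  using keys_add[of r s] by (auto simp: R_set_def)

lemma sm_zero: "r \<in> R_set \<Longrightarrow> sm r 0 = 0"
  using F_smul(1)[of r 0 0] F_closed(1) by simp
lemma sm_0: "a \<in> M \<Longrightarrow> sm 0 a = 0"
  using F_smul(2)[of 0 0 a] R_set_0 by simp
lemma der_zero: "cs_der F 0 = 0"
  using F_additive(1)[of 0 0] F_closed(1) by simp
lemma prod_zero: "a \<in> M \<Longrightarrow> cs_prod F n 0 a = 0" "a \<in> M \<Longrightarrow> cs_prod F n a 0 = 0"
  using F_additive(2)[of 0 0 a n] F_additive(3)[of a 0 0 n] F_closed(1) by simp_all

lemma \<Theta>_hom: "g \<in> C \<Longrightarrow> fs (\<Theta> g)" "g \<in> C \<Longrightarrow> h \<in> C \<Longrightarrow> \<Theta> (g + h) = \<Theta> g + \<Theta> h"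
  "g \<in> C \<Longrightarrow> \<Theta> (cs_smul (base_change F) r g) = AS_smul r (\<Theta> g)"
  "g \<in> C \<Longrightarrow> \<Theta> (cs_der (base_change F) g) = AS_der (\<Theta> g)"
  "g \<in> C \<Longrightarrow> h \<in> C \<Longrightarrow> \<Theta> (cs_prod (base_change F) n g h) = AS_prod n (\<Theta> g) (\<Theta> h)"
  using iso by (auto simp: csa_iso_def csa_hom_def)

lemma \<Theta>_even: "g \<in> C \<Longrightarrow> (\<And>q. g q \<in> cs_even F) \<Longrightarrow> AS_even (\<Theta> g)"
  and \<Theta>_odd: "g \<in> C \<Longrightarrow> (\<And>q. g q \<in> cs_odd F) \<Longrightarrow> AS_odd (\<Theta> g)"
  using iso by (auto simp: csa_iso_def csa_hom_def base_change_simps(3,4))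

lemma \<Theta>_bij: "bij_betw \<Theta> C {f. fs f}"
  using iso by (simp add: csa_iso_def)

lemma C_iff: "g \<in> C \<longleftrightarrow> fs g \<and> supp g \<subseteq> {0..<1} \<and> (\<forall>q. g q \<in> M)"
  by (simp add: base_change_simps)

lemma at_pt_in_C: "0 \<le> q \<Longrightarrow> q < 1 \<Longrightarrow> a \<in> M \<Longrightarrow> at_pt q a \<in> C"
  by (simp add: C_iff supp_at_pt at_pt_apply F_closed)

lemma C_add: "g \<in> C \<Longrightarrow> h \<in> C \<Longrightarrow> g + h \<in> C"
  using supp_add[of g h] by (auto simp: C_iff plus_fun_apply F_closed)

lemma C_0: "0 \<in> C"
  by (simp add: C_iff zero_fun_apply F_closed)

definition \<iota> :: "'f \<Rightarrow> rat \<Rightarrow> 'k N2" where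
  "\<iota> a = \<Theta> (at_pt 0 a)"

text \<open>For scalars in R every fractional part is 0, so the normal form of a (x) r is (r a) (x)
  1.\<close>

lemma embedR_R:
  assumes r: "r \<in> R_set" and a: "a \<in> M"
  shows "embedR F a r = at_pt 0 (sm r a)"
proof -
  let ?s = "\<lambda>p. Poly_Mapping.single p (Poly_Mapping.lookup r p)"
  have Z: "p \<in> \<int>" if "p \<in> Poly_Mapping.keys r" for p
    using r that by (auto simp: R_set_def)
  have "embedR F a r = (\<Sum>p\<in>Poly_Mapping.keys r. at_pt 0 (sm (?s p) a))"
    unfolding embedR_def
  proof (rule sum.cong, goal_cases)
    case (2 p)
    from Z[OF 2] obtain k where "p = of_int k"
      by (auto elim: Ints_cases)
    then show ?case
      by simp
  qed simp
  also have "\<dots> = at_pt 0 (\<Sum>p\<in>Poly_Mapping.keys r. sm (?s p) a)"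
    by (simp add: at_pt_sum)
  also have "(\<Sum>p\<in>Poly_Mapping.keys r. sm (?s p) a) = sm (\<Sum>p\<in>Poly_Mapping.keys r. ?s p) a"
  proof -
    have "(\<Sum>p\<in>A. ?s p) \<in> R_set \<and> (\<Sum>p\<in>A. sm (?s p) a) = sm (\<Sum>p\<in>A. ?s p) a" if "A \<subseteq> Poly_Mapping.keys r" for A
      using finite_subset[OF that finite_keys] that
    proof (induction A rule: finite_induct)
      case (insert p A)
      then have "?s p \<in> R_set"
        using Z by (auto intro: R_set_single)
      with insert show ?case
        using a by (simp add: R_set_add F_smul(2))
    qed (use a in \<open>simp_all add: R_set_0 sm_0\<close>)
    then show ?thesis
      by auto
  qed
  finally show ?thesis
    by (simp add: single_sum)
qed

lemma base_smul_at_pt_0: "a \<in> M \<Longrightarrow> cs_smul (base_change F) r (at_pt 0 a) = (if a = 0 then 0 else embedR F a r)"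
  by (simp add: base_change_simps supp_at_pt at_pt_apply tpow_def)

lemma \<iota>_smul: "r \<in> R_set \<Longrightarrow> a \<in> M \<Longrightarrow> \<iota> (sm r a) = AS_smul r (\<iota> a)"
  using \<Theta>_hom(3)[of "at_pt 0 a" r] at_pt_in_C[of 0 a]
  by (auto simp: \<iota>_def base_smul_at_pt_0 embedR_R sm_zero split: if_splits)

lemma fs_\<iota> [simp]: "a \<in> M \<Longrightarrow> fs (\<iota> a)"
  by (simp add: \<iota>_def \<Theta>_hom at_pt_in_C)

lemma \<iota>_add: "a \<in> M \<Longrightarrow> b \<in> M \<Longrightarrow> \<iota> (a + b) = \<iota> a + \<iota> b"
  by (simp add: \<iota>_def at_pt_add \<Theta>_hom at_pt_in_C)

lemma \<Theta>_at_pt: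
  assumes "0 \<le> q" "q < 1" "a \<in> M"
  shows "\<Theta> (at_pt q a) = AS_smul (tpow q) (\<iota> a)"
proof -
  have "\<lfloor>q\<rfloor> = 0" "frac q = q"
    using assms by (auto simp: floor_eq_iff frac_eq)
  then have "embedR F a (tpow q) = at_pt q a"
    using assms by (simp add: embedR_def tpow_def F_smul(4))
  then have "cs_smul (base_change F) (tpow q) (at_pt 0 a) = at_pt q a"
    using assms by (simp add: base_smul_at_pt_0)
  then show ?thesis
    using \<Theta>_hom(3)[of "at_pt 0 a" "tpow q"] assms by (simp add: \<iota>_def at_pt_in_C)
qed

lemma \<iota>_der: "a \<in> M \<Longrightarrow> \<iota> (cs_der F a) = AS_der (\<iota> a)"
proof -
  assume a: "a \<in> M"
  have d0: "puis_deriv (tpow 0) = (0 :: 'k puis)"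
    unfolding tpow_def puis_deriv_single by simp
  have "cs_der (base_change F) (at_pt 0 a) = at_pt 0 (cs_der F a)"
    by (simp add: base_change_simps supp_at_pt at_pt_apply der_zero d0 embedR_def)
  then show ?thesis
    using \<Theta>_hom(4)[of "at_pt 0 a"] a by (simp add: \<iota>_def at_pt_in_C)
qed

lemma \<iota>_prod: "a \<in> M \<Longrightarrow> b \<in> M \<Longrightarrow> \<iota> (cs_prod F n a b) = AS_prod n (\<iota> a) (\<iota> b)"
proof -
  assume a: "a \<in> M" and b: "b \<in> M"
  let ?N = "prod_bound (cs_prod F) a b"
  have e: "embedR F (cs_prod F (n + j) a b) (kconst (inverse (fact j)) * (puis_deriv ^^ j) (tpow 0) * tpow 0)
      = (if j = 0 then at_pt 0 (cs_prod F n a b) else 0)" for j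
  proof (cases j)
    case 0
    then show ?thesis
      using embedR_R[OF R_set_1, of "cs_prod F n a b"] a b
      by (simp add: kconst_def tpow_def F_closed F_smul)
  next
    case (Suc i)
    then have "kconst (inverse (fact j)) * (puis_deriv ^^ j) (tpow 0) = (0 :: 'k puis)"
      unfolding divided_deriv_tpow by simp
    then show ?thesis
      using Suc by (simp only: mult_zero_left) (simp add: embedR_def)
  qed
  \<comment> \<open>If the cut-off is 0, the sum is empty and its term j = 0 is missing; the product
    itself is then zero.\<close>
  have "cs_prod F n a b = 0" if "?N = 0"
    using prod_bound_local[of "cs_prod F" a b n] F_local[OF a b] that by simp
  then have "(\<Sum>j<?N. if j = 0 then at_pt 0 (cs_prod F n a b) else 0) = at_pt (0::rat) (cs_prod F n a b)"
    by (cases ?N) (simp_all add: sum.delta)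
  then have "cs_prod (base_change F) n (at_pt 0 a) (at_pt 0 b) = at_pt 0 (cs_prod F n a b)"
    using a b by (simp add: base_change_simps supp_at_pt at_pt_apply prod_zero e del: One_nat_def)
  then show ?thesis
    using \<Theta>_hom(5)[of "at_pt 0 a" "at_pt 0 b" n] a b by (simp add: \<iota>_def at_pt_in_C)
qed

lemma \<iota>_inj: "inj_on \<iota> M"
proof (rule inj_onI)
  fix a b assume ab: "a \<in> M" "b \<in> M" "\<iota> a = \<iota> b"
  then have "at_pt (0::rat) a = at_pt 0 b"
    using bij_betw_imp_inj_on[OF \<Theta>_bij] at_pt_in_C[of 0] by (auto simp: \<iota>_def inj_on_def)
  from fun_cong[OF this, of 0] show "a = b"
    by (simp add: at_pt_apply)
qed

lemma \<iota>_parity: "a \<in> M \<Longrightarrow> a \<in> cs_even F \<Longrightarrow> AS_even (\<iota> a)" "a \<in> M \<Longrightarrow> a \<in> cs_odd F \<Longrightarrow> AS_odd (\<iota> a)"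
proof -
  have "0 \<in> cs_even F" "0 \<in> cs_odd F"
    using F_parity(1,2) by (auto simp: is_submod_def)
  then show "a \<in> M \<Longrightarrow> a \<in> cs_even F \<Longrightarrow> AS_even (\<iota> a)" "a \<in> M \<Longrightarrow> a \<in> cs_odd F \<Longrightarrow> AS_odd (\<iota> a)"
    unfolding \<iota>_def by (auto intro!: \<Theta>_even \<Theta>_odd at_pt_in_C simp: at_pt_apply)
qed

lemma kconst_R: "kconst c \<in> R_set"
  by (simp add: kconst_def R_set_single)

text \<open>This is 1 (x) Gamma: on the basis t^q it acts by the constant chi(q), which F can
  multiply by since constants lie in R.\<close>

definition \<Gamma> :: "(rat \<Rightarrow> 'f) \<Rightarrow> rat \<Rightarrow> 'f" where
  "\<Gamma> g = (\<lambda>q. sm (kconst (chi q)) (g q))"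

lemma \<Gamma>_C: "g \<in> C \<Longrightarrow> \<Gamma> g \<in> C"
proof -
  assume g: "g \<in> C"
  then have "supp (\<Gamma> g) \<subseteq> supp g"
    by (auto simp: supp_def \<Gamma>_def sm_zero kconst_R)
  then show ?thesis
    using g by (auto simp: C_iff \<Gamma>_def F_closed kconst_R dest: finite_subset)
qed

lemma \<Gamma>_add: "g \<in> C \<Longrightarrow> h \<in> C \<Longrightarrow> \<Gamma> (g + h) = \<Gamma> g + \<Gamma> h"
  by (auto simp: \<Gamma>_def plus_fun_apply C_iff F_smul kconst_R)

lemma \<Gamma>_pow: "g \<in> C \<Longrightarrow> (\<Gamma> ^^ n) g = (\<lambda>q. sm (kconst (chi q ^ n)) (g q))"
proof (induction n)
  case 0
  then show ?case
    by (auto simp: kconst_def C_iff F_smul)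
next
  case (Suc n)
  have "kconst (chi q ^ Suc n) = kconst (chi q) * kconst (chi q ^ n)" for q
    by (simp add: kconst_def mult_single)
  with Suc show ?case
    by (auto simp: \<Gamma>_def C_iff F_smul kconst_R)
qed

definition \<Theta>' :: "(rat \<Rightarrow> 'k N2) \<Rightarrow> rat \<Rightarrow> 'f" where
  "\<Theta>' = inv_into C \<Theta>"

lemma \<Theta>'_C: "fs f \<Longrightarrow> \<Theta>' f \<in> C" and \<Theta>_\<Theta>': "fs f \<Longrightarrow> \<Theta> (\<Theta>' f) = f" and \<Theta>'_\<Theta>: "g \<in> C \<Longrightarrow> \<Theta>' (\<Theta> g) = g"
  using \<Theta>_bij by (auto simp: \<Theta>'_def bij_betw_def inv_into_into f_inv_into_f)

text \<open>The Galois generator of the base change of F, transported to A (x) S-hat.\<close>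

definition T :: "(rat \<Rightarrow> 'k N2) \<Rightarrow> rat \<Rightarrow> 'k N2" where
  "T f = \<Theta> (\<Gamma> (\<Theta>' f))"

lemma T_\<Theta>: "g \<in> C \<Longrightarrow> T (\<Theta> g) = \<Theta> (\<Gamma> g)"
  by (simp add: T_def \<Theta>'_\<Theta>)

lemma fs_T [simp]: "fs f \<Longrightarrow> fs (T f)"
  by (simp add: T_def \<Theta>_hom \<Gamma>_C \<Theta>'_C)

lemma T_add: "fs f \<Longrightarrow> fs g \<Longrightarrow> T (f + g) = T f + T g"
  using T_\<Theta>[of "\<Theta>' f + \<Theta>' g"] T_\<Theta>[of "\<Theta>' f"] T_\<Theta>[of "\<Theta>' g"]
  by (simp add: \<Theta>_hom \<Theta>'_C C_add \<Gamma>_add \<Gamma>_C \<Theta>_\<Theta>')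

text \<open>The integral power of t is moved into F, leaving the basis element with exponent frac q;
  and chi(frac q) = chi(q).\<close>

lemma T_\<iota>:
  assumes a: "a \<in> M"
  shows "T (AS_smul (Poly_Mapping.single q c) (\<iota> a)) = AS_smul (Poly_Mapping.single q (chi q * c)) (\<iota> a)"
proof -
  let ?b = "sm (Poly_Mapping.single (of_int \<lfloor>q\<rfloor>) c) a"
  have R: "Poly_Mapping.single (of_int \<lfloor>q\<rfloor>) c \<in> R_set" for c :: 'k
    by (simp add: R_set_single)
  have b: "?b \<in> M"
    by (simp add: F_closed R a)
  have q: "0 \<le> frac q" "frac q < 1"
    by (simp_all add: frac_ge_0 frac_lt_1)
  have "AS_smul (Poly_Mapping.single q c) (\<iota> a) = AS_smul (tpow (frac q)) (AS_smul (Poly_Mapping.single (of_int \<lfloor>q\<rfloor>) c) (\<iota> a))"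
    using a by (simp add: AS_smul_mult[symmetric] tpow_def mult_single rat_frac_floor)
  also have "\<dots> = \<Theta> (at_pt (frac q) ?b)"
    by (simp add: \<Theta>_at_pt q b \<iota>_smul R a)
  finally have "T (AS_smul (Poly_Mapping.single q c) (\<iota> a)) = \<Theta> (\<Gamma> (at_pt (frac q) ?b))"
    by (simp add: T_\<Theta> at_pt_in_C q b)
  also have "\<Gamma> (at_pt (frac q) ?b) = at_pt (frac q) (sm (kconst (chi (frac q))) ?b)"
    by (auto simp: \<Gamma>_def at_pt_def sm_zero kconst_R)
  also have "\<Theta> \<dots> = AS_smul (tpow (frac q)) (AS_smul (kconst (chi (frac q))) (AS_smul (Poly_Mapping.single (of_int \<lfloor>q\<rfloor>) c) (\<iota> a)))"
    by (simp add: \<Theta>_at_pt q b F_closed kconst_R \<iota>_smul R a)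
  also have "\<dots> = AS_smul (Poly_Mapping.single q (chi (frac q) * c)) (\<iota> a)"
    using a by (simp add: AS_smul_mult[symmetric] tpow_def kconst_def mult_single rat_frac_floor)
  also have "chi (frac q) = chi q"
    using chi_add[of "frac q" "of_int \<lfloor>q\<rfloor>"] by (simp add: rat_frac_floor chi_of_int)
  finally show ?thesis .
qed

text \<open>Since \<open>\<Theta>\<close> is onto, the image of F spans A (x) S-hat over S-hat.
  Semilinearity and multiplicativity of \<open>T\<close> can thus be tested on multiples of elements
  \<open>\<iota> a\<close>.\<close>

lemma \<iota>_induct [consumes 1, case_names \<iota> add]:
  assumes f: "fs f" and i: "\<And>q c a. a \<in> M \<Longrightarrow> P (AS_smul (Poly_Mapping.single q c) (\<iota> a))"
    and add: "\<And>f g. fs f \<Longrightarrow> fs g \<Longrightarrow> P f \<Longrightarrow> P g \<Longrightarrow> P (f + g)"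
  shows "P f"
proof -
  have z: "P 0"
    using i[OF F_closed(1), of 0 0] by simp
  define g where "g = \<Theta>' f"
  have g: "g \<in> C" "\<Theta> g = f"
    using f by (simp_all add: g_def \<Theta>'_C \<Theta>_\<Theta>')
  have "(\<Sum>q\<in>A. at_pt q (g q)) \<in> C \<and> P (\<Theta> (\<Sum>q\<in>A. at_pt q (g q)))" if "A \<subseteq> supp g" "finite A" for A
    using that(2,1)
  proof (induction A rule: finite_induct)
    case empty
    have "\<Theta> 0 = 0"
      using \<Theta>_hom(2)[OF C_0 C_0] by simp
    then show ?case
      by (simp add: C_0 z)
  next
    case (insert q A)
    let ?s = "\<Sum>q\<in>A. at_pt q (g q)"
    have q: "0 \<le> q" "q < 1" "g q \<in> M"
      using insert.prems g by (auto simp: C_iff)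
    have s: "?s \<in> C" "P (\<Theta> ?s)"
      using insert by auto
    have pq: "at_pt q (g q) \<in> C"
      using q by (rule at_pt_in_C)
    have "P (\<Theta> (at_pt q (g q)))"
      unfolding \<Theta>_at_pt[OF q] tpow_def by (rule i[OF q(3)])
    then have "P (\<Theta> (at_pt q (g q)) + \<Theta> ?s)"
      by (intro add \<Theta>_hom(1) pq s)
    then have "P (\<Theta> (at_pt q (g q) + ?s))"
      using \<Theta>_hom(2)[OF pq s(1)] by simp
    then show ?case
      using C_add[OF pq s(1)] insert.hyps by simp
  qed
  from this[of "supp g"] g show ?thesis
    by (auto simp: C_iff fs_decomp)
qed

text \<open>\<open>T\<close> fixes the image of F and multiplies t^q by chi(q). In a product of t^p
  \<open>\<iota> a\<close> and t^q \<open>\<iota> b\<close> all exponents are p + q - j, with the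
  common factor chi(p + q), and the products of a and b lie in F again.\<close>

lemma conf_hom_T: "conf_hom chi T"
proof -
  have T0: "T 0 = 0"
    using T_add[of 0 0] by simp
  have Tsum: "T (\<Sum>i\<in>A. h i) = (\<Sum>i\<in>A. T (h i))" if "finite A" "\<And>i. fs (h i)" for A :: "nat set" and h
    using that(1)
  proof (induction A rule: finite_induct)
    case (insert x A)
    have "T (h x + sum h A) = T (h x) + T (sum h A)"
      by (rule T_add) (simp_all add: that fs_sum)
    with insert show ?case
      by simp
  qed (simp add: T0)
  have S: "T (AS_smul (Poly_Mapping.single p d) f) = AS_smul (Poly_Mapping.single p (chi p * d)) (T f)" if "fs f" for p d f
    using that
  proof (induction rule: \<iota>_induct)
    case (\<iota> q c a)
    then show ?case
      by (simp add: AS_smul_mult[symmetric] mult_single T_\<iota> chi_add mult_ac)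
  qed (simp add: AS_smul_add T_add)
  have D: "T (AS_der f) = AS_der (T f)" if "fs f" for f
    using that
  proof (induction rule: \<iota>_induct)
    case (\<iota> q c a)
    then show ?case
      by (simp add: AS_der_smul_single T_add \<iota>_der[symmetric] F_closed T_\<iota> chi_diff_1 mult_ac)
  qed (simp add: AS_der_add T_add)
  have P: "T (AS_prod n f g) = AS_prod n (T f) (T g)" if "fs f" "fs g" for n f g
    using that(1)
  proof (induction rule: \<iota>_induct)
    case (\<iota> p c a)
    note a = this
    from that(2) show ?case
    proof (induction rule: \<iota>_induct)
      case (\<iota> q d b)
      obtain N where N: "\<forall>m\<ge>N. AS_prod m (\<iota> a) (\<iota> b) = 0"
        using AS_prod_local[of "\<iota> a" "\<iota> b"] a \<iota> by auto
      have e: "AS_prod n (AS_smul (Poly_Mapping.single p c) (\<iota> a)) (AS_smul (Poly_Mapping.single q d) (\<iota> b)) =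
        (\<Sum>j<N. AS_smul (Poly_Mapping.single (q + (p - of_nat j)) (d * ((of_rat p gchoose j) * c))) (\<iota> (cs_prod F (n + j) a b)))" for c d
      proof -
        have "AS_prod n (AS_smul (Poly_Mapping.single p c) (\<iota> a)) (AS_smul (Poly_Mapping.single q d) (\<iota> b)) =
          AS_smul (Poly_Mapping.single q d) (AS_prod n (AS_smul (Poly_Mapping.single p c) (\<iota> a)) (\<iota> b))"
          using a \<iota> by (simp add: AS_prod_smul_right)
        also have "\<dots> = (\<Sum>j<N. AS_smul (Poly_Mapping.single q d) (AS_smul (Poly_Mapping.single (p - of_nat j) ((of_rat p gchoose j) * c)) (AS_prod (n + j) (\<iota> a) (\<iota> b))))"
          unfolding AS_prod_smul_left[OF fs_\<iota>[OF a] fs_\<iota>[OF \<iota>] N] by (rule AS_smul_sum) simp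
        also have "\<dots> = (\<Sum>j<N. AS_smul (Poly_Mapping.single (q + (p - of_nat j)) (d * ((of_rat p gchoose j) * c))) (\<iota> (cs_prod F (n + j) a b)))"
          using a \<iota> by (simp add: AS_smul_mult[symmetric] mult_single \<iota>_prod)
        finally show ?thesis .
      qed
      show ?case
        unfolding T_\<iota>[OF a] T_\<iota>[OF \<iota>] e
        using a \<iota> by (subst Tsum) (simp_all add: F_closed T_\<iota> chi_add chi_diff_nat mult_ac)
    qed (use a in \<open>simp add: AS_prod_add_right T_add\<close>)
  qed (simp add: AS_prod_add_left T_add)
  show ?thesis
    using S D P by (simp add: conf_hom_def conf_lin_def T_add)
qed

text \<open>Isomorphisms are only required to send even to even and odd to odd, so parity of a
  preimage has to be derived: the image of its even part is even and, as a difference of odd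
  elements, odd, hence zero.\<close>

lemma T_odd:
  assumes f: "fs f" "AS_odd f"
  shows "AS_odd (T f)"
proof -
  define g where "g = \<Theta>' f"
  have g: "g \<in> C" "\<Theta> g = f"
    using f by (simp_all add: g_def \<Theta>'_C \<Theta>_\<Theta>')
  have E: "cs_even F \<subseteq> M" "0 \<in> cs_even F" and O: "cs_odd F \<subseteq> M" "0 \<in> cs_odd F"
    and Os: "\<And>r a. r \<in> R_set \<Longrightarrow> a \<in> cs_odd F \<Longrightarrow> sm r a \<in> cs_odd F"
    using F_parity(1,2) by (auto simp: is_submod_def)
  \<comment> \<open>Choosing (0, 0) wherever g(q) = 0 keeps the supports of both parts
    finite.\<close>
  have "\<forall>q. \<exists>xy. fst xy \<in> cs_even F \<and> snd xy \<in> cs_odd F \<and> g q = fst xy + snd xy \<and> (g q = 0 \<longrightarrow> xy = (0, 0))"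
  proof
    fix q
    show "\<exists>xy. fst xy \<in> cs_even F \<and> snd xy \<in> cs_odd F \<and> g q = fst xy + snd xy \<and> (g q = 0 \<longrightarrow> xy = (0, 0))"
    proof (cases "g q = 0")
      case True
      then show ?thesis
        using E O by (intro exI[of _ "(0, 0)"]) simp
    next
      case False
      then show ?thesis
        using F_parity(3)[of "g q"] g by (force simp: C_iff)
    qed
  qed
  then obtain w where w: "\<And>q. fst (w q) \<in> cs_even F" "\<And>q. snd (w q) \<in> cs_odd F" "\<And>q. g q = fst (w q) + snd (w q)"
    "\<And>q. g q = 0 \<Longrightarrow> w q = (0, 0)"
    by metis
  define gx where "gx = (\<lambda>q. fst (w q))"
  define gy where "gy = (\<lambda>q. snd (w q))"
  have "supp gx \<subseteq> supp g" "supp gy \<subseteq> supp g"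
    using w(4) by (force simp: supp_def gx_def gy_def)+
  then have C: "gx \<in> C" "gy \<in> C"
    using g w(1,2) E O by (auto simp: C_iff gx_def gy_def dest: finite_subset)
  have "g = gx + gy"
    by (auto simp: gx_def gy_def plus_fun_apply w(3))
  then have "f = \<Theta> gx + \<Theta> gy"
    using g C \<Theta>_hom(2) by metis
  moreover have "AS_even (\<Theta> gx)" "AS_odd (\<Theta> gy)"
    using C w(1,2) by (auto intro: \<Theta>_even \<Theta>_odd simp: gx_def gy_def)
  ultimately have "\<Theta> gx = 0"
    using f(2)
    by (intro ext, rename_tac q z, case_tac z) (auto simp: AS_even_def AS_odd_def vanishes_def fun_ops)
  then have "f = \<Theta> gy"
    using \<open>f = \<Theta> gx + \<Theta> gy\<close> by simp
  then have "T f = \<Theta> (\<Gamma> gy)"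
    using T_\<Theta>[OF C(2)] by simp
  moreover have "AS_odd (\<Theta> (\<Gamma> gy))"
    by (rule \<Theta>_odd) (use \<Gamma>_C[OF C(2)] w(2) in \<open>auto simp: \<Gamma>_def gy_def Os kconst_R\<close>)
  ultimately show ?thesis
    by simp
qed

text \<open>Finitely many exponents q occur in the normal form of f; for a common denominator n all
  chi(q)^n are 1. This n depends on f.\<close>

lemma T_finite_order:
  assumes f: "fs f"
  shows "\<exists>n>0. (T ^^ n) f = f"
proof -
  define g where "g = \<Theta>' f"
  have g: "g \<in> C" "\<Theta> g = f"
    using f by (simp_all add: g_def \<Theta>'_C \<Theta>_\<Theta>')
  then obtain n where n: "n > 0" "\<forall>q\<in>supp g. of_nat n * q \<in> (\<int> :: rat set)"
    using common_denominator[of "supp g"] by (auto simp: C_iff)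
  have "(T ^^ k) f = \<Theta> ((\<Gamma> ^^ k) g) \<and> (\<Gamma> ^^ k) g \<in> C" for k
    by (induction k) (use g in \<open>auto simp: T_\<Theta> \<Gamma>_C\<close>)
  moreover have "(\<Gamma> ^^ n) g = g"
    unfolding \<Gamma>_pow[OF g(1)]
  proof
    fix q
    show "sm (kconst (chi q ^ n)) (g q) = g q"
    proof (cases "g q = 0")
      case True
      then show ?thesis
        by (simp add: sm_zero kconst_R)
    next
      case False
      then have "chi q ^ n = 1"
        using n unfolding chi_power[symmetric] by (simp add: chi_eq_1_iff supp_def)
      then show ?thesis
        using g by (simp add: kconst_def C_iff F_smul)
    qed
  qed
  ultimately show ?thesis
    using n g by metis
qed

text \<open>A fixed normal form satisfies (chi(q) - 1) g(q) = 0, and chi(q) - 1 is invertible in k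
  for 0 < q < 1, so only the coordinate at q = 0 survives.\<close>

lemma \<iota>_image: "\<iota> ` M = {f. fs f \<and> T f = f}"
proof safe
  fix a assume a: "a \<in> M"
  then show "fs (\<iota> a)"
    by simp
  show "T (\<iota> a) = \<iota> a"
    using T_\<iota>[OF a, of 0 1] a by simp
next
  fix f assume f: "fs f" "T f = f"
  define g where "g = \<Theta>' f"
  have g: "g \<in> C" "\<Theta> g = f"
    using f by (simp_all add: g_def \<Theta>'_C \<Theta>_\<Theta>')
  then have "\<Theta> (\<Gamma> g) = \<Theta> g"
    using f T_\<Theta>[of g] by simp
  then have \<Gamma>g: "\<Gamma> g = g"
    using \<Theta>'_\<Theta>[of g] \<Theta>'_\<Theta>[of "\<Gamma> g"] g \<Gamma>_C by metis
  have "g q = 0" if "q \<noteq> 0" for q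
  proof (cases "chi q = 1")
    case True
    then have "q \<in> \<int>"
      by (simp add: chi_eq_1_iff)
    then have "\<not> (0 \<le> q \<and> q < 1)"
      using that by (auto elim!: Ints_cases)
    then show ?thesis
      using g by (auto simp: C_iff supp_def)
  next
    case False
    have gq: "g q \<in> M"
      using g by (simp add: C_iff)
    let ?d = "kconst (chi q - 1)"
    have "kconst (chi q) = ?d + 1"
      by (simp add: kconst_def single_diff)
    then have "sm (kconst (chi q)) (g q) = sm ?d (g q) + g q"
      using F_smul(2)[of ?d 1 "g q"] gq by (simp add: kconst_R R_set_1 F_smul(4))
    then have "sm ?d (g q) = 0"
      using fun_cong[OF \<Gamma>g, of q] by (simp add: \<Gamma>_def)
    then have "sm (kconst (inverse (chi q - 1)) * ?d) (g q) = 0"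
      using gq by (simp add: F_smul(3) kconst_R sm_zero)
    moreover have "kconst (inverse (chi q - 1)) * ?d = 1"
      using False by (simp add: kconst_def mult_single)
    ultimately show ?thesis
      using gq by (simp add: F_smul(4))
  qed
  then have "g = at_pt 0 (g 0)"
    by (auto simp: at_pt_def)
  then have "f = \<iota> (g 0)"
    using g by (metis \<iota>_def)
  moreover have "g 0 \<in> M"
    using g by (simp add: C_iff)
  ultimately show "f \<in> \<iota> ` M"
    by blast
qed

lemma \<iota>_iso: "csa_iso R_set F (fix_csa T) \<iota>"
proof -
  have E: "cs_even F \<subseteq> M" and O: "cs_odd F \<subseteq> M"
    using F_parity(1,2) by (auto simp: is_submod_def)
  have c: "fs (\<iota> a) \<and> T (\<iota> a) = \<iota> a" if "a \<in> M" for a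
    using \<iota>_image that by blast
  have "bij_betw \<iota> M {f. fs f \<and> T f = f}"
    using \<iota>_inj \<iota>_image by (simp add: bij_betw_def)
  then show ?thesis
    unfolding csa_iso_def csa_hom_def
    using c E O by (auto simp: \<iota>_add \<iota>_smul \<iota>_der \<iota>_prod \<iota>_parity subset_iff)
qed

lemma form_classification:
  assumes alg_closed: "\<forall>p :: 'k poly. degree p > 0 \<longrightarrow> (\<exists>x. poly p x = 0)"
  shows "(\<exists>\<psi>. csa_iso R_set F (loop xi 1 id) \<psi>) \<or> (\<exists>\<psi>. csa_iso R_set F (loop xi 2 omega) \<psi>)"
proof -
  have o: "AS_odd (Gen gGp :: rat \<Rightarrow> 'k N2)" "AS_odd (Gen gGm :: rat \<Rightarrow> 'k N2)"
    by (auto simp: Gen_def AS_odd_def intro: vanishes_at_pt_gmon)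
  obtain n where n: "n > 0" "(T ^^ n) (Gen gGp) = Gen gGp"
    using T_finite_order[OF fs_Gen] by blast
  have T0: "T 0 = 0"
    using T_add[of 0 0] by simp
  \<comment> \<open>Some positive power of \<open>T\<close> returns G+ to itself, so
    \<open>T\<close> cannot kill it.\<close>
  have nz: "T (Gen gGp) \<noteq> 0"
  proof
    assume "T (Gen gGp) = 0"
    then have "(T ^^ Suc k) (Gen gGp) = 0" for k
      by (induction k) (simp_all add: T0)
    from this[of "n - 1"] n have "Gen gGp = (0 :: rat \<Rightarrow> 'k N2)"
      by simp
    then show False
      by (simp add: Gen_def at_pt_eq_0_iff)
  qed
  have "(\<exists>\<phi>. csa_iso UNIV (fix_csa T) (loop xi 1 id) \<phi>) \<or> (\<exists>\<phi>. csa_iso UNIV (fix_csa T) (loop xi 2 omega) \<phi>)"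
    by (rule fix_csa_classification[OF alg_closed conf_hom_T]) (use T_odd o n nz in auto)
  then show ?thesis
    using csa_iso_trans[OF \<iota>_iso] csa_iso_subset[of UNIV _ _ _ R_set] by blast
qed

end

text \<open>Both representatives are themselves twisted loop algebras, for (1, id) and, by the first
  clause, for (2, omega); with the second and third clauses this means exactly two. Since
  \<open>k_set\<close> lies in \<open>R_set\<close>, non-isomorphy over k includes that over R.
  \<open>loop xi 1 id\<close> plays the part of A (x) R.\<close>

theorem theorem4p20:
  fixes xi :: "nat \<Rightarrow> 'k::field_char_0"
  assumes alg_closed: "\<forall>p :: 'k poly. degree p > 0 \<longrightarrow> (\<exists>x. poly p x = 0)"
    and xi_prim: "\<forall>m>0. xi m ^ m = 1 \<and> (\<forall>j. 0 < j \<and> j < m \<longrightarrow> xi m ^ j \<noteq> 1)"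
    and xi_compat: "\<forall>m>0. \<forall>l>0. xi (m * l) ^ l = xi m"
  shows
    "csa_iso k_set N2_csa N2_csa omega \<and> omega ^^ 2 = id
   \<and> (\<forall>(m::nat) \<sigma>. m > 0 \<and> csa_iso k_set N2_csa N2_csa \<sigma> \<and> \<sigma> ^^ m = id \<longrightarrow>
        (\<exists>\<phi>. csa_iso k_set (loop xi m \<sigma>) (loop xi 1 id) \<phi>)
      \<or> (\<exists>\<phi>. csa_iso k_set (loop xi m \<sigma>) (loop xi 2 omega) \<phi>))
   \<and> \<not> (\<exists>\<phi>. csa_iso k_set (loop xi 1 id) (loop xi 2 omega) \<phi>)
   \<and> (\<forall>F :: ('k, 'f::ab_group_add) csa.
        is_csa R_set F
        \<and> (\<exists>\<phi>. csa_iso UNIV (base_change F) (base_change (loop xi 1 id)) \<phi>) \<longrightarrow>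
          (\<exists>\<psi>. csa_iso R_set F (loop xi 1 id) \<psi>)
        \<or> (\<exists>\<psi>. csa_iso R_set F (loop xi 2 omega) \<psi>))"
proof -
  interpret compatible_roots xi
    by unfold_locales (fact xi_prim, fact xi_compat)
  have loops: "(\<exists>\<phi>. csa_iso k_set (loop xi m \<sigma>) (loop xi 1 id) \<phi>) \<or> (\<exists>\<phi>. csa_iso k_set (loop xi m \<sigma>) (loop xi 2 omega) \<phi>)"
    if "m > 0" "csa_iso k_set N2_csa N2_csa \<sigma>" "\<sigma> ^^ m = id" for m \<sigma>
    using loop_classification[OF alg_closed that] csa_iso_subset[of UNIV _ _ _ k_set] by blast
  have forms: "(\<exists>\<psi>. csa_iso R_set F (loop xi 1 id) \<psi>) \<or> (\<exists>\<psi>. csa_iso R_set F (loop xi 2 omega) \<psi>)"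
    if F: "is_csa R_set F" "csa_iso UNIV (base_change F) (base_change (loop xi 1 id)) \<phi>"
    for F :: "('k, 'f) csa" and \<phi>
  proof -
    have "csa_iso UNIV (base_change F) AS_csa (mult_out \<circ> \<phi>)"
      using csa_iso_trans[OF F(2)[unfolded loop_id_eq] mult_out_iso] .
    with F(1) interpret conformal_form xi F "mult_out \<circ> \<phi>"
      by unfold_locales
    show ?thesis
      by (rule form_classification[OF alg_closed])
  qed
  show ?thesis
  proof (intro conjI allI impI)
    show "csa_iso k_set N2_csa N2_csa omega" "omega ^^ 2 = id"
      by (rule omega_csa_iso omega_pow_2)+
    show "\<not> (\<exists>\<phi>. csa_iso k_set (loop xi 1 id) (loop xi 2 omega) \<phi>)"
      using loops_not_isomorphic by blast
  qed (elim conjE exE, rule loops forms, assumption+)+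
qed

end
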